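(* Let $(k_n)_{n\in\mathbb{N}}$ be a sequence of positive numbers and $(P_n)_{n\in\mathbb{N}}$ a sequence of entire functions of genus zero, written as $P_n(z)=a_nz^{\alpha_n}\prod_j(1-z/z_{n,j})$, with $k_n\ge d^*(P_n)$ for all $n$. Let $E\subseteq\mathbb{C}$ be a closed set such that $$\limsup_{R\to\infty}\frac{\log \mathrm{cap}(E_R)}{\log R}=\beta>0,\qquad E_R=E\cap\{z:|z|\le R\}.$$ Assume that $$\lim_{R\to\infty}\limsup_{n\to\infty}\frac{\left|\sum_{|z_{n,j}|\ge R}1/z_{n,j}\right|}{k_n}=0,$$ and that there exists a sequence $(R_n)$ of positive real numbers tending to $\infty$ such that $$\limsup_{n\to\infty}\frac{\eta(P_n,R_n)}{k_n}<\infty.$$ Let $h:[0,\infty)\to(0,\infty)$ be a function and $\gamma$ a real number with $$\limsup_{R\to\infty}\frac{\log h(R)}{\log R}\le\gamma<\infty.$$ If for all $z\in E$ we have $$\limsup_{n\to\infty}|P_n(z)|^{1/k_n}\le h(|z|),$$ then for all $R>0$ we have $$\limsup_{n\to\infty}\|P_n\|_R^{1/k_n}\le C_0(1+R)^{\gamma/\beta},$$ where $C_0=\limsup_{n\to\infty}C(P_n,1)^{1/k_n}$.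
   Context: An entire function $P(z)=\sum_{m\ge 0}c_mz^m$ (not identically zero) is called of genus zero if its order $\rho=\limsup_{m\to\infty}\frac{m\log m}{\log(1/|c_m|)}$ is less than $1$. Such a $P$ factorizes as $P(z)=az^{\alpha}\prod_j(1-z/z_j)$, where $a\ne 0$, $\alpha\in\{0,1,2,\dots\}$, and $(z_j)$ is the (finite or infinite) list of nonzero zeros of $P$, repeated according to multiplicity, with $\sum_j 1/|z_j|<\infty$. The "degree" of $P$ is $$d^*(P)=\alpha+\sum_{|z_j|\le 1}1+\sum_{|z_j|>1}\frac{1}{|z_j|}.$$ For an entire function $f$ and $R>0$: $\|f\|_R=\sup_{|z|\le R}|f(z)|$, $C(f,R)=\exp\left\{\frac{1}{2\pi}\int_0^{2\pi}\log|f(Re^{it})|\,dt\right\}$, and $\eta(f,R)$ is the number of zeros $z$ of $f$ with $0<|z|\le R$, counted with multiplicity. $\mathrm{cap}(K)$ denotes the logarithmic capacity of a compact set $K\subset\mathbb{C}$. *)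

theory Defs
  imports "HOL-Complex_Analysis.Complex_Analysis" "HOL-Probability.Probability"
begin

(* The library has ln 0 = 0 on the reals; wherever log 0 can occur, the value -\<infinity> is meant. *)
definition ereal_ln :: "real \<Rightarrow> ereal" where
  "ereal_ln x = (if x \<le> 0 then - \<infinity> else ereal (ln x))"

(* The denominator is log (1/|c_m|), so vanishing coefficients contribute x/\<infinity> = 0. *)
definition entire_order :: "(complex \<Rightarrow> complex) \<Rightarrow> ereal" where
  "entire_order f = limsup (\<lambda>m.
     ereal (real m * ln (real m)) / (- ereal_ln (norm (fps_nth (fps_expansion f 0) m))))"

definition genus_zero :: "(complex \<Rightarrow> complex) \<Rightarrow> bool" where
  "genus_zero f \<longleftrightarrow> f holomorphic_on UNIV \<and> (\<exists>z. f z \<noteq> 0) \<and> entire_order f < 1"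

definition nonzero_zeros :: "(complex \<Rightarrow> complex) \<Rightarrow> complex set" where
  "nonzero_zeros f = {z. z \<noteq> 0 \<and> f z = 0}"

(* Sums over the list of nonzero zeros, repeated according to multiplicity, are written as sums
   over the set of zeros weighted by zorder f z.  For genus zero functions the infinite sums
   converge absolutely.  The exponent of the factor z^\<alpha> is zorder f 0, also when f 0 \<noteq> 0. *)
definition star_degree :: "(complex \<Rightarrow> complex) \<Rightarrow> real" where
  "star_degree f = of_int (zorder f 0)
     + (\<Sum>z\<in>{z \<in> nonzero_zeros f. norm z \<le> 1}. of_int (zorder f z))
     + (\<Sum>\<^sub>\<infinity>z\<in>{z \<in> nonzero_zeros f. norm z > 1}. of_int (zorder f z) / norm z)"

definition tail_sum :: "(complex \<Rightarrow> complex) \<Rightarrow> real \<Rightarrow> complex" where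
  "tail_sum f R = (\<Sum>\<^sub>\<infinity>z\<in>{z \<in> nonzero_zeros f. norm z \<ge> R}. of_int (zorder f z) / z)"

definition zero_count :: "(complex \<Rightarrow> complex) \<Rightarrow> real \<Rightarrow> real" where
  "zero_count f R = (\<Sum>z\<in>{z \<in> nonzero_zeros f. norm z \<le> R}. of_int (zorder f z))"

definition disc_norm :: "(complex \<Rightarrow> complex) \<Rightarrow> real \<Rightarrow> real" where
  "disc_norm f R = (SUP z\<in>cball 0 R. norm (f z))"

(* A nonzero entire function has only finitely many zeros on the circle, so the value of ln
   at 0 does not affect the integral. *)
definition circle_geo_mean :: "(complex \<Rightarrow> complex) \<Rightarrow> real \<Rightarrow> real" where
  "circle_geo_mean f R =
     exp (1 / (2 * pi) * (LINT t:{0..2 * pi}|lborel. ln (norm (f (of_real R * cis t)))))"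

(* The energy, i.e. the double integral of log (1/|z - w|), as positive part minus negative part;
   e2ennreal maps negative arguments to 0.  The kernel is \<infinity> on the diagonal.  For measures of
   bounded support the negative part is finite. *)
definition log_energy :: "complex measure \<Rightarrow> ereal" where
  "log_energy \<mu> =
     enn2ereal (\<integral>\<^sup>+ z. (\<integral>\<^sup>+ w. e2ennreal (- ereal_ln (dist z w)) \<partial>\<mu>) \<partial>\<mu>)
   - enn2ereal (\<integral>\<^sup>+ z. (\<integral>\<^sup>+ w. e2ennreal (ereal_ln (dist z w)) \<partial>\<mu>) \<partial>\<mu>)"

definition robin_constant :: "complex set \<Rightarrow> ereal" where
  "robin_constant K =
     Inf (log_energy ` {\<mu>. sets \<mu> = sets borel \<and> prob_space \<mu> \<and> emeasure \<mu> K = 1})"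

(* exp (- V) for the minimal energy V, which lies in (-\<infinity>, \<infinity>] when K is compact. *)
definition log_capacity :: "complex set \<Rightarrow> real" where
  "log_capacity K =
     (if robin_constant K = \<infinity> then 0 else exp (- real_of_ereal (robin_constant K)))"

end

theory Submission
  imports Defs
begin

text \<open>
  Jensen's formula and the Hadamard product express \<open>ln \<bar>P\<^sub>n(z)\<bar>\<close> as \<open>ln C(P\<^sub>n, 1)\<close> plus the sum of
  \<open>ln (\<bar>z - w\<bar> / max 1 \<bar>w\<bar>)\<close> over all zeros \<open>w\<close>; the zeros with \<open>\<bar>w\<bar> \<ge> S\<close> contribute only
  \<open>O(\<bar>z\<bar> \<bar>tail sum\<bar> + \<bar>z\<bar>\<^sup>2 k\<^sub>n / S)\<close>. As each term is at most \<open>ln (1 + \<bar>z\<bar>)\<close>, it suffices that along every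
  subsequence the number of zeros in large discs is asymptotically at most \<open>(\<gamma> / \<beta>) k\<^sub>n\<close>.
  To see this, integrate \<open>ln \<bar>P\<^sub>n\<bar> / k\<^sub>n\<close> against a probability measure on \<open>E\<^sub>R\<close> that nearly minimises the
  energy. Its potential is bounded below by \<open>ln cap E\<^sub>R - O(1)\<close> everywhere, so about \<open>\<kappa> k\<^sub>n\<close> zeros in a fixed
  disc force the integral to be at least \<open>\<kappa> \<beta> ln R - o(ln R)\<close> for suitable large \<open>R\<close>, whereas by Fatou's lemma the
  hypothesis on \<open>E\<close> bounds it by \<open>\<gamma> ln R + o(ln R)\<close>. If \<open>\<gamma> < 0\<close>, this gives \<open>\<kappa> = 0\<close>, and integrating over
  the part of \<open>E\<close> outside a large disc yields a contradiction.
\<close>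

section \<open>Logarithmic means over the unit circle\<close>

text \<open>A zero outside the disc of radius \<open>T\<close> but within radius \<open>S\<close>
  may lower the integral by as much as \<open>\<Lambda>\<close>, which can be of order ln R like the
  main term. So \<open>T\<close> has to capture almost all the zeros that any larger disc will ever
  contain; this is possible because the densities are bounded and increase with the disc. The
  choices are made in the order e, T, R, S, n. The capacity of the truncated set is known to be
  large only for arbitrarily large radii, but a single good \<open>R\<close> suffices. Since
  \<open>h\<close> is controlled near infinity only and may be unbounded on bounded sets, the
  bounded part of \<open>E\<close> is handled by an a priori bound for ln |P_n| / k_n. The resulting
  constant is harmless against a nonnegative power of R but would swamp a negative one, hence the
  separate argument for \<gamma> < 0. Additive constants in the potential do not matter either, as
  they are compared with ln R; this permits a near-minimiser and a crude maximum principle in place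
  of the equilibrium measure.\<close>

lemma norm_less_norm_diff_real:
  fixes z :: complex
  assumes "Re z < A" "A > 0"
  shows "norm z < norm (2 * complex_of_real A - z)"
proof -
  have "(norm z)^2 < (norm (2 * complex_of_real A - z))^2"
  proof -
    have "(norm (2 * complex_of_real A - z))^2 - (norm z)^2 = 4 * A * (A - Re z)"
      unfolding cmod_power2 by (simp add: power2_eq_square algebra_simps)
    moreover have "4 * A * (A - Re z) > 0" using assms by simp
    ultimately show ?thesis by linarith
  qed
  then show ?thesis by (rule power_less_imp_less_base) simp
qed

text \<open>Borel--Caratheodory for a logarithm of \<open>g\<close>, via the Schwarz lemma.\<close>
lemma ln_norm_zero_free_bound:
  assumes g: "g holomorphic_on ball 0 r" and r: "r > 0" and A: "A > 0"
    and nz: "\<And>z. norm z < r \<Longrightarrow> g z \<noteq> 0"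
    and bd: "\<And>z. norm z < r \<Longrightarrow> norm (g z) < norm (g 0) * exp A"
    and z: "norm z < r"
  shows "\<bar>ln (norm (g z)) - ln (norm (g 0))\<bar> \<le> 2 * A * norm z / (r - norm z)"
proof -
  obtain h where h: "h holomorphic_on ball 0 r" and gh: "\<And>z. z \<in> ball 0 r \<Longrightarrow> exp (h z) = g z"
    using holomorphic_logarithm_exists[of "ball 0 r" g 0] g nz r by (metis convex_ball open_ball centre_in_ball mem_ball_0)
  define F where "F = (\<lambda>w. h (of_real r * w) - h 0)"
  have lng: "ln (norm (g w)) = Re (h w)" if "norm w < r" for w
    using gh[of w] that by (metis ln_exp mem_ball_0 norm_exp_eq_Re)
  have ReF: "Re (F w) < A" if "norm w < 1" for w
  proof -
    have nw: "norm (of_real r * w) < r" using that r by (simp add: norm_mult)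
    have "norm (g (of_real r * w)) < norm (g 0) * exp A" using bd[OF nw] .
    then have "exp (Re (h (of_real r * w))) < exp (Re (h 0) + A)"
      using gh[of "of_real r * w"] gh[of 0] nw r by (metis centre_in_ball exp_add mem_ball_0 norm_exp_eq_Re)
    then show ?thesis by (simp add: F_def)
  qed
  have holF: "F holomorphic_on ball 0 1"
  proof -
    have "(h \<circ> (\<lambda>w. of_real r * w)) holomorphic_on ball 0 1"
      by (rule holomorphic_on_compose_gen[OF _ h]) (use r in \<open>auto intro!: holomorphic_intros simp: norm_mult\<close>)
    then show ?thesis unfolding F_def o_def by (intro holomorphic_intros)
  qed
  \<comment> \<open>The Moebius map \<open>w / (2 * A - w)\<close> takes the half-plane Re w < A
    into the unit disc and fixes 0, so the Schwarz lemma applies to \<open>p\<close>.\<close>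
  define p where "p = (\<lambda>w. F w / (2 * of_real A - F w))"
  have less: "norm (F w) < norm (2 * complex_of_real A - F w)" if "norm w < 1" for w
    using norm_less_norm_diff_real[OF ReF[OF that] A] .
  have p_le: "norm (p w) \<le> norm w" if "norm w < 1" for w
  proof (rule Schwarz_Lemma(1)[OF _ _ _ that])
    have "2 * complex_of_real A - F w \<noteq> 0" if "norm w < 1" for w using less[OF that] by auto
    then show "p holomorphic_on ball 0 1" unfolding p_def by (intro holomorphic_intros holF) auto
    show "p 0 = 0" by (simp add: p_def F_def)
    show "norm (p w) < 1" if "norm w < 1" for w
      using less[OF that] by (auto simp: p_def norm_divide divide_simps)
  qed
  define w where "w = z / of_real r"
  have w: "norm w = norm z / r" "norm w < 1" using z r by (auto simp: w_def norm_divide)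
  have "norm (p w) \<le> norm w" by (rule p_le[OF w(2)])
  then have "norm (F w) \<le> norm w * norm (2 * complex_of_real A - F w)"
    using less[OF w(2)] by (simp add: p_def norm_divide divide_simps split: if_splits)
  also have "\<dots> \<le> norm w * (2 * A + norm (F w))"
    using norm_triangle_ineq4[of "2 * complex_of_real A" "F w"] A by (intro mult_left_mono) (auto simp: norm_mult)
  finally have "norm (F w) * (1 - norm w) \<le> 2 * A * norm w" by (simp add: algebra_simps)
  then have "norm (F w) \<le> 2 * A * norm w / (1 - norm w)" using w(2) by (simp add: pos_le_divide_eq)
  also have "\<dots> = 2 * A * norm z / (r - norm z)" using r z w by (simp add: field_simps)
  finally have "norm (F w) \<le> 2 * A * norm z / (r - norm z)" .
  moreover have "\<bar>Re (F w)\<bar> \<le> norm (F w)" by (rule abs_Re_le_cmod)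
  moreover have "Re (F w) = ln (norm (g z)) - ln (norm (g 0))"
    using r z by (simp add: F_def w_def lng)
  ultimately show ?thesis by simp
qed

text \<open>Integrability is bundled with the value because the Bochner integral of a non-integrable
  function is 0; means can then be added without side conditions.\<close>

definition has_circle_mean :: "(real \<Rightarrow> real) \<Rightarrow> real \<Rightarrow> bool" where
  "has_circle_mean u m \<longleftrightarrow> set_integrable lborel {0..2 * pi} u \<and>
     (LINT t:{0..2 * pi}|lborel. u t) = 2 * pi * m"

lemma has_circle_mean_add:
  "has_circle_mean u m \<Longrightarrow> has_circle_mean v n \<Longrightarrow> has_circle_mean (\<lambda>t. u t + v t) (m + n)"
  by (auto simp: has_circle_mean_def set_integral_add algebra_simps)

lemma has_circle_mean_cmult:
  "has_circle_mean u m \<Longrightarrow> has_circle_mean (\<lambda>t. c * u t) (c * m)"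
  by (auto simp: has_circle_mean_def algebra_simps)

lemma has_circle_mean_const: "has_circle_mean (\<lambda>t. c) c"
  by (auto simp: has_circle_mean_def set_integral_const set_integrable_def mult.commute)

lemma has_circle_mean_sum:
  assumes "finite D" "\<And>w. w \<in> D \<Longrightarrow> has_circle_mean (u w) (m w)"
  shows "has_circle_mean (\<lambda>t. \<Sum>w\<in>D. u w t) (\<Sum>w\<in>D. m w)"
  using assms by (induction D) (auto intro: has_circle_mean_add has_circle_mean_const[of 0])

text \<open>Additivity of \<open>ln\<close> over a product fails at zeros on the circle, where
  \<open>ln 0 = 0\<close>. Measurability of \<open>v\<close> is assumed separately, since
  \<open>lborel\<close> is not complete.\<close>

lemma has_circle_mean_cong_AE:
  assumes "has_circle_mean u m" "AE t in lborel. u t = v t" "v \<in> borel_measurable borel"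
  shows "has_circle_mean v m"
proof -
  have i: "integrable lborel (\<lambda>t. indicator {0..2*pi} t *\<^sub>R u t)"
    using assms(1) by (simp add: has_circle_mean_def set_integrable_def)
  have m: "(\<lambda>t. indicator {0..2*pi} t *\<^sub>R v t) \<in> borel_measurable lborel"
    using assms(3) by measurable
  have e: "AE t in lborel. indicator {0..2*pi} t *\<^sub>R u t = indicator {0..2*pi} t *\<^sub>R v t"
    using assms(2) by eventually_elim auto
  have "integrable lborel (\<lambda>t. indicator {0..2*pi} t *\<^sub>R v t)"
    using integrable_cong_AE_imp[OF i m] e by (auto elim: eventually_mono)
  moreover have "integral\<^sup>L lborel (\<lambda>t. indicator {0..2*pi} t *\<^sub>R u t) = integral\<^sup>L lborel (\<lambda>t. indicator {0..2*pi} t *\<^sub>R v t)"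
    using i m e by (intro integral_cong_AE) auto
  ultimately show ?thesis using assms(1)
    by (simp add: has_circle_mean_def set_integrable_def set_lebesgue_integral_def)
qed

text \<open>On a zero-free disc \<open>ln (norm (g z))\<close> is the real part of a holomorphic
  logarithm, so this is the mean value property, read off from Cauchy's formula at the
  centre.\<close>

lemma has_circle_mean_zero_free:
  assumes g: "g holomorphic_on ball 0 r" and r: "r > 1"
    and nz: "\<And>z. norm z < r \<Longrightarrow> g z \<noteq> 0"
  shows "has_circle_mean (\<lambda>t. ln (norm (g (cis t)))) (ln (norm (g 0)))"
proof -
  obtain h where h: "h holomorphic_on ball 0 r" and gh: "\<And>z. z \<in> ball 0 r \<Longrightarrow> exp (h z) = g z"
    using holomorphic_logarithm_exists[of "ball 0 r" g 0] g nz r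
    by (metis convex_ball open_ball centre_in_ball mem_ball_0 less_trans zero_less_one)
  have lng: "ln (norm (g w)) = Re (h w)" if "norm w < r" for w
    using gh[of w] that by (metis ln_exp mem_ball_0 norm_exp_eq_Re)
  have "((\<lambda>u. h u / (u - 0)) has_contour_integral (2 * of_real pi * \<i> * h 0)) (circlepath 0 1)"
    by (rule Cauchy_integral_circlepath)
       (use r in \<open>auto intro!: holomorphic_on_imp_continuous_on holomorphic_on_subset[OF h]\<close>)
  then have "((\<lambda>t. h (cis t) / cis t * \<i> * cis t) has_integral (2 * of_real pi * \<i> * h 0)) {0..2*pi}"
    unfolding circlepath_def by (subst (asm) has_contour_integral_part_circlepath_iff) auto
  then have "((\<lambda>t. (h (cis t) / cis t * \<i> * cis t) * (- \<i>)) has_integral ((2 * of_real pi * \<i> * h 0) * (-\<i>))) {0..2*pi}"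
    by (rule has_integral_mult_left)
  then have "((\<lambda>t. h (cis t)) has_integral (2 * of_real pi * h 0)) {0..2*pi}"
    by (simp add: mult_ac)
  then have "((\<lambda>t. Re (h (cis t))) has_integral (Re (2 * of_real pi * h 0))) {0..2*pi}"
    by (rule has_integral_Re)
  then have I: "((\<lambda>t. ln (norm (g (cis t)))) has_integral (2 * pi * ln (norm (g 0)))) {0..2*pi}"
    using r by (simp add: lng)
  have c: "continuous_on {0..2*pi} (\<lambda>t. ln (norm (g (cis t))))"
  proof -
    have "continuous_on {0..2*pi} (\<lambda>t. g (cis t))"
      by (rule continuous_on_compose2[OF holomorphic_on_imp_continuous_on[OF g]]) (use r in \<open>auto intro!: continuous_intros\<close>)
    then show ?thesis using nz r by (intro continuous_intros) auto
  qed
  have s: "set_integrable lborel {0..2*pi} (\<lambda>t. ln (norm (g (cis t))))"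
    by (rule borel_integrable_atLeastAtMost'[OF c])
  moreover have "(LINT t:{0..2 * pi}|lborel. ln (norm (g (cis t)))) = 2 * pi * ln (norm (g 0))"
    using set_borel_integral_eq_integral(2)[OF s] I by (simp add: integral_unique)
  ultimately show ?thesis by (simp add: has_circle_mean_def)
qed

section \<open>Jensen's formula for one linear factor\<close>

lemma AE_cis_neq: "AE t in lborel. cis t \<noteq> w"
proof -
  have "countable {t. cis t = w}"
  proof (cases "{t. cis t = w} = {}")
    case False
    then obtain s where s: "cis s = w" by auto
    have "{t. cis t = w} \<subseteq> range (\<lambda>n::int. s + 2 * pi * n)"
      using s by (auto simp: complex_eq_iff image_def) (metis sin_cos_eq_iff)
    then show ?thesis by (rule countable_subset) auto
  qed simp
  then have "{t. cis t = w} \<in> null_sets lborel" by (rule countable_imp_null_set_lborel)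
  then show ?thesis using AE_not_in by fastforce
qed

text \<open>Reflection in the unit circle: \<open>1 - cnj w * z\<close> has the same modulus as
  \<open>z - w\<close> on the circle, but its zero, if any, lies outside the open unit disc.\<close>

lemma norm_cis_diff: 
  assumes "norm w \<le> 1"
  shows "norm (cis t - w) = norm (1 - cnj w * cis t)"
proof -
  have "norm (cis t - w) = norm (cnj (cis t - w) * cis t)" by (simp add: norm_mult del: complex_cnj_diff)
  also have "cnj (cis t - w) * cis t = 1 - cnj w * cis t"
    by (simp add: algebra_simps cis_cnj cis_inverse flip: cis_mult) (simp add: cis_mult)
  finally show ?thesis .
qed

lemma borel_measurable_cis [measurable]: "cis \<in> borel_measurable borel"
  by (intro borel_measurable_continuous_onI continuous_intros)

text \<open>The zero is moved out to radius \<open>1 / q n\<close>, where the mean is 0 by the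
  zero-free case. Fatou's lemma makes the limit integrable, and the limit itself, up to constants,
  then dominates the approximations.\<close>

lemma has_circle_mean_ln_dist_unit:
  assumes w: "norm w = 1"
  shows "has_circle_mean (\<lambda>t. ln (norm (cis t - w))) 0"
proof -
  define q where "q n = 1 - 1 / (real n + 2)" for n :: nat
  have q: "0 < q n" "q n < 1" for n by (auto simp: q_def divide_simps)
  have qlim: "q \<longlonglongrightarrow> 1" unfolding q_def by real_asymp
  define v where "v n t = ln (norm (1 - of_real (q n) * cnj w * cis t))" for n t
  have v: "has_circle_mean (v n) 0" for n
  proof -
    have "has_circle_mean (\<lambda>t. ln (norm (1 - of_real (q n) * cnj w * cis t))) (ln (norm (1 - of_real (q n) * cnj w * 0)))"
    proof (rule has_circle_mean_zero_free[where r = "1 / q n"])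
      fix z :: complex assume "norm z < 1 / q n"
      then have "norm (of_real (q n) * cnj w * z) < 1" using w q[of n] by (simp add: norm_mult field_simps)
      then show "1 - of_real (q n) * cnj w * z \<noteq> 0" by force
    qed (use q[of n] in \<open>auto intro!: holomorphic_intros simp: field_simps\<close>)
    then show ?thesis by (simp add: v_def[abs_def])
  qed
  define V where "V t = ln (norm (1 - cnj w * cis t))" for t
  have wt: "norm (cnj w * cis t) = 1" for t using w by (simp add: norm_mult)
  \<comment> \<open>With u = \<open>cnj w * cis t\<close> of modulus 1: |1 - u| \<le> |1 - q u| + (1
    - q), and 1 - q \<le> |1 - q u|. Away from u = 1 this gives
    \<open>V t - ln 2 \<le> v n t\<close> for every \<open>n\<close>.\<close>
  have lower: "norm (1 - cnj w * cis t) / 2 \<le> norm (1 - of_real (q n) * cnj w * cis t)" for n t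
  proof -
    have "norm (1 - cnj w * cis t) \<le> norm (1 - of_real (q n) * cnj w * cis t) + norm (of_real (1 - q n) * (cnj w * cis t))"
      by (rule order_trans[OF _ norm_triangle_ineq4]) (simp add: algebra_simps)
    also have "norm (of_real (1 - q n) * (cnj w * cis t)) = 1 - q n"
      using q[of n] wt[of t] by (simp add: norm_mult del: of_real_diff)
    also have "1 - q n \<le> norm (1 - of_real (q n) * cnj w * cis t)"
      using norm_triangle_ineq2[of 1 "of_real (q n) * cnj w * cis t"] q[of n] wt[of t] w by (simp add: norm_mult)
    finally show ?thesis by simp
  qed
  have upper: "norm (1 - of_real (q n) * cnj w * cis t) \<le> 2" for n t
    using norm_triangle_ineq4[of 1 "of_real (q n) * cnj w * cis t"] q[of n] w by (simp add: norm_mult)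
  have ne: "AE t in lborel. 1 - cnj w * cis t \<noteq> 0"
    using AE_cis_neq[of w]
  proof eventually_elim
    case (elim t)
    then show ?case using norm_cis_diff[of w t] w by auto
  qed
  have lim: "(\<lambda>n. v n t) \<longlonglongrightarrow> V t" if "1 - cnj w * cis t \<noteq> 0" for t
  proof -
    have "(\<lambda>n. ln (norm (1 - of_real (q n) * cnj w * cis t))) \<longlonglongrightarrow> ln (norm (1 - of_real 1 * cnj w * cis t))"
      using that by (intro tendsto_intros qlim) auto
    then show ?thesis by (simp add: v_def V_def)
  qed
  have vb: "v n t \<le> ln 2" for n t
  proof (cases "1 - of_real (q n) * cnj w * cis t = 0")
    case True then show ?thesis by (simp add: v_def)
  next
    case False then show ?thesis unfolding v_def using upper[of n t] by (subst ln_le_cancel_iff) auto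
  qed
  let ?I = "\<lambda>t. indicator {0..2*pi} t :: real"
  have vi: "integrable lborel (\<lambda>t. ?I t * v n t)" and vI: "integral\<^sup>L lborel (\<lambda>t. ?I t * v n t) = 0" for n
    using v[of n] by (auto simp: has_circle_mean_def set_integrable_def set_lebesgue_integral_def)
  have ii: "integrable lborel (\<lambda>t. ?I t * ln 2)"
    using has_circle_mean_const[of "ln 2"] by (auto simp: has_circle_mean_def set_integrable_def)
  have iI: "integral\<^sup>L lborel (\<lambda>t. ?I t * ln 2) = 2 * pi * ln 2"
    using has_circle_mean_const[of "ln 2"] by (auto simp: has_circle_mean_def set_lebesgue_integral_def)
  have Vm[measurable]: "V \<in> borel_measurable borel" unfolding V_def by measurable
  have vm[measurable]: "v n \<in> borel_measurable borel" for n unfolding v_def by measurable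
  \<comment> \<open>\<open>ln 2 - v n t\<close> is nonnegative with the same integral for every
    \<open>n\<close>, so Fatou's lemma bounds the integral of \<open>ln 2 - V t\<close>.\<close>
  have "(\<integral>\<^sup>+t. ennreal (?I t * (ln 2 - V t)) \<partial>lborel) \<le> 2 * pi * ln 2"
  proof -
    have "(\<integral>\<^sup>+t. ennreal (?I t * (ln 2 - V t)) \<partial>lborel) = (\<integral>\<^sup>+t. liminf (\<lambda>n. ennreal (?I t * (ln 2 - v n t))) \<partial>lborel)"
    proof (rule nn_integral_cong_AE)
      show "AE t in lborel. ennreal (?I t * (ln 2 - V t)) = liminf (\<lambda>n. ennreal (?I t * (ln 2 - v n t)))"
        using ne
      proof eventually_elim
        case (elim t)
        show ?case by (rule lim_imp_Liminf[symmetric]) (use elim in \<open>auto intro!: tendsto_intros lim\<close>)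
      qed
    qed
    also have "\<dots> \<le> liminf (\<lambda>n. \<integral>\<^sup>+t. ennreal (?I t * (ln 2 - v n t)) \<partial>lborel)"
      by (rule nn_integral_liminf) measurable
    also have "\<dots> = liminf (\<lambda>n. ennreal (2 * pi * ln 2))"
    proof (rule arg_cong[where f = liminf], rule ext)
      fix n
      have i: "integrable lborel (\<lambda>t. ?I t * (ln 2 - v n t))"
        using Bochner_Integration.integrable_diff[OF ii vi[of n]] by (simp add: algebra_simps)
      have "(\<integral>\<^sup>+t. ennreal (?I t * (ln 2 - v n t)) \<partial>lborel) = ennreal (integral\<^sup>L lborel (\<lambda>t. ?I t * (ln 2 - v n t)))"
        using vb by (intro nn_integral_eq_integral i) (auto intro!: AE_I2 mult_nonneg_nonneg)
      also have "integral\<^sup>L lborel (\<lambda>t. ?I t * (ln 2 - v n t)) = 2 * pi * ln 2"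
        using Bochner_Integration.integral_diff[OF ii vi[of n]] by (simp only: right_diff_distrib iI vI diff_0_right)
      finally show "(\<integral>\<^sup>+t. ennreal (?I t * (ln 2 - v n t)) \<partial>lborel) = ennreal (2 * pi * ln 2)" .
    qed
    finally show ?thesis by (simp add: Liminf_const)
  qed
  then have fin: "(\<integral>\<^sup>+t. ennreal (?I t * (ln 2 - V t)) \<partial>lborel) < \<infinity>"
    by (rule le_less_trans) simp
  have Vle: "V t \<le> ln 2" for t
  proof (cases "1 - cnj w * cis t = 0")
    case False
    then show ?thesis unfolding V_def using norm_triangle_ineq4[of 1 "cnj w * cis t"] wt[of t]
      by (subst ln_le_cancel_iff) auto
  qed (simp add: V_def)
  have "integrable lborel (\<lambda>t. ?I t * (ln 2 - V t))"
  proof (rule integrableI_nonneg)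
    show "AE t in lborel. 0 \<le> ?I t * (ln 2 - V t)" using Vle by (intro AE_I2) auto
    show "(\<lambda>t. ?I t * (ln 2 - V t)) \<in> borel_measurable lborel" by measurable
  qed (use fin in auto)
  then have ib: "integrable lborel (\<lambda>t. ?I t * (ln 2 - V t) + 2 * (?I t * ln 2))"
    using ii by (intro Bochner_Integration.integrable_add integrable_mult_right) auto
  have bound: "AE t in lborel. norm (?I t * v n t) \<le> ?I t * (ln 2 - V t) + 2 * (?I t * ln 2)" for n
    using ne
  proof eventually_elim
    case (elim t)
    have "ln (norm (1 - cnj w * cis t) / 2) \<le> v n t"
      unfolding v_def using lower[of t n] elim by (subst ln_le_cancel_iff) (auto intro: less_le_trans[of 0 "norm (1 - cnj w * cis t) / 2"])
    then have "V t - ln 2 \<le> v n t" using elim by (simp add: V_def ln_div)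
    moreover have "(0 :: real) < ln 2" by simp
    ultimately have "\<bar>v n t\<bar> \<le> (ln 2 - V t) + 2 * ln 2"
      using vb[of n t] Vle[of t] by linarith
    then show ?case by (auto simp: indicator_def)
  qed
  have l: "AE t in lborel. (\<lambda>n. ?I t * v n t) \<longlonglongrightarrow> ?I t * V t"
    using ne by eventually_elim (intro tendsto_intros lim)
  have "integrable lborel (\<lambda>t. ?I t * V t)" 
    by (rule integrable_dominated_convergence[OF _ _ ib l bound]) measurable
  moreover have "(\<lambda>n. integral\<^sup>L lborel (\<lambda>t. ?I t * v n t)) \<longlonglongrightarrow> integral\<^sup>L lborel (\<lambda>t. ?I t * V t)" 
    by (rule integral_dominated_convergence[OF _ _ ib l bound]) measurable
  then have "integral\<^sup>L lborel (\<lambda>t. ?I t * V t) = 0"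
    by (simp add: vI LIMSEQ_const_iff)
  ultimately have "has_circle_mean V 0"
    by (simp add: has_circle_mean_def set_integrable_def set_lebesgue_integral_def)
  then show ?thesis using norm_cis_diff[of w] w by (simp add: V_def[abs_def])
qed

text \<open>Zeros inside the disc are reflected to the outside, where the mean is the value at 0.
  The result ln max (1, |w|) is what the normalisation of the linear factors cancels.\<close>

lemma has_circle_mean_ln_dist:
  "has_circle_mean (\<lambda>t. ln (norm (cis t - w))) (ln (max 1 (norm w)))"
proof (cases "norm w" "1 :: real" rule: linorder_cases)
  case less
  obtain r where r: "r > 1" "norm w * r < 1"
  proof (cases "w = 0")
    case True then show ?thesis using that[of 2] by simp
  next
    case False
    obtain r where "1 < r" "r < 1 / norm w" using dense[of 1 "1 / norm w"] less False by auto
    then show ?thesis using that[of r] False by (simp add: field_simps)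
  qed
  have "has_circle_mean (\<lambda>t. ln (norm (1 - cnj w * cis t))) (ln (norm (1 - cnj w * 0)))"
  proof (rule has_circle_mean_zero_free[OF _ r(1)])
    fix z :: complex assume "norm z < r"
    then have "norm (cnj w * z) \<le> norm w * r" by (simp add: norm_mult mult_left_mono)
    then show "1 - cnj w * z \<noteq> 0" using r by force
  qed (auto intro!: holomorphic_intros)
  then show ?thesis using less norm_cis_diff[of w] by simp
next
  case equal
  then show ?thesis using has_circle_mean_ln_dist_unit by simp
next
  case greater
  have "has_circle_mean (\<lambda>t. ln (norm (cis t - w))) (ln (norm (0 - w)))"
    by (rule has_circle_mean_zero_free[where r = "norm w"]) (use greater in \<open>auto intro!: holomorphic_intros\<close>)
  then show ?thesis using greater by simp
qed

section \<open>Zeros of entire functions of genus zero\<close>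

text \<open>Natural so that it can serve as an exponent; \<open>nat\<close> loses nothing for an
  entire function that is not identically 0, whose orders are nonnegative.\<close>

definition zmult :: "(complex \<Rightarrow> complex) \<Rightarrow> complex \<Rightarrow> nat" where
  "zmult f w = nat (zorder f w)"

text \<open>The disc is open, so that the remaining zeros are those summed in
  \<open>tail_sum\<close>; the origin is included, in contrast to \<open>zero_count\<close>.\<close>

definition zeros_ball :: "(complex \<Rightarrow> complex) \<Rightarrow> real \<Rightarrow> complex set" where
  "zeros_ball f r = {w. f w = 0 \<and> norm w < r}"

text \<open>The factor \<open>max 1 \<bar>w\<bar>\<close> normalises the logarithm to have mean 0 over the unit circle.\<close>
definition zprod :: "(complex \<Rightarrow> complex) \<Rightarrow> complex set \<Rightarrow> complex \<Rightarrow> complex" where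
  "zprod f D z = (\<Prod>w\<in>D. ((z - w) / of_real (max 1 (norm w))) ^ zmult f w)"

definition zlog :: "(complex \<Rightarrow> complex) \<Rightarrow> complex set \<Rightarrow> complex \<Rightarrow> real" where
  "zlog f D z = (\<Sum>w\<in>D. real (zmult f w) * ln (norm (z - w) / max 1 (norm w)))"

definition zcount :: "(complex \<Rightarrow> complex) \<Rightarrow> real \<Rightarrow> real" where
  "zcount f r = (\<Sum>w\<in>zeros_ball f r. real (zmult f w))"

lemma zprod_eq_0_iff: "finite D \<Longrightarrow> zprod f D z = 0 \<longleftrightarrow> z \<in> D \<and> zmult f z > 0"
  by (auto simp: zprod_def)

lemma norm_zprod: "norm (zprod f D z) = (\<Prod>w\<in>D. (norm (z - w) / max 1 (norm w)) ^ zmult f w)"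
  by (simp add: zprod_def norm_power norm_divide flip: prod_norm)

lemma ln_norm_zprod:
  assumes "finite D" "z \<notin> D"
  shows "ln (norm (zprod f D z)) = zlog f D z"
proof -
  have pos: "norm (z - w) / max 1 (norm w) > 0" if "w \<in> D" for w
    using assms that by (intro divide_pos_pos) auto
  have "ln (\<Prod>w\<in>D. (norm (z - w) / max 1 (norm w)) ^ zmult f w)
      = (\<Sum>w\<in>D. ln ((norm (z - w) / max 1 (norm w)) ^ zmult f w))"
    using assms(1) less_imp_neq[OF zero_less_power[OF pos]] by (intro ln_prod) auto
  also have "\<dots> = zlog f D z"
    unfolding zlog_def by (intro sum.cong refl ln_realpow pos)
  finally show ?thesis by (simp only: norm_zprod)
qed

lemma holomorphic_zprod [holomorphic_intros]: "zprod f D holomorphic_on A"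
  unfolding zprod_def by (intro holomorphic_intros) auto

section \<open>Splitting off the zeros in a disc\<close>

locale nonzero_entire =
  fixes f :: "complex \<Rightarrow> complex"
  assumes hol: "f holomorphic_on UNIV" and nz: "\<exists>z. f z \<noteq> 0"
begin

lemma ev_nz: "eventually (\<lambda>w. f w \<noteq> 0) (at z)"
proof -
  obtain b where "f b \<noteq> 0" using nz by auto
  from non_zero_neighbour_alt[OF hol open_UNIV connected_UNIV UNIV_I UNIV_I this, of z]
  show ?thesis by (auto elim: eventually_mono)
qed

lemma analytic: "f analytic_on {z}"
  using hol by (rule holomorphic_on_imp_analytic_at) auto

lemma zorder_nonneg: "zorder f z \<ge> 0"
  using zorder_ge_0[OF analytic] ev_nz by (simp add: eventually_frequently)

lemma of_int_zorder: "of_int (zorder f z) = of_nat (zmult f z)"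
  using zorder_nonneg[of z] by (simp add: zmult_def of_nat_nat)

lemma finite_zeros_compact:
  assumes "compact K"
  shows "finite {z \<in> K. f z = 0}"
proof (cases "f constant_on UNIV")
  case True
  then have "{z \<in> K. f z = 0} = {}" using nz by (auto simp: constant_on_def)
  then show ?thesis by (simp only: finite.emptyI)
next
  case False
  then show ?thesis using holomorphic_compact_finite_zeros[OF hol _ _ assms] by auto
qed

lemma finite_zeros_ball: "finite (zeros_ball f r)"
  by (rule finite_subset[OF _ finite_zeros_compact[of "cball 0 r"]]) (auto simp: zeros_ball_def)

text \<open>Induction on \<open>D\<close>, dividing out one zero with its full multiplicity at a
  time. The exact zero set of the cofactor is carried along because it shows that the next point is
  still one of its zeros.\<close>

lemma zprod_factor:
  assumes "finite D" "D \<subseteq> {w. f w = 0}"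
  shows "\<exists>g. g holomorphic_on UNIV \<and> (\<forall>z. f z = zprod f D z * g z) \<and> (\<forall>z. g z = 0 \<longleftrightarrow> f z = 0 \<and> z \<notin> D)"
  using assms
proof (induction D)
  case empty
  then show ?case using hol by (intro exI[of _ f]) (auto simp: zprod_def)
next
  case (insert w D)
  then obtain g where g: "g holomorphic_on UNIV" "\<And>z. f z = zprod f D z * g z"
    "\<And>z. g z = 0 \<longleftrightarrow> f z = 0 \<and> z \<notin> D" by blast
  have gw: "g w = 0" using g(3)[of w] insert by simp
  have gnz: "\<exists>u\<in>UNIV. g u \<noteq> 0" using nz g(2) by (metis UNIV_I mult_zero_right)
  define N where "N = zmult f w"
  have pw: "zprod f D w \<noteq> 0" using insert by (simp add: zprod_eq_0_iff)
  \<comment> \<open>\<open>zprod f D\<close> does not vanish at \<open>w\<close>, so the cofactor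
    has the same order at \<open>w\<close> as \<open>f\<close>.\<close>
  have "zorder f w = zorder (\<lambda>z. zprod f D z * g z) w" by (rule arg_cong2[of _ _ _ _ zorder]) (use g(2) in auto)
  also have "\<dots> = zorder (zprod f D) w + zorder g w"
    by (rule zorder_times_analytic)
       (use ev_nz[of w] g(1) in \<open>auto intro!: holomorphic_on_imp_analytic_at[of _ UNIV] holomorphic_intros simp: g(2)\<close>)
  also have "zorder (zprod f D) w = 0"
    by (rule zorder_eq_0I) (auto intro!: holomorphic_on_imp_analytic_at[of _ UNIV] holomorphic_intros pw)
  finally have N: "N = nat (zorder g w)" by (simp add: N_def zmult_def)
  obtain r where r: "r > 0" "zor_poly g w holomorphic_on cball w r"
    "\<And>u. u \<in> cball w r \<Longrightarrow> g u = zor_poly g w u * (u - w) ^ N \<and> zor_poly g w u \<noteq> 0"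
    using zorder_exist_zero[OF g(1) open_UNIV connected_UNIV UNIV_I gnz, of w] unfolding N by blast
  define c where "c = complex_of_real (max 1 (norm w))"
  have c: "c \<noteq> 0" by (simp add: c_def)
  \<comment> \<open>The quotient, with the removable singularity at \<open>w\<close> filled in from
    the local factorisation; it is holomorphic on two open sets that cover the plane.\<close>
  define h where "h u = (if u = w then zor_poly g w w * c ^ N else g u / ((u - w) / c) ^ N)" for u
  have hb: "h u = zor_poly g w u * c ^ N" if "u \<in> ball w r" for u
    using r(3)[of u] that c by (auto simp: h_def field_simps power_divide)
  have "h holomorphic_on (ball w r \<union> - {w})"
  proof (rule holomorphic_on_Un)
    have "(\<lambda>u. zor_poly g w u * c ^ N) holomorphic_on ball w r"
      by (intro holomorphic_intros holomorphic_on_subset[OF r(2)]) auto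
    then show "h holomorphic_on ball w r" using hb by (subst holomorphic_cong[OF refl]) auto
    have "(\<lambda>u. g u / ((u - w) / c) ^ N) holomorphic_on - {w}"
      by (intro holomorphic_intros holomorphic_on_subset[OF g(1)]) (auto simp: c)
    then show "h holomorphic_on - {w}" by (subst holomorphic_cong[OF refl]) (auto simp: h_def)
  qed auto
  moreover have "ball w r \<union> - {w} = UNIV" using r by auto
  ultimately have "h holomorphic_on UNIV" by simp
  moreover have gh: "g u = ((u - w) / c) ^ N * h u" for u
    using c gw r(3)[of w] r(1) by (auto simp: h_def)
  then have "f z = zprod f (insert w D) z * h z" for z
    using insert g(2)[of z] by (simp add: zprod_def N_def c_def)
  moreover have "h z = 0 \<longleftrightarrow> f z = 0 \<and> z \<notin> insert w D" for z
  proof (cases "z = w")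
    case True then show ?thesis using r(3)[of w] r(1) c by (simp add: h_def)
  next
    case False then show ?thesis using g(3)[of z] c by (simp add: h_def)
  qed
  ultimately show ?case by blast
qed

lemma zeros_ball_factor:
  "\<exists>g. g holomorphic_on UNIV \<and> (\<forall>z. f z = zprod f (zeros_ball f r) z * g z) \<and>
     (\<forall>z. norm z < r \<longrightarrow> g z \<noteq> 0)"
proof -
  have "zeros_ball f r \<subseteq> {w. f w = 0}" by (auto simp: zeros_ball_def)
  from zprod_factor[OF finite_zeros_ball this] obtain g where g: "g holomorphic_on UNIV"
    "\<forall>z. f z = zprod f (zeros_ball f r) z * g z" "\<forall>z. g z = 0 \<longleftrightarrow> f z = 0 \<and> z \<notin> zeros_ball f r"
    by (elim exE conjE)
  have "\<forall>z. norm z < r \<longrightarrow> g z \<noteq> 0" using g(3) by (simp add: zeros_ball_def)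
  with g(1,2) show ?thesis by (intro exI[of _ g] conjI)
qed

lemma ln_norm_factor:
  assumes fz: "f z = zprod f (zeros_ball f r) z * g z" and nz0: "f z \<noteq> 0"
  shows "ln (norm (f z)) = zlog f (zeros_ball f r) z + ln (norm (g z))"
proof -
  have "z \<notin> zeros_ball f r" using nz0 by (simp add: zeros_ball_def)
  then have "ln (norm (zprod f (zeros_ball f r) z)) = zlog f (zeros_ball f r) z"
    by (intro ln_norm_zprod finite_zeros_ball)
  moreover have "zprod f (zeros_ball f r) z \<noteq> 0" "g z \<noteq> 0" using fz nz0 by auto
  moreover have "norm (f z) = norm (zprod f (zeros_ball f r) z) * norm (g z)"
    unfolding norm_mult[symmetric] using fz by (rule arg_cong)
  ultimately show ?thesis by (simp add: ln_mult)
qed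

text \<open>Every normalised factor has logarithmic mean 0 over the unit circle, so only the
  cofactor counts, and it has no zeros in the closed unit disc because \<open>r > 1\<close>.\<close>

lemma circle_geo_mean_factor:
  assumes g: "g holomorphic_on UNIV" "\<And>z. f z = zprod f (zeros_ball f r) z * g z"
    "\<And>z. norm z < r \<Longrightarrow> g z \<noteq> 0" and r: "r > 1"
  shows "circle_geo_mean f 1 = norm (g 0)"
proof -
  let ?D = "zeros_ball f r"
  have "has_circle_mean (\<lambda>t. (\<Sum>w\<in>?D. real (zmult f w) * (ln (norm (cis t - w)) + - ln (max 1 (norm w)))) + ln (norm (g (cis t))))
     ((\<Sum>w\<in>?D. real (zmult f w) * (ln (max 1 (norm w)) + - ln (max 1 (norm w)))) + ln (norm (g 0)))"
    by (intro has_circle_mean_add has_circle_mean_sum finite_zeros_ball has_circle_mean_cmult has_circle_mean_ln_dist has_circle_mean_const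
        has_circle_mean_zero_free[where r = r] holomorphic_on_subset[OF g(1)] r g(3)) auto
  then have "has_circle_mean (\<lambda>t. (\<Sum>w\<in>?D. real (zmult f w) * (ln (norm (cis t - w)) + - ln (max 1 (norm w)))) + ln (norm (g (cis t)))) (ln (norm (g 0)))"
    by simp
  then have "has_circle_mean (\<lambda>t. ln (norm (f (cis t)))) (ln (norm (g 0)))"
  proof (rule has_circle_mean_cong_AE)
    have "AE t in lborel. \<forall>w\<in>?D. cis t \<noteq> w"
      by (rule AE_finite_allI[OF finite_zeros_ball AE_cis_neq])
    then show "AE t in lborel. (\<Sum>w\<in>?D. real (zmult f w) * (ln (norm (cis t - w)) + - ln (max 1 (norm w)))) + ln (norm (g (cis t))) = ln (norm (f (cis t)))"
    proof eventually_elim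
      case (elim t)
      have "f (cis t) \<noteq> 0" using elim r by (auto simp: zeros_ball_def)
      then have "ln (norm (f (cis t))) = zlog f ?D (cis t) + ln (norm (g (cis t)))"
        by (rule ln_norm_factor[where g = g, OF g(2)])
      also have "zlog f ?D (cis t) = (\<Sum>w\<in>?D. real (zmult f w) * (ln (norm (cis t - w)) + - ln (max 1 (norm w))))"
        unfolding zlog_def using elim by (intro sum.cong refl) (simp add: ln_div)
      finally show ?case by simp
    qed
    have [measurable]: "f \<in> borel_measurable borel"
      by (intro borel_measurable_continuous_onI holomorphic_on_imp_continuous_on hol)
    show "(\<lambda>t. ln (norm (f (cis t)))) \<in> borel_measurable borel" by measurable
  qed
  then show ?thesis using r g(3)[of 0]
    by (simp add: circle_geo_mean_def has_circle_mean_def)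
qed

lemma max_mod:
  assumes g: "g holomorphic_on UNIV" and "r > 0" "\<And>z. norm z = r \<Longrightarrow> norm (g z) \<le> B" "norm z \<le> r"
  shows "norm (g z) \<le> B"
  by (rule maximum_modulus_frontier[of g "cball 0 r" B z])
     (use assms in \<open>auto intro: holomorphic_on_subset holomorphic_on_imp_continuous_on\<close>)

text \<open>On the circle of radius 5 r every zero counted is at distance at least 4 r, so each
  normalised factor has modulus at least 4. By the maximum principle the cofactor is smaller than
  \<open>M\<close> by the factor \<open>4 ^ n\<close> at the origin, where its modulus is
  \<open>circle_geo_mean f 1\<close>; and ln 4 \<ge> 1.\<close>

lemma zcount_bound:
  assumes r: "r > 1" and M: "\<And>z. norm z \<le> 5 * r \<Longrightarrow> norm (f z) \<le> M"
  shows "zcount f r \<le> ln M - ln (circle_geo_mean f 1)"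
proof -
  let ?D = "zeros_ball f r"
  obtain g where g: "g holomorphic_on UNIV" "\<And>z. f z = zprod f ?D z * g z"
    "\<And>z. norm z < r \<Longrightarrow> g z \<noteq> 0" using zeros_ball_factor[of r] by blast
  define n where "n = (\<Sum>w\<in>?D. zmult f w)"
  have "norm (g 0) \<le> M / 4 ^ n"
  proof (rule max_mod[OF g(1), of "5 * r"])
    fix z :: complex assume z: "norm z = 5 * r"
    have "4 ^ n = (\<Prod>w\<in>?D. 4 ^ zmult f w)" by (simp add: n_def power_sum)
    also have "\<dots> \<le> norm (zprod f ?D z)"
      unfolding norm_zprod
    proof (intro prod_mono conjI power_mono)
      fix w assume w: "w \<in> ?D"
      have "norm (z - w) \<ge> 4 * r" using norm_triangle_ineq2[of z w] z w by (simp add: zeros_ball_def)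
      moreover have "max 1 (norm w) \<le> r" using w r by (simp add: zeros_ball_def)
      ultimately have "4 * max 1 (norm w) \<le> norm (z - w)" by linarith
      then show "4 \<le> norm (z - w) / max 1 (norm w)"
        by (subst pos_le_divide_eq) auto
    qed auto
    finally have "4 ^ n * norm (g z) \<le> norm (f z)"
      by (subst g(2)) (simp add: norm_mult mult_right_mono)
    also have "\<dots> \<le> M" using M z by simp
    finally show "norm (g z) \<le> M / 4 ^ n" by (simp add: field_simps)
  qed (use r in auto)
  moreover have C: "circle_geo_mean f 1 = norm (g 0)" by (rule circle_geo_mean_factor[OF g r])
  moreover have pos: "circle_geo_mean f 1 > 0" by (simp add: circle_geo_mean_def)
  ultimately have le: "circle_geo_mean f 1 \<le> M / 4 ^ n" by simp
  then have "0 < M / 4 ^ n" using pos by linarith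
  then have Mp: "M > 0" by (simp add: zero_less_divide_iff)
  have "ln (circle_geo_mean f 1) \<le> ln (M / 4 ^ n)" using le pos by simp
  then have "ln (circle_geo_mean f 1) \<le> ln M - n * ln 4" using Mp by (simp add: ln_div ln_realpow)
  moreover have "ln 4 \<ge> (1 :: real)" using exp_le by (subst ln_ge_iff) auto
  then have "real n * 1 \<le> n * ln 4" by (intro mult_left_mono) auto
  ultimately show ?thesis by (simp add: zcount_def n_def)
qed

lemma zcount_nonneg: "zcount f r \<ge> 0"
  by (simp add: zcount_def sum_nonneg)

lemma zcount_mono: "r \<le> s \<Longrightarrow> zcount f r \<le> zcount f s"
  unfolding zcount_def by (rule sum_mono2[OF finite_zeros_ball]) (auto simp: zeros_ball_def)

end

text \<open>With s = 1 / p > 1 and x = \<open>norm z powr p\<close>, the order bounds the m-th term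
  of the series by a constant times \<open>(x ^ m / fact m) powr s\<close>. Since
  \<open>x ^ m / fact m \<le> exp x\<close>, all but one power of it is traded for
  \<open>exp (x * (s - 1))\<close>, and the exponential series remains.\<close>

lemma genus_zero_growth:
  assumes "genus_zero f"
  shows "\<exists>A B p. A > 0 \<and> B > 0 \<and> 0 < p \<and> p < 1 \<and> (\<forall>z. norm (f z) \<le> A * exp (B * norm z powr p))"
proof -
  define c where "c m = fps_nth (fps_expansion f 0) m" for m
  have hol: "f holomorphic_on UNIV" and ord: "entire_order f < 1" using assms by (auto simp: genus_zero_def)
  have sums: "(\<lambda>m. c m * z ^ m) sums f z" for z
  proof -
    have "((\<lambda>n. (deriv ^^ n) f 0 / fact n * (z - 0) ^ n) sums f z)"
      by (rule holomorphic_power_series[where r = "norm z + 1"]) (auto intro: holomorphic_on_subset[OF hol])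
    then show ?thesis by (simp add: c_def fps_expansion_def)
  qed
  \<comment> \<open>The maximum with 0 yields a positive exponent \<open>p\<close>, whose reciprocal
    is taken below.\<close>
  have "max 0 (entire_order f) < 1" using ord by simp
  then obtain p' where p': "max 0 (entire_order f) < p'" "p' < 1" using dense by blast
  then obtain p where p: "p' = ereal p" by (cases p') auto
  have p01: "0 < p" "p < 1" using p' p by auto
  define s where "s = 1 / p"
  have s1: "s > 1" using p01 by (simp add: s_def)
  have ev1: "eventually (\<lambda>m. ereal (real m * ln (real m)) / (- ereal_ln (norm (c m))) < p) sequentially"
    using p' p unfolding entire_order_def c_def by (intro Limsup_lessD) auto
  have "(\<lambda>m. norm (c m)) \<longlonglongrightarrow> 0"
    using summable_LIMSEQ_zero[OF sums_summable[OF sums[of 1]]] by (simp add: tendsto_norm_zero)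
  then have ev2: "eventually (\<lambda>m. norm (c m) < 1) sequentially"
    by (rule order_tendstoD) simp
  have "eventually (\<lambda>m. norm (c m) \<le> (1 / fact m) powr s) sequentially"
    using ev1 ev2 eventually_gt_at_top[of 1]
  proof eventually_elim
    case (elim m)
    show ?case
    proof (cases "c m = 0")
      case False
      let ?x = "norm (c m)"
      have x: "?x > 0" "?x < 1" using False elim by auto
      have l: "ln ?x < 0" using x by simp
      have "real m * ln (real m) / (- ln ?x) < p"
        using elim(1) x l by (simp add: ereal_ln_def)
      then have "real m * ln (real m) < p * (- ln ?x)" using l by (subst (asm) pos_divide_less_eq) auto
      then have "s * (real m * ln (real m)) < - ln ?x" using p01 by (simp add: s_def field_simps)
      moreover have "ln (fact m :: real) \<le> real m * ln (real m)"
      proof -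
        have "ln (fact m :: real) \<le> ln (real (m ^ m))"
          by (subst ln_le_cancel_iff) (use elim fact_le_power[of m, where ?'a = real] in auto)
        then show ?thesis using elim by (simp add: ln_realpow)
      qed
      then have "s * ln (fact m :: real) \<le> s * (real m * ln (real m))" using s1 by (intro mult_left_mono) auto
      ultimately have "ln ?x \<le> s * ln (1 / fact m)" by (simp add: ln_div)
      then have "exp (ln ?x) \<le> exp (s * ln (1 / fact m))" by (subst exp_le_cancel_iff)
      also have "exp (ln ?x) = ?x" using x(1) by (rule exp_ln)
      also have "exp (s * ln (1 / fact m)) = (1 / fact m) powr s" by (simp add: powr_def)
      finally show ?thesis .
    qed simp
  qed
  then obtain M where M: "\<And>m. m \<ge> M \<Longrightarrow> norm (c m) \<le> (1 / fact m) powr s"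
    by (auto simp: eventually_sequentially)
  \<comment> \<open>The finitely many coefficients before \<open>M\<close> are absorbed into the
    constant; the summand 1 covers the others.\<close>
  define K where "K = 1 + (\<Sum>m<M. norm (c m) * (fact m) powr s)"
  have K1: "K \<ge> 1" by (simp add: K_def sum_nonneg)
  have cK: "norm (c m) \<le> K * (1 / fact m) powr s" for m
  proof (cases "m < M")
    case True
    have "norm (c m) * (fact m) powr s \<le> (\<Sum>m<M. norm (c m) * (fact m) powr s)"
      using True by (intro member_le_sum) auto
    then have "norm (c m) * (fact m) powr s \<le> K" by (simp add: K_def)
    then show ?thesis by (simp add: powr_divide pos_le_divide_eq)
  next
    case False
    then have "norm (c m) \<le> 1 * (1 / fact m) powr s" using M[of m] by simp
    also have "\<dots> \<le> K * (1 / fact m) powr s" using K1 by (intro mult_right_mono) auto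
    finally show ?thesis .
  qed
  have "norm (f z) \<le> K * exp (s * norm z powr p)" for z
  proof (cases "z = 0")
    case True
    have "f 0 = c 0" by (simp add: c_def fps_expansion_def)
    then show ?thesis using True cK[of 0] K1 by simp
  next
    case False
    define x where "x = norm z powr p"
    have xp: "x > 0" using False by (simp add: x_def)
    have xs: "x powr s = norm z" using False p01 by (simp add: x_def s_def powr_powr)
    have tm: "norm (c m * z ^ m) \<le> (K * exp (x * (s - 1))) * (x ^ m / fact m)" for m
    proof -
      have t: "x ^ m / fact m > 0" using xp by simp
      have "x ^ m / fact m \<le> exp x"
      proof -
        have "(\<lambda>n. x ^ n /\<^sub>R fact n) sums exp x" by (rule exp_converges)
        then have "sum (\<lambda>n. x ^ n /\<^sub>R fact n) {m} \<le> exp x"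
          using xp sum_le_suminf[of "\<lambda>n. x ^ n /\<^sub>R fact n" "{m}"] by (simp add: sums_iff)
        then show ?thesis by (simp add: field_simps)
      qed
      then have e: "(x ^ m / fact m) powr (s - 1) \<le> exp (x * (s - 1))"
        using t s1 by (subst exp_powr_real[symmetric]) (intro powr_mono2, auto)
      have "norm (c m * z ^ m) = norm (c m) * (x powr s) ^ m" by (simp add: norm_mult norm_power xs)
      also have "\<dots> \<le> (K * (1 / fact m) powr s) * (x powr s) ^ m" using cK by (intro mult_right_mono) auto
      also have "(x powr s) ^ m = (x ^ m) powr s" 
      proof -
        have "(x powr s) ^ m = (x powr s) powr real m" using xp by (intro powr_realpow[symmetric]) auto
        also have "\<dots> = (x powr real m) powr s" by (simp add: powr_powr mult.commute)
        also have "x powr real m = x ^ m" using xp by (rule powr_realpow)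
        finally show ?thesis .
      qed
      also have "(K * (1 / fact m) powr s) * (x ^ m) powr s = K * (x ^ m / fact m) powr s"
        using xp by (simp add: powr_divide)
      also have "(x ^ m / fact m) powr s = (x ^ m / fact m) powr (s - 1) * (x ^ m / fact m)"
        using t xp powr_add[of "x ^ m / fact m" "s - 1" 1] by simp
      also have "K * \<dots> \<le> K * (exp (x * (s - 1)) * (x ^ m / fact m))"
        using K1 e t by (intro mult_left_mono mult_right_mono) auto
      finally show ?thesis by (simp add: mult_ac)
    qed
    have e: "(\<lambda>m. (K * exp (x * (s - 1))) * (x ^ m / fact m)) sums ((K * exp (x * (s - 1))) * exp x)"
      using exp_converges[of x] by (intro sums_mult) (simp add: field_simps)
    have "norm (suminf (\<lambda>m. c m * z ^ m)) \<le> suminf (\<lambda>m. (K * exp (x * (s - 1))) * (x ^ m / fact m))"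
      by (rule norm_suminf_le[OF tm]) (use e in \<open>simp add: sums_iff\<close>)
    also have "suminf (\<lambda>m. c m * z ^ m) = f z" using sums[of z] by (simp add: sums_iff)
    also have "suminf (\<lambda>m. (K * exp (x * (s - 1))) * (x ^ m / fact m)) = (K * exp (x * (s - 1))) * exp x"
      using e by (simp add: sums_iff)
    also have "\<dots> = K * exp (s * x)" by (simp add: algebra_simps flip: exp_add)
    finally show ?thesis by (simp add: x_def)
  qed
  then show ?thesis using K1 s1 p01 by (intro exI[of _ K] exI[of _ s] exI[of _ p]) auto
qed

section \<open>Convergence of the sums over zeros\<close>

locale genus_zero_function =
  fixes f :: "complex \<Rightarrow> complex"
  assumes genus_zero: "genus_zero f"

sublocale genus_zero_function \<subseteq> nonzero_entire
  by unfold_locales (use genus_zero in \<open>auto simp: genus_zero_def\<close>)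

context genus_zero_function
begin

abbreviation "C1 \<equiv> circle_geo_mean f 1"

text \<open>The contribution of a zero to the star degree, in one formula for the origin, the unit
  disc and the exterior.\<close>

definition wt :: "complex \<Rightarrow> real" where
  "wt w = real (zmult f w) / max 1 (norm w)"

lemma C1_pos: "C1 > 0"
  by (simp add: circle_geo_mean_def)

lemma wt_nonneg: "wt w \<ge> 0"
  by (simp add: wt_def)

lemma zcount_growth: "\<exists>Q p. Q \<ge> 0 \<and> 0 < p \<and> p < 1 \<and> (\<forall>r\<ge>2. zcount f r \<le> Q * r powr p)"
proof -
  obtain A B p where A: "A > 0" "B > 0" "0 < p" "p < 1" and
    bd: "\<And>z. norm (f z) \<le> A * exp (B * norm z powr p)"
    using genus_zero_growth[OF genus_zero] by blast
  define Q where "Q = \<bar>ln A - ln C1\<bar> + B * 5 powr p"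
  have "zcount f r \<le> Q * r powr p" if r: "r \<ge> 2" for r
  proof -
    have "zcount f r \<le> ln (A * exp (B * (5 * r) powr p)) - ln C1"
    proof (rule zcount_bound)
      fix z :: complex assume z: "norm z \<le> 5 * r"
      have "norm z powr p \<le> (5 * r) powr p" using z A by (intro powr_mono2) auto
      then have "A * exp (B * norm z powr p) \<le> A * exp (B * (5 * r) powr p)" using A by simp
      then show "norm (f z) \<le> A * exp (B * (5 * r) powr p)" using bd[of z] by linarith
    qed (use r in auto)
    also have "\<dots> = (ln A - ln C1) + B * 5 powr p * r powr p"
      using A r by (simp add: ln_mult powr_mult)
    also have "\<dots> \<le> \<bar>ln A - ln C1\<bar> * r powr p + B * 5 powr p * r powr p"
    proof -
      have "1 \<le> r powr p" using r A by (intro ge_one_powr_ge_zero) auto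
      then have "\<bar>ln A - ln C1\<bar> * 1 \<le> \<bar>ln A - ln C1\<bar> * r powr p" by (intro mult_left_mono) auto
      then show ?thesis by simp
    qed
    finally show ?thesis by (simp add: Q_def algebra_simps)
  qed
  moreover have "Q \<ge> 0" using A by (simp add: Q_def)
  ultimately show ?thesis using A by blast
qed

text \<open>Dyadic shells: at most a constant times 2^(p J) zeros have modulus between 2^J and 2^(J
  + 1), and each has weight at most 2^(-J) per multiplicity. Since p < 1, the shells sum
  geometrically.\<close>

lemma sum_wt_bound: "\<exists>K. \<forall>J. (\<Sum>w\<in>zeros_ball f (2 ^ J). wt w) \<le> K"
proof -
  obtain Q p where Q: "Q \<ge> 0" "0 < p" "p < 1" "\<And>r. r \<ge> 2 \<Longrightarrow> zcount f r \<le> Q * r powr p"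
    using zcount_growth by blast
  define q where "q = (2 :: real) powr (p - 1)"
  have q: "0 < q" "q < 1" using Q powr_less_mono[of "p - 1" 0 2] by (auto simp: q_def)
  have step: "(\<Sum>w\<in>zeros_ball f (2 ^ Suc J). wt w) \<le> (\<Sum>w\<in>zeros_ball f (2 ^ J). wt w) + Q * 2 powr p * q ^ J" for J
  proof -
    let ?D = "zeros_ball f (2 ^ Suc J) - zeros_ball f (2 ^ J)"
    have sub: "zeros_ball f (2 ^ J) \<subseteq> zeros_ball f (2 ^ Suc J)"
      by (auto simp: zeros_ball_def intro: less_le_trans)
    have "(\<Sum>w\<in>zeros_ball f (2 ^ Suc J). wt w) = (\<Sum>w\<in>?D. wt w) + (\<Sum>w\<in>zeros_ball f (2 ^ J). wt w)"
      by (rule sum.subset_diff[OF sub finite_zeros_ball])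
    also have "(\<Sum>w\<in>?D. wt w) \<le> (\<Sum>w\<in>?D. real (zmult f w) / 2 ^ J)"
      unfolding wt_def by (intro sum_mono divide_left_mono) (auto simp: zeros_ball_def)
    also have "\<dots> \<le> (\<Sum>w\<in>zeros_ball f (2 ^ Suc J). real (zmult f w) / 2 ^ J)"
      by (intro sum_mono2 finite_zeros_ball) auto
    also have "\<dots> = zcount f (2 ^ Suc J) / 2 ^ J" by (simp add: zcount_def sum_divide_distrib)
    also have "\<dots> \<le> (Q * (2 ^ Suc J) powr p) / 2 ^ J"
      by (intro divide_right_mono Q(4)) auto
    also have "\<dots> = Q * 2 powr p * q ^ J"
    proof -
      have "(2 ^ Suc J) powr p = (2 :: real) powr p * (2 powr p) ^ J"
        by (simp add: powr_mult powr_powr mult.commute flip: powr_realpow)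
      moreover have "q ^ J = (2 powr p) ^ J / 2 ^ J" by (simp add: q_def powr_diff power_divide)
      ultimately show ?thesis by simp
    qed
    finally show ?thesis by simp
  qed
  have "(\<Sum>w\<in>zeros_ball f (2 ^ J). wt w) \<le> (\<Sum>w\<in>zeros_ball f (2 ^ 0). wt w) + Q * 2 powr p * (\<Sum>i<J. q ^ i)" for J
  proof (induction J)
    case (Suc J)
    then show ?case using step[of J] by (simp add: algebra_simps)
  qed simp
  moreover have "Q * 2 powr p * (\<Sum>i<J. q ^ i) \<le> Q * 2 powr p * (1 / (1 - q))" for J
    using Q q by (intro mult_left_mono) (auto simp: sum_gp_strict divide_right_mono)
  ultimately show ?thesis
    by (intro exI[of _ "(\<Sum>w\<in>zeros_ball f (2 ^ 0). wt w) + Q * 2 powr p * (1 / (1 - q))"]) (meson add_left_mono order_trans)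
qed

text \<open>\<open>infsum\<close> is 0 for a family that is not summable, so
  \<open>star_degree\<close> and \<open>tail_sum\<close> carry information about the zeros only once
  this is known.\<close>

lemma wt_summable: "wt summable_on {w. f w = 0}"
proof -
  obtain K where K: "\<And>J. (\<Sum>w\<in>zeros_ball f (2 ^ J). wt w) \<le> K" using sum_wt_bound by blast
  have "sum wt F \<le> K" if F: "finite F" "F \<subseteq> {w. f w = 0}" for F
  proof -
    obtain b where b: "\<And>w. w \<in> F \<Longrightarrow> norm w \<le> b"
      using finite_imp_bounded[OF F(1)] by (auto simp: bounded_iff)
    obtain J where J: "b < 2 ^ J" using real_arch_pow[of 2 b] by auto
    have "sum wt F \<le> sum wt (zeros_ball f (2 ^ J))"
      using F b J by (intro sum_mono2 finite_zeros_ball wt_nonneg) (force simp: zeros_ball_def)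
    then show ?thesis using K[of J] by linarith
  qed
  then show ?thesis
    by (intro nonneg_bounded_partial_sums_imp_summable_on[where C = K] wt_nonneg) (auto simp: eventually_finite_subsets_at_top)
qed

text \<open>\<open>wt\<close> adds up to \<open>star_degree\<close> over the origin, the rest of the
  closed unit disc and the exterior. Inserting 0 covers the exponent of z whether or not the origin
  is a zero.\<close>

lemma sum_wt_le_star_degree:
  assumes "finite F" "F \<subseteq> insert 0 {w. f w = 0}"
  shows "sum wt F \<le> star_degree f"
proof -
  let ?S2 = "{z \<in> nonzero_zeros f. norm z \<le> 1}" and ?S3 = "{z \<in> nonzero_zeros f. norm z > 1}"
  have star: "star_degree f = sum wt {0} + sum wt ?S2 + infsum wt ?S3"
  proof -
    have "(\<Sum>z\<in>?S2. of_int (zorder f z)) = sum wt ?S2"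
      by (intro sum.cong refl) (simp add: wt_def of_int_zorder)
    moreover have "(\<Sum>\<^sub>\<infinity>z\<in>?S3. of_int (zorder f z) / norm z) = infsum wt ?S3"
      by (intro infsum_cong) (simp add: wt_def of_int_zorder)
    ultimately show ?thesis by (simp add: star_degree_def of_int_zorder wt_def)
  qed
  have fin2: "finite ?S2"
    by (rule finite_subset[OF _ finite_zeros_compact[of "cball 0 1"]]) (auto simp: nonzero_zeros_def)
  have sum3: "wt summable_on ?S3"
    by (rule summable_on_subset_banach[OF wt_summable]) (auto simp: nonzero_zeros_def)
  have "F = F \<inter> {0} \<union> F \<inter> ?S2 \<union> F \<inter> ?S3" using assms(2) by (auto simp: nonzero_zeros_def)
  then have "sum wt F = sum wt (F \<inter> {0} \<union> F \<inter> ?S2 \<union> F \<inter> ?S3)" by simp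
  also have "\<dots> = sum wt (F \<inter> {0}) + sum wt (F \<inter> ?S2) + sum wt (F \<inter> ?S3)"
    using assms(1) by (subst sum.union_disjoint, auto)+ (auto simp: nonzero_zeros_def)
  also have "sum wt (F \<inter> {0}) \<le> sum wt {0}" by (intro sum_mono2 wt_nonneg) auto
  also have "sum wt (F \<inter> ?S2) \<le> sum wt ?S2" by (intro sum_mono2 wt_nonneg fin2) auto
  also have "sum wt (F \<inter> ?S3) \<le> infsum wt ?S3"
    using assms(1) by (intro finite_sum_le_infsum sum3 wt_nonneg) auto
  finally show ?thesis by (simp add: star)
qed

lemma star_degree_nonneg: "star_degree f \<ge> 0"
  using sum_wt_le_star_degree[of "{}"] by simp

lemma sum_wt_zeros_ball: "sum wt (zeros_ball f r - X) \<le> star_degree f"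
  by (rule sum_wt_le_star_degree[OF finite_Diff[OF finite_zeros_ball]]) (auto simp: zeros_ball_def)

text \<open>\<open>zero_count\<close> leaves out the origin, whose multiplicity is at most the star
  degree.\<close>

lemma zcount_le_zero_count: "r \<le> s \<Longrightarrow> zcount f r \<le> star_degree f + zero_count f s"
proof -
  assume rs: "r \<le> s"
  let ?A = "{z \<in> nonzero_zeros f. norm z \<le> s}"
  have fin: "finite ?A"
    by (rule finite_subset[OF _ finite_zeros_compact[of "cball 0 s"]]) (auto simp: nonzero_zeros_def)
  have "zcount f r \<le> (\<Sum>w\<in>insert 0 ?A. real (zmult f w))"
    unfolding zcount_def using fin rs by (intro sum_mono2) (auto simp: zeros_ball_def nonzero_zeros_def)
  also have "\<dots> = real (zmult f 0) + zero_count f s"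
    using fin by (subst sum.insert) (auto simp: zero_count_def of_int_zorder nonzero_zeros_def)
  also have "real (zmult f 0) \<le> star_degree f"
    using sum_wt_le_star_degree[of "{0}"] by (simp add: wt_def)
  finally show ?thesis by simp
qed

text \<open>Replaces the unordered sum by sums over growing discs, the form in which the product
  formula is available. For \<open>S \<ge> 1\<close> the weights are the multiplicities divided by
  |w|, which gives absolute convergence.\<close>

lemma tail_sum_limit:
  assumes S: "S \<ge> 1"
  shows "((\<lambda>r. \<Sum>w\<in>zeros_ball f r - zeros_ball f S. of_nat (zmult f w) / w) \<longlongrightarrow> tail_sum f S) at_top"
proof -
  let ?A = "{z \<in> nonzero_zeros f. norm z \<ge> S}"
  have "(\<lambda>w. of_nat (zmult f w) / w) summable_on ?A"
  proof (rule abs_summable_summable)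
    have "wt summable_on ?A"
      by (rule summable_on_subset_banach[OF wt_summable]) (auto simp: nonzero_zeros_def)
    then show "(\<lambda>w. norm (of_nat (zmult f w) / w)) summable_on ?A"
      by (rule summable_on_cong[THEN iffD1, rotated]) (use S in \<open>auto simp: wt_def norm_divide max_def\<close>)
  qed
  then have "((\<lambda>w. of_nat (zmult f w) / w) has_sum (\<Sum>\<^sub>\<infinity>w\<in>?A. of_nat (zmult f w) / w)) ?A"
    by (rule has_sum_infsum)
  then have "(sum (\<lambda>w. of_nat (zmult f w) / w) \<longlongrightarrow> (\<Sum>\<^sub>\<infinity>w\<in>?A. of_nat (zmult f w) / w)) (finite_subsets_at_top ?A)"
    by (simp add: has_sum_def)
  moreover have "filterlim (\<lambda>r. zeros_ball f r - zeros_ball f S) (finite_subsets_at_top ?A) at_top"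
    unfolding filterlim_finite_subsets_at_top
  proof (intro allI impI)
    fix X assume X: "finite X \<and> X \<subseteq> ?A"
    obtain b where b: "\<And>w. w \<in> X \<Longrightarrow> norm w \<le> b"
      using finite_imp_bounded[of X] X by (auto simp: bounded_iff)
    show "\<forall>\<^sub>F r in at_top. finite (zeros_ball f r - zeros_ball f S) \<and> X \<subseteq> zeros_ball f r - zeros_ball f S
       \<and> zeros_ball f r - zeros_ball f S \<subseteq> ?A"
      using eventually_gt_at_top[of b]
    proof eventually_elim
      case (elim r)
      then show ?case using X b S
        by (auto simp: finite_zeros_ball) (fastforce simp: zeros_ball_def nonzero_zeros_def)+
    qed
  qed
  ultimately have "((\<lambda>r. \<Sum>w\<in>zeros_ball f r - zeros_ball f S. of_nat (zmult f w) / w) \<longlongrightarrow> (\<Sum>\<^sub>\<infinity>w\<in>?A. of_nat (zmult f w) / w)) at_top"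
    by (rule filterlim_compose)
  also have "(\<Sum>\<^sub>\<infinity>w\<in>?A. of_nat (zmult f w) / w) = tail_sum f S"
    unfolding tail_sum_def by (intro infsum_cong) (simp add: of_int_zorder)
  finally show ?thesis .
qed

text \<open>The Hadamard product in logarithmic form: the zero-free cofactor on the disc of radius \<open>r\<close>
  has growth \<open>exp (o(r))\<close>, so its logarithm tends to a constant.\<close>
lemma zlog_limit:
  assumes fz: "f z \<noteq> 0"
  shows "((\<lambda>r. zlog f (zeros_ball f r) z) \<longlongrightarrow> ln (norm (f z)) - ln C1) at_top"
proof -
  obtain A B p where A: "A > 0" "B > 0" "0 < p" "p < 1" and
    bd: "\<And>z. norm (f z) \<le> A * exp (B * norm z powr p)"
    using genus_zero_growth[OF genus_zero] by blast
  \<comment> \<open>The summand 1 makes the inequality required by the Borel--Caratheodory bound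
    strict.\<close>
  define L where "L = \<bar>ln A - ln C1\<bar> + 1"
  have est: "\<bar>zlog f (zeros_ball f r) z - (ln (norm (f z)) - ln C1)\<bar> \<le> 2 * (B * (2 * r) powr p + L) * norm z / (r - norm z)"
    if r: "r \<ge> 2" "norm z < r" for r
  proof -
    let ?D = "zeros_ball f r"
    obtain g where g: "g holomorphic_on UNIV" "\<And>z. f z = zprod f ?D z * g z"
      "\<And>z. norm z < r \<Longrightarrow> g z \<noteq> 0" using zeros_ball_factor[of r] by blast
    have C: "C1 = norm (g 0)" by (rule circle_geo_mean_factor[OF g]) (use r in auto)
    \<comment> \<open>On |u| = 2 r each normalised factor has modulus at least 1, so the growth
      bound for \<open>f\<close> passes to the cofactor there, and to the inside by the maximum
      principle.\<close>
    have gb: "norm (g u) \<le> A * exp (B * (2 * r) powr p)" if "norm u \<le> 2 * r" for u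
    proof (rule max_mod[OF g(1) _ _ that])
      fix u :: complex assume u: "norm u = 2 * r"
      have "1 \<le> norm (zprod f ?D u)"
        unfolding norm_zprod
      proof (intro prod_ge_1 one_le_power)
        fix w assume w: "w \<in> ?D"
        have "norm (u - w) \<ge> r" using norm_triangle_ineq2[of u w] u w by (simp add: zeros_ball_def)
        moreover have "max 1 (norm w) \<le> r" using w r by (simp add: zeros_ball_def)
        ultimately have "1 * max 1 (norm w) \<le> norm (u - w)" by linarith
        then show "1 \<le> norm (u - w) / max 1 (norm w)"
          by (subst pos_le_divide_eq) auto
      qed
      then have "1 * norm (g u) \<le> norm (zprod f ?D u) * norm (g u)" by (intro mult_right_mono) auto
      also have "\<dots> = norm (f u)" unfolding norm_mult[symmetric] by (rule arg_cong) (rule g(2)[symmetric])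
      also have "\<dots> \<le> A * exp (B * (2 * r) powr p)" using bd[of u] u by simp
      finally show "norm (g u) \<le> A * exp (B * (2 * r) powr p)" by simp
    qed (use r in auto)
    have "\<bar>ln (norm (g z)) - ln (norm (g 0))\<bar> \<le> 2 * (B * (2 * r) powr p + L) * norm z / (r - norm z)"
    proof (rule ln_norm_zero_free_bound[OF holomorphic_on_subset[OF g(1)]])
      show "B * (2 * r) powr p + L > 0" using A r by (intro add_nonneg_pos) (auto simp: L_def)
      fix u :: complex assume u: "norm u < r"
      have "norm (g u) \<le> A * exp (B * (2 * r) powr p)" using u r by (intro gb) auto
      also have "\<dots> = exp (ln A + B * (2 * r) powr p)" using A by (simp add: exp_add)
      also have "\<dots> < exp (ln C1 + (B * (2 * r) powr p + L))" by (subst exp_less_cancel_iff) (simp add: L_def)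
      also have "\<dots> = norm (g 0) * exp (B * (2 * r) powr p + L)" using C1_pos by (simp add: exp_add C)
      finally show "norm (g u) < norm (g 0) * exp (B * (2 * r) powr p + L)" .
    qed (use r g in auto)
    moreover have "ln (norm (f z)) = zlog f ?D z + ln (norm (g z))"
      by (rule ln_norm_factor[where g = g, OF g(2) fz])
    ultimately show ?thesis by (simp add: C abs_minus_commute)
  qed
  \<comment> \<open>The expression is at most of order r^(p - 1), and p < 1.\<close>
  have "((\<lambda>r. 2 * (B * (2 * r) powr p + L) * norm z / (r - norm z)) \<longlongrightarrow> 0) at_top"
  proof -
    have "((\<lambda>r. r powr (p - 1)) \<longlongrightarrow> 0) at_top" using A by (intro tendsto_neg_powr filterlim_ident) auto
    moreover have "((\<lambda>r. L / r) \<longlongrightarrow> 0) at_top" by real_asymp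
    moreover have "((\<lambda>r. r / (r - norm z)) \<longlongrightarrow> 1) at_top" by real_asymp
    ultimately have "((\<lambda>r. 2 * norm z * (B * 2 powr p * (r powr (p - 1)) + L / r) * (r / (r - norm z))) \<longlongrightarrow> 2 * norm z * (B * 2 powr p * 0 + 0) * 1) at_top"
      by (intro tendsto_intros)
    then have "((\<lambda>r. 2 * norm z * (B * 2 powr p * (r powr (p - 1)) + L / r) * (r / (r - norm z))) \<longlongrightarrow> 0) at_top"
      by simp
    then show ?thesis
    proof (rule Lim_transform_eventually)
      show "\<forall>\<^sub>F r in at_top. 2 * norm z * (B * 2 powr p * (r powr (p - 1)) + L / r) * (r / (r - norm z)) = 2 * (B * (2 * r) powr p + L) * norm z / (r - norm z)"
        using eventually_gt_at_top[of "norm z"] eventually_gt_at_top[of 0]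
      proof eventually_elim
        case (elim r)
        have "r powr (p - 1) = r powr p / r" using elim by (simp add: powr_diff)
        moreover have "2 * norm z * (B * 2 powr p * (R / r) + L / r) * (r / (r - norm z)) = 2 * (B * (2 powr p * R) + L) * norm z / (r - norm z)" for R
          using elim by (simp add: field_simps)
        ultimately show ?case using elim by (simp only: powr_mult)
      qed
    qed
  qed
  moreover have "\<forall>\<^sub>F r in at_top. norm (zlog f (zeros_ball f r) z - (ln (norm (f z)) - ln C1)) \<le> 2 * (B * (2 * r) powr p + L) * norm z / (r - norm z)"
    using eventually_ge_at_top[of 2] eventually_gt_at_top[of "norm z"]
    by eventually_elim (use est in auto)
  ultimately have "((\<lambda>r. zlog f (zeros_ball f r) z - (ln (norm (f z)) - ln C1)) \<longlongrightarrow> 0) at_top"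
    by (rule Lim_null_comparison[rotated])
  then show ?thesis by (simp add: LIM_zero_iff)
qed

section \<open>Pointwise bounds for the logarithm\<close>

lemma zlog_term_le:
  fixes z w :: complex
  assumes "z \<noteq> w"
  shows "ln (norm (z - w) / max 1 (norm w)) \<le> ln (1 + norm z / max 1 (norm w))"
proof (subst ln_le_cancel_iff)
  have "norm (z - w) \<le> max 1 (norm w) + norm z"
    using norm_triangle_ineq4[of z w] by linarith
  then have "norm (z - w) / max 1 (norm w) \<le> (max 1 (norm w) + norm z) / max 1 (norm w)"
    by (intro divide_right_mono) auto
  also have "\<dots> = 1 + norm z / max 1 (norm w)" by (simp add: add_divide_distrib)
  finally show "norm (z - w) / max 1 (norm w) \<le> 1 + norm z / max 1 (norm w)" .
  show "0 < norm (z - w) / max 1 (norm w)" using assms by (intro divide_pos_pos) auto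
  show "0 < 1 + norm z / max 1 (norm w)" by (intro add_pos_nonneg divide_nonneg_pos) auto
qed

text \<open>ln (1 + t) \<le> t bounds each term by its weight times |z|. Along the sequence this
  becomes an a priori bound uniform in n after division by \<open>k n\<close>, which supplies the
  majorant for Fatou's lemma.\<close>

lemma norm_le_exp_star_degree: "norm (f z) \<le> C1 * exp (star_degree f * norm z)"
proof (cases "f z = 0")
  case True then show ?thesis using C1_pos by simp
next
  case False
  have "zlog f (zeros_ball f r) z \<le> star_degree f * norm z" for r
  proof -
    have "zlog f (zeros_ball f r) z \<le> (\<Sum>w\<in>zeros_ball f r. wt w * norm z)"
      unfolding zlog_def
    proof (rule sum_mono)
      fix w assume w: "w \<in> zeros_ball f r"
      then have "z \<noteq> w" using False by (auto simp: zeros_ball_def)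
      then have "ln (norm (z - w) / max 1 (norm w)) \<le> ln (1 + norm z / max 1 (norm w))" by (rule zlog_term_le)
      also have "\<dots> \<le> norm z / max 1 (norm w)" by (intro ln_add_one_self_le_self divide_nonneg_pos) auto
      finally have "real (zmult f w) * ln (norm (z - w) / max 1 (norm w)) \<le> real (zmult f w) * (norm z / max 1 (norm w))"
        by (intro mult_left_mono) auto
      then show "real (zmult f w) * ln (norm (z - w) / max 1 (norm w)) \<le> wt w * norm z" by (simp add: wt_def)
    qed
    also have "\<dots> \<le> star_degree f * norm z"
      using sum_wt_zeros_ball[of r "{}"] by (simp add: mult_right_mono flip: sum_distrib_right)
    finally show ?thesis .
  qed
  then have "ln (norm (f z)) - ln C1 \<le> star_degree f * norm z"
    by (intro tendsto_upperbound[OF zlog_limit[OF False]]) auto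
  then have "exp (ln (norm (f z))) \<le> exp (ln C1 + star_degree f * norm z)" by simp
  then show ?thesis using False C1_pos by (simp add: exp_add)
qed

text \<open>For |w| \<ge> S \<ge> 2 |z|, ln |1 - z / w| equals - Re (z / w) up to 2 |z / w|^2. The
  linear terms are summed before absolute values are taken, because along the sequence the sum of 1
  / w is assumed small, not that of 1 / |w|; the quadratic terms gain a factor 1 / S over the
  weights.\<close>

lemma ln_norm_estimate:
  assumes S: "S \<ge> 2" and z: "norm z \<le> S / 2" and fz: "f z \<noteq> 0"
  shows "\<bar>ln (norm (f z)) - ln C1 - zlog f (zeros_ball f S) z\<bar>
    \<le> norm z * norm (tail_sum f S) + 2 * (norm z)\<^sup>2 * star_degree f / S"
proof -
  define T where "T r = (\<Sum>w\<in>zeros_ball f r - zeros_ball f S. of_nat (zmult f w) / w)" for r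
  have bound: "\<bar>zlog f (zeros_ball f r) z - zlog f (zeros_ball f S) z\<bar> \<le> norm z * norm (T r) + 2 * (norm z)\<^sup>2 * star_degree f / S"
    if r: "r \<ge> S" for r
  proof -
    let ?D = "zeros_ball f r - zeros_ball f S"
    have "zlog f (zeros_ball f r) z = zlog f ?D z + zlog f (zeros_ball f S) z"
      unfolding zlog_def using r by (intro sum.subset_diff finite_zeros_ball) (auto simp: zeros_ball_def)
    moreover have "\<bar>zlog f ?D z + Re (z * T r)\<bar> \<le> 2 * (norm z)\<^sup>2 * star_degree f / S"
    proof -
      have "zlog f ?D z + Re (z * T r) = (\<Sum>w\<in>?D. real (zmult f w) * (ln (norm (z - w) / max 1 (norm w)) + Re (z / w)))"
        unfolding zlog_def T_def sum_distrib_left Re_sum sum.distrib[symmetric]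
      proof (intro sum.cong refl)
        fix w
        have "z * (of_nat (zmult f w) / w) = of_real (real (zmult f w)) * (z / w)" by simp
        then have "Re (z * (of_nat (zmult f w) / w)) = real (zmult f w) * Re (z / w)" by (simp only: Re_complex_of_real Im_complex_of_real times_complex.sel mult_zero_left diff_0_right)
        then show "real (zmult f w) * ln (norm (z - w) / max 1 (norm w)) + Re (z * (of_nat (zmult f w) / w)) = real (zmult f w) * (ln (norm (z - w) / max 1 (norm w)) + Re (z / w))"
          by (simp add: algebra_simps)
      qed
      also have "\<bar>\<dots>\<bar> \<le> (\<Sum>w\<in>?D. wt w * (2 * (norm z)\<^sup>2 / S))"
      proof (rule order_trans[OF sum_abs sum_mono])
        fix w assume w: "w \<in> ?D"
        have wS: "norm w \<ge> S" and w0: "w \<noteq> 0" using w S by (auto simp: zeros_ball_def)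
        define t where "t = z / w"
        have t: "norm t \<le> 1 / 2" using z wS S w0 by (simp add: t_def norm_divide divide_simps)
        have t1: "1 - t \<noteq> 0" using t by auto
        have "norm (z - w) / max 1 (norm w) = norm (1 - t)"
          using w0 wS S by (simp add: t_def diff_divide_eq_iff norm_divide norm_minus_commute)
        moreover have "ln (norm (1 - t)) = Re (Ln (1 - t))" using t1 by simp
        moreover have "norm (ln (1 + (- t)) - (- t)) \<le> (norm (- t))\<^sup>2 / (1 - norm (- t))"
          using t by (intro Ln_approx_linear) auto
        then have "norm (Ln (1 - t) + t) \<le> (norm t)\<^sup>2 / (1 - norm t)" by simp
        moreover have "\<dots> \<le> (norm t)\<^sup>2 / (1 / 2)" using t by (intro divide_left_mono) auto
        moreover have "\<bar>Re (Ln (1 - t) + t)\<bar> \<le> norm (Ln (1 - t) + t)" by (rule abs_Re_le_cmod)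
        ultimately have "\<bar>ln (norm (z - w) / max 1 (norm w)) + Re t\<bar> \<le> 2 * (norm t)\<^sup>2" by simp
        also have "\<dots> \<le> 2 * (norm z)\<^sup>2 / S / max 1 (norm w)"
        proof -
          have "(norm t)\<^sup>2 = (norm z)\<^sup>2 / (norm w * norm w)" by (simp add: t_def norm_divide power_divide power2_eq_square)
          also have "\<dots> \<le> (norm z)\<^sup>2 / (S * norm w)" using wS S w0 by (intro divide_left_mono mult_right_mono mult_pos_pos) auto
          finally show ?thesis using wS S by (simp add: max_def)
        qed
        finally have "real (zmult f w) * \<bar>ln (norm (z - w) / max 1 (norm w)) + Re t\<bar> \<le> real (zmult f w) * (2 * (norm z)\<^sup>2 / S / max 1 (norm w))"
          by (intro mult_left_mono) auto
        then show "\<bar>real (zmult f w) * (ln (norm (z - w) / max 1 (norm w)) + Re (z / w))\<bar> \<le> wt w * (2 * (norm z)\<^sup>2 / S)"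
          by (simp add: wt_def abs_mult t_def mult_ac)
      qed
      also have "\<dots> \<le> star_degree f * (2 * (norm z)\<^sup>2 / S)"
        using sum_wt_zeros_ball[of r "zeros_ball f S"] S unfolding sum_distrib_right[symmetric] by (intro mult_right_mono) auto
      finally show ?thesis by (simp add: mult_ac)
    qed
    moreover have "\<bar>Re (z * T r)\<bar> \<le> norm z * norm (T r)" using abs_Re_le_cmod[of "z * T r"] by (simp add: norm_mult)
    ultimately show ?thesis by linarith
  qed
  have lim1: "((\<lambda>r. \<bar>zlog f (zeros_ball f r) z - zlog f (zeros_ball f S) z\<bar>) \<longlongrightarrow> \<bar>ln (norm (f z)) - ln C1 - zlog f (zeros_ball f S) z\<bar>) at_top"
    by (intro tendsto_intros zlog_limit fz)
  have lim2: "((\<lambda>r. norm z * norm (T r) + 2 * (norm z)\<^sup>2 * star_degree f / S) \<longlongrightarrow> norm z * norm (tail_sum f S) + 2 * (norm z)\<^sup>2 * star_degree f / S) at_top"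
    unfolding T_def by (intro tendsto_intros tail_sum_limit) (use S in auto)
  show ?thesis
    by (rule tendsto_le[OF trivial_limit_at_top_linorder lim2 lim1 eventually_mono[OF eventually_ge_at_top[of S]]])
       (rule bound)
qed

lemma ln_norm_upper:
  assumes S: "S \<ge> 2" and z: "norm z \<le> S / 2" and fz: "f z \<noteq> 0"
  shows "ln (norm (f z)) \<le> ln C1 + zcount f S * ln (1 + norm z) + norm z * norm (tail_sum f S) + 2 * (norm z)\<^sup>2 * star_degree f / S"
proof -
  have "zlog f (zeros_ball f S) z \<le> (\<Sum>w\<in>zeros_ball f S. real (zmult f w) * ln (1 + norm z))"
    unfolding zlog_def
  proof (intro sum_mono mult_left_mono)
    fix w assume w: "w \<in> zeros_ball f S"
    then have "z \<noteq> w" using fz by (auto simp: zeros_ball_def)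
    then have "ln (norm (z - w) / max 1 (norm w)) \<le> ln (1 + norm z / max 1 (norm w))" by (rule zlog_term_le)
    also have "\<dots> \<le> ln (1 + norm z)"
    proof (subst ln_le_cancel_iff)
      have "norm z / max 1 (norm w) \<le> norm z / 1" by (intro divide_left_mono) auto
      then show "1 + norm z / max 1 (norm w) \<le> 1 + norm z" by simp
    qed (auto intro!: add_pos_nonneg divide_nonneg_pos)
    finally show "ln (norm (z - w) / max 1 (norm w)) \<le> ln (1 + norm z)" .
  qed auto
  also have "\<dots> = zcount f S * ln (1 + norm z)" by (simp add: zcount_def sum_distrib_right)
  finally show ?thesis using ln_norm_estimate[OF assms] by linarith
qed

end

section \<open>Measures with bounded logarithmic potential\<close>

text \<open>The logarithmic kernel, scaled by \<open>L\<close> so that it is nonnegative on sets of diameter at most \<open>L\<close>;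
  negative values are truncated to 0 by \<^const>\<open>ennreal\<close>.\<close>
definition lkern :: "real \<Rightarrow> complex \<Rightarrow> complex \<Rightarrow> ennreal" where
  "lkern L z w = (if z = w then \<infinity> else ennreal (ln (L / dist z w)))"

definition lpot :: "real \<Rightarrow> complex measure \<Rightarrow> complex \<Rightarrow> ennreal" where
  "lpot L \<mu> z = (\<integral>\<^sup>+w. lkern L z w \<partial>\<mu>)"

definition lenergy :: "real \<Rightarrow> complex measure \<Rightarrow> ennreal" where
  "lenergy L \<mu> = (\<integral>\<^sup>+z. lpot L \<mu> z \<partial>\<mu>)"

lemma lkern_sym: "lkern L z w = lkern L w z"
  by (simp add: lkern_def dist_commute)

lemma measurable_lkern [measurable (raw)]:
  assumes [measurable]: "f \<in> M \<rightarrow>\<^sub>M borel" "g \<in> M \<rightarrow>\<^sub>M borel"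
  shows "(\<lambda>x. lkern L (f x) (g x)) \<in> borel_measurable M"
  unfolding lkern_def by measurable

lemma measurable_lpot:
  assumes "finite_measure \<mu>" and [measurable_cong]: "sets \<mu> = sets borel"
  shows "lpot L \<mu> \<in> borel_measurable borel"
proof -
  interpret finite_measure \<mu> by fact
  show ?thesis unfolding lpot_def by measurable
qed

lemma lkern_lower_semicontinuous:
  assumes x: "x \<longlonglongrightarrow> z" and L: "L > 0"
  shows "lkern L z w \<le> liminf (\<lambda>i. lkern L (x i) w)"
proof (cases "z = w")
  case False
  have "eventually (\<lambda>i. x i \<noteq> w) sequentially" using tendsto_imp_eventually_ne[OF x False] .
  then have e: "eventually (\<lambda>i. ennreal (ln (L / dist (x i) w)) = lkern L (x i) w) sequentially"
    by eventually_elim (simp add: lkern_def)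
  have "(\<lambda>i. ennreal (ln (L / dist (x i) w))) \<longlonglongrightarrow> ennreal (ln (L / dist z w))"
    using False L by (intro tendsto_intros x) auto
  then have "(\<lambda>i. lkern L (x i) w) \<longlonglongrightarrow> ennreal (ln (L / dist z w))"
    by (rule Lim_transform_eventually[OF _ e])
  then have "liminf (\<lambda>i. lkern L (x i) w) = ennreal (ln (L / dist z w))"
    by (intro lim_imp_Liminf) auto
  then show ?thesis using False by (simp add: lkern_def)
next
  case True
  show ?thesis
  proof (subst le_Liminf_iff, intro allI impI)
    fix y assume "y < lkern L z w"
    then have "y < \<top>" by (simp add: lkern_def True)
    then obtain c where c: "c \<ge> 0" "y = ennreal c" by (cases y) auto
    \<comment> \<open>Within this distance of the diagonal the kernel exceeds
      \<open>c + 1\<close>.\<close>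
    have "eventually (\<lambda>i. dist (x i) z < L * exp (- (c + 1))) sequentially"
      using L by (intro tendstoD[OF x]) auto
    then show "eventually (\<lambda>i. y < lkern L (x i) w) sequentially"
    proof eventually_elim
      case (elim i)
      show ?case
      proof (cases "x i = w")
        case False
        then have d: "dist (x i) w > 0" by simp
        have "exp (c + 1) < L / dist (x i) w"
        proof -
          have "dist (x i) w * exp (c + 1) < L * exp (- (c + 1)) * exp (c + 1)"
            using elim True by (intro mult_strict_right_mono) auto
          also have "\<dots> = L" by (simp flip: exp_add)
          finally show ?thesis using d by (simp add: field_simps)
        qed
        then have "c + 1 < ln (L / dist (x i) w)"
          using ln_less_cancel_iff[of "exp (c + 1)" "L / dist (x i) w"] d L by (simp only: exp_gt_zero divide_pos_pos ln_exp)
        then show ?thesis using c False by (simp add: lkern_def ennreal_less_iff)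
      qed (use c in \<open>simp add: lkern_def\<close>)
    qed
  qed
qed

text \<open>The kernel is nonnegative and lower semicontinuous, also on the diagonal where it is
  infinite, so Fatou's lemma applies.\<close>

lemma lpot_lower_semicontinuous:
  assumes "finite_measure \<mu>" and [measurable_cong]: "sets \<mu> = sets borel" and L: "L > 0" and x: "x \<longlonglongrightarrow> z"
  shows "lpot L \<mu> z \<le> liminf (\<lambda>i. lpot L \<mu> (x i))"
proof -
  have "lpot L \<mu> z \<le> (\<integral>\<^sup>+w. liminf (\<lambda>i. lkern L (x i) w) \<partial>\<mu>)"
    unfolding lpot_def by (intro nn_integral_mono lkern_lower_semicontinuous x L)
  also have "\<dots> \<le> liminf (\<lambda>i. \<integral>\<^sup>+w. lkern L (x i) w \<partial>\<mu>)"
    by (rule nn_integral_liminf) measurable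
  finally show ?thesis by (simp add: lpot_def)
qed

text \<open>Closedness is what lets the maximum principle below project onto a nearest point of such
  a set.\<close>

lemma closed_lpot_sublevel:
  assumes "finite_measure \<mu>" "sets \<mu> = sets borel" "L > 0" "closed K"
  shows "closed {z \<in> K. lpot L \<mu> z \<le> c}"
  unfolding closed_sequential_limits
proof (intro allI impI, elim conjE)
  fix x z assume x: "\<forall>n. x n \<in> {z \<in> K. lpot L \<mu> z \<le> c}" and l: "x \<longlonglongrightarrow> z"
  have "z \<in> K" using x l \<open>closed K\<close> by (auto simp: closed_sequential_limits)
  moreover have "lpot L \<mu> z \<le> liminf (\<lambda>i. lpot L \<mu> (x i))"
    by (rule lpot_lower_semicontinuous[OF assms(1-3) l])
  moreover have "liminf (\<lambda>i. lpot L \<mu> (x i)) \<le> liminf (\<lambda>i. c)"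
    using x by (intro Liminf_mono) auto
  ultimately show "z \<in> {z \<in> K. lpot L \<mu> z \<le> c}" by (simp add: Liminf_const order_trans)
qed

text \<open>On \<open>K\<close> the kernel for \<open>L\<close> is nonnegative and exceeds ln (1 /
  |z - w|) by ln L. Positive parts are added on both sides instead of subtracting, and the positive
  part of ln |z - w| is cancelled at the end, where its integral is finite.\<close>

lemma log_energy_conv_lenergy:
  assumes [measurable_cong]: "sets \<mu> = sets borel" and P: "prob_space \<mu>" and K: "emeasure \<mu> K = 1"
    and KR: "K \<subseteq> cball 0 R" "K \<in> sets borel" and R: "R \<ge> 1" and L: "L \<ge> 2 * R"
  shows "log_energy \<mu> = enn2ereal (lenergy L \<mu>) - ereal (ln L)"
proof -
  interpret prob_space \<mu> by fact
  have L1: "L \<ge> 1" using R L by simp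
  have space: "space \<mu> = UNIV" using sets_eq_imp_space_eq[OF assms(1)] by simp
  have "AE z in \<mu>. z \<in> K"
    using K KR(2) assms(1) by (subst AE_in_set_eq_1) (auto simp: emeasure_eq_measure)
  then have AEK: "AE z in \<mu>. norm z \<le> R" by eventually_elim (use KR(1) in auto)
  have dL: "dist z w \<le> L" if "norm z \<le> R" "norm w \<le> R" for z w :: complex
    using norm_triangle_ineq4[of z w] that L by (simp add: dist_norm)
  define pos where "pos z w = e2ennreal (ereal_ln (dist z w))" for z w :: complex
  have neg: "e2ennreal (- ereal_ln (dist z w)) = lkern 1 z w" for z w :: complex
    by (auto simp: ereal_ln_def lkern_def ln_div e2ennreal_infty simp flip: ereal_uminus_eq_reorder)
  have pos: "pos z w = (if z = w then 0 else ennreal (ln (dist z w)))" for z w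
    by (auto simp: ereal_ln_def pos_def e2ennreal_neg)
  have [measurable]: "(\<lambda>x. pos (f x) (g x)) \<in> borel_measurable M" if [measurable]: "f \<in> M \<rightarrow>\<^sub>M borel" "g \<in> M \<rightarrow>\<^sub>M borel" for f g and M :: "'b measure"
    unfolding pos by measurable
  have eq: "lkern L z w + pos z w = lkern 1 z w + ennreal (ln L)" if "norm z \<le> R" "norm w \<le> R" for z w
  proof (cases "z = w")
    case False
    then have d: "dist z w > 0" "dist z w \<le> L" using dL that by auto
    have a: "ln (L / dist z w) = ln L - ln (dist z w)" "ln (1 / dist z w) = - ln (dist z w)" using d L1 by (auto simp: ln_div)
    have b: "ln (dist z w) \<le> ln L" "0 \<le> ln L" using d L1 by auto
    show ?thesis
    proof (cases "ln (dist z w) \<ge> 0")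
      case True then show ?thesis using False a b by (simp add: lkern_def pos ennreal_neg flip: ennreal_plus)
    next
      case F: False then show ?thesis using False a b by (simp add: lkern_def pos ennreal_neg flip: ennreal_plus)
    qed
  qed (simp add: lkern_def)
  define PP where "PP = (\<integral>\<^sup>+z. (\<integral>\<^sup>+w. pos z w \<partial>\<mu>) \<partial>\<mu>)"
  have "PP \<le> (\<integral>\<^sup>+z. (\<integral>\<^sup>+w. ennreal (ln L) \<partial>\<mu>) \<partial>\<mu>)"
    unfolding PP_def
  proof (rule nn_integral_mono_AE)
    show "AE z in \<mu>. (\<integral>\<^sup>+w. pos z w \<partial>\<mu>) \<le> (\<integral>\<^sup>+w. ennreal (ln L) \<partial>\<mu>)"
      using AEK
    proof eventually_elim
      case (elim z)
      show ?case
      proof (rule nn_integral_mono_AE)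
        show "AE w in \<mu>. pos z w \<le> ennreal (ln L)"
          using AEK
        proof eventually_elim
          case (elim w)
          then show ?case using dL[OF \<open>norm z \<le> R\<close> elim] L1 by (auto simp: pos intro!: ennreal_leI)
        qed
      qed
    qed
  qed
  also have "\<dots> = ennreal (ln L)" by (simp add: emeasure_space_1)
  finally have PPf: "PP \<le> ennreal (ln L)" .
  have "lenergy L \<mu> + PP = lenergy 1 \<mu> + ennreal (ln L)"
  proof -
    have "lenergy L \<mu> + PP = (\<integral>\<^sup>+z. (\<integral>\<^sup>+w. lkern L z w + pos z w \<partial>\<mu>) \<partial>\<mu>)"
      unfolding lenergy_def lpot_def PP_def by (subst nn_integral_add[symmetric]; (measurable)?) (simp add: nn_integral_add)
    also have "\<dots> = (\<integral>\<^sup>+z. (\<integral>\<^sup>+w. lkern 1 z w + ennreal (ln L) \<partial>\<mu>) \<partial>\<mu>)"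
    proof (rule nn_integral_cong_AE)
      show "AE z in \<mu>. (\<integral>\<^sup>+w. lkern L z w + pos z w \<partial>\<mu>) = (\<integral>\<^sup>+w. lkern 1 z w + ennreal (ln L) \<partial>\<mu>)"
        using AEK
      proof eventually_elim
        case (elim z)
        show ?case
        proof (rule nn_integral_cong_AE)
          show "AE w in \<mu>. lkern L z w + pos z w = lkern 1 z w + ennreal (ln L)"
            using AEK by eventually_elim (use eq elim in auto)
        qed
      qed
    qed
    also have "\<dots> = lenergy 1 \<mu> + ennreal (ln L)"
      unfolding lenergy_def lpot_def by (simp add: nn_integral_add emeasure_space_1)
    finally show ?thesis .
  qed
  moreover have "log_energy \<mu> = enn2ereal (lenergy 1 \<mu>) - enn2ereal PP"
    by (simp add: log_energy_def neg lenergy_def lpot_def PP_def pos_def)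
  moreover have "PP < \<top>" using PPf by (rule le_less_trans) simp
  then obtain p where p: "PP = ennreal p" "p \<ge> 0" by (cases PP) auto
  ultimately show ?thesis
    using L1 by (cases "lenergy L \<mu>"; cases "lenergy 1 \<mu>") (auto simp: simp flip: ennreal_plus)
qed

text \<open>A crude maximum principle: passing to the nearest point of the support costs only \<open>ln 2\<close>.\<close>
lemma lkern_le_lkern_nearest:
  assumes w': "w' \<in> B" "\<And>z. z \<in> B \<Longrightarrow> dist w w' \<le> dist w z" and z: "z \<in> B" and L: "L > 0"
  shows "lkern L w z \<le> lkern L w' z + ennreal (ln 2)"
proof (cases "z = w' \<or> z = w")
  case True
  then show ?thesis using w'(2)[OF z] by (auto simp: lkern_def)
next
  case False
  then have d: "dist w z > 0" "dist w' z > 0" by auto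
  have "dist w' z \<le> 2 * dist w z" using dist_triangle[of w' z w] w'(2)[OF z] by (simp add: dist_commute)
  then have "L / dist w z \<le> 2 * (L / dist w' z)" using d L by (simp add: divide_simps)
  then have "ln (L / dist w z) \<le> ln (2 * (L / dist w' z))" using d L by (subst ln_le_cancel_iff) auto
  also have "\<dots> = ln (L / dist w' z) + ln 2" using d L by (subst ln_mult) auto
  finally have "ennreal (ln (L / dist w z)) \<le> ennreal (ln (L / dist w' z) + ln 2)" by (rule ennreal_leI)
  also have "\<dots> \<le> ennreal (ln (L / dist w' z)) + ennreal (ln 2)"
    by (cases "ln (L / dist w' z) \<ge> 0") (auto simp: ennreal_neg intro!: ennreal_leI simp flip: ennreal_plus)
  finally show ?thesis using False by (auto simp: lkern_def)
qed

section \<open>Near-minimisers of the energy\<close>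

lemma lenergy_density:
  assumes "finite_measure \<nu>" and [measurable_cong]: "sets \<nu> = sets borel" and [measurable]: "\<phi> \<in> borel_measurable borel"
  shows "lenergy L (density \<nu> \<phi>) = (\<integral>\<^sup>+z. (\<integral>\<^sup>+w. \<phi> z * \<phi> w * lkern L z w \<partial>\<nu>) \<partial>\<nu>)"
proof -
  interpret finite_measure \<nu> by fact
  have p: "lpot L (density \<nu> \<phi>) z = (\<integral>\<^sup>+w. \<phi> w * lkern L z w \<partial>\<nu>)" for z
    unfolding lpot_def by (subst nn_integral_density) auto
  have "lenergy L (density \<nu> \<phi>) = (\<integral>\<^sup>+z. \<phi> z * (\<integral>\<^sup>+w. \<phi> w * lkern L z w \<partial>\<nu>) \<partial>\<nu>)"
    unfolding lenergy_def p by (subst nn_integral_density) auto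
  also have "\<dots> = (\<integral>\<^sup>+z. (\<integral>\<^sup>+w. \<phi> z * \<phi> w * lkern L z w \<partial>\<nu>) \<partial>\<nu>)"
    by (intro nn_integral_cong) (simp add: nn_integral_cmult mult.assoc)
  finally show ?thesis .
qed

text \<open>If a near-minimiser of the energy gave mass \<open>m\<close> to the set where its potential exceeds
  \<open>W + 1\<close>, then scaling it down there by \<open>1 - s\<close> would lower the energy.\<close>
lemma near_minimiser_exceptional_mass:
  assumes "prob_space \<nu>" and [measurable_cong]: "sets \<nu> = sets borel"
    and W: "W \<ge> 0" and d: "d \<ge> 0" and s: "0 < s" "s < 1"
    and A: "A \<in> sets borel" "\<And>z. z \<in> A \<Longrightarrow> lpot L \<nu> z \<ge> ennreal (W + 1)"
    and e: "lenergy L \<nu> \<le> ennreal (W + d)"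
    and min: "\<And>\<phi>. \<phi> \<in> borel_measurable borel \<Longrightarrow> prob_space (density \<nu> \<phi>) \<Longrightarrow> lenergy L (density \<nu> \<phi>) \<ge> ennreal W"
  shows "2 * s * measure \<nu> A \<le> d + s\<^sup>2 * (W + d)"
proof -
  interpret prob_space \<nu> by fact
  interpret pair_sigma_finite \<nu> \<nu> ..
  note [measurable] = A(1)
  define m where "m = measure \<nu> A"
  have m: "0 \<le> m" "m \<le> 1" by (auto simp: m_def)
  have sm: "s * m < 1" using s m mult_left_mono[of m 1 s] by linarith
  define \<psi> :: "complex \<Rightarrow> real" where "\<psi> z = 1 - s * indicator A z" for z
  have \<psi>: "0 \<le> \<psi> z" "\<psi> z \<le> 1" for z using s by (auto simp: \<psi>_def indicator_def)
  define \<phi> :: "complex \<Rightarrow> ennreal" where "\<phi> z = ennreal (\<psi> z / (1 - s * m))" for z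
  have [measurable]: "\<psi> \<in> borel_measurable borel" unfolding \<psi>_def by measurable
  have [measurable]: "\<phi> \<in> borel_measurable borel" unfolding \<phi>_def by measurable
  have prob: "prob_space (density \<nu> \<phi>)"
  proof (rule prob_spaceI)
    have "emeasure (density \<nu> \<phi>) (space (density \<nu> \<phi>)) = (\<integral>\<^sup>+z. \<phi> z \<partial>\<nu>)"
      by (simp add: emeasure_density cong: nn_integral_cong)
    also have "\<dots> = ennreal (integral\<^sup>L \<nu> (\<lambda>z. \<psi> z / (1 - s * m)))"
      unfolding \<phi>_def using \<psi> sm
      by (intro nn_integral_eq_integral integrable_const_bound[where B = "1 / (1 - s * m)"]) (auto simp: divide_right_mono)
    also have "integral\<^sup>L \<nu> (\<lambda>z. \<psi> z / (1 - s * m)) = (1 - s * m) / (1 - s * m)"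
    proof -
      have "integrable \<nu> (\<lambda>z. s * indicator A z)"
        by (intro integrable_mult_right integrable_const_bound[where B = 1]) (auto simp: indicator_def)
      then have "integral\<^sup>L \<nu> (\<lambda>z. 1 - s * indicator A z) = 1 - s * m"
        by (subst Bochner_Integration.integral_diff) (auto simp: m_def prob_space)
      then show ?thesis by (simp add: \<psi>_def)
    qed
    finally show "emeasure (density \<nu> \<phi>) (space (density \<nu> \<phi>)) = 1" using sm by simp
  qed
  define J where "J = (\<integral>\<^sup>+z. (\<integral>\<^sup>+w. ennreal (\<psi> z) * ennreal (\<psi> w) * lkern L z w \<partial>\<nu>) \<partial>\<nu>)"
  have "ennreal W \<le> lenergy L (density \<nu> \<phi>)" by (rule min[OF _ prob]) measurable
  also have "\<dots> = (\<integral>\<^sup>+z. (\<integral>\<^sup>+w. \<phi> z * \<phi> w * lkern L z w \<partial>\<nu>) \<partial>\<nu>)"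
    by (rule lenergy_density[OF finite_measure_axioms assms(2)]) measurable
  also have "\<dots> = (\<integral>\<^sup>+z. (\<integral>\<^sup>+w. ennreal (1 / (1 - s * m)^2) * (ennreal (\<psi> z) * ennreal (\<psi> w) * lkern L z w) \<partial>\<nu>) \<partial>\<nu>)"
  proof (intro nn_integral_cong)
    fix z w
    have "\<phi> z * \<phi> w = ennreal (1 / (1 - s * m)^2) * (ennreal (\<psi> z) * ennreal (\<psi> w))"
      unfolding \<phi>_def using \<psi> sm by (simp add: power2_eq_square flip: ennreal_mult)
    then show "\<phi> z * \<phi> w * lkern L z w = ennreal (1 / (1 - s * m)^2) * (ennreal (\<psi> z) * ennreal (\<psi> w) * lkern L z w)"
      by (simp add: mult.assoc)
  qed
  also have "\<dots> = ennreal (1 / (1 - s * m)^2) * J"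
    unfolding J_def by (simp add: nn_integral_cmult)
  finally have WJ: "ennreal W \<le> ennreal (1 / (1 - s * m)^2) * J" .
  let ?I = "\<lambda>z. ennreal s * indicator A z"
  \<comment> \<open>The product \<open>\<psi> z * \<psi> w\<close> is 1, minus \<open>s\<close> for
    each of the two points in \<open>A\<close>, plus s^2 if both are; the negative terms stand on
    the left so that everything stays in \<open>ennreal\<close>.\<close>
  have sum: "ennreal (\<psi> z) * ennreal (\<psi> w) * lkern L z w + (?I z * lkern L z w + ?I w * lkern L w z)
      \<le> lkern L z w + ennreal (s\<^sup>2) * lkern L z w" for z w
  proof -
    have "ennreal (\<psi> z) * ennreal (\<psi> w) + (ennreal (s * indicator A z) + ennreal (s * indicator A w)) \<le> 1 + ennreal (s\<^sup>2)"
      using s \<psi> by (simp flip: ennreal_mult ennreal_plus ennreal_1 del: ennreal_1)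
        (auto simp: \<psi>_def indicator_def power2_eq_square algebra_simps intro!: ennreal_leI)
    then have "(ennreal (\<psi> z) * ennreal (\<psi> w) + (ennreal (s * indicator A z) + ennreal (s * indicator A w))) * lkern L z w
      \<le> (1 + ennreal (s\<^sup>2)) * lkern L z w" by (rule mult_right_mono) simp
    moreover have "ennreal (s * indicator A z) = ?I z" for z by (auto simp: indicator_def)
    ultimately show ?thesis by (simp add: distrib_right lkern_sym[of L w z])
  qed
  have pA: "ennreal s * (ennreal (W + 1) * ennreal m) \<le> (\<integral>\<^sup>+z. (\<integral>\<^sup>+w. ?I z * lkern L z w \<partial>\<nu>) \<partial>\<nu>)"
  proof -
    have "ennreal s * (ennreal (W + 1) * ennreal m) = (\<integral>\<^sup>+z. ennreal s * (ennreal (W + 1) * indicator A z) \<partial>\<nu>)"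
      by (simp add: nn_integral_cmult m_def emeasure_eq_measure)
    also have "\<dots> \<le> (\<integral>\<^sup>+z. ?I z * lpot L \<nu> z \<partial>\<nu>)"
      by (intro nn_integral_mono) (auto simp: indicator_def intro!: mult_left_mono A(2))
    also have "\<dots> = (\<integral>\<^sup>+z. (\<integral>\<^sup>+w. ?I z * lkern L z w \<partial>\<nu>) \<partial>\<nu>)"
      unfolding lpot_def by (intro nn_integral_cong) (simp add: nn_integral_cmult)
    finally show ?thesis .
  qed
  have swap: "(\<integral>\<^sup>+z. (\<integral>\<^sup>+w. ?I w * lkern L w z \<partial>\<nu>) \<partial>\<nu>) = (\<integral>\<^sup>+z. (\<integral>\<^sup>+w. ?I z * lkern L z w \<partial>\<nu>) \<partial>\<nu>)"
    by (rule Fubini') measurable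
  have "J + (ennreal s * (ennreal (W + 1) * ennreal m) + ennreal s * (ennreal (W + 1) * ennreal m))
    \<le> J + ((\<integral>\<^sup>+z. (\<integral>\<^sup>+w. ?I z * lkern L z w \<partial>\<nu>) \<partial>\<nu>) + (\<integral>\<^sup>+z. (\<integral>\<^sup>+w. ?I w * lkern L w z \<partial>\<nu>) \<partial>\<nu>))"
    unfolding swap by (intro add_mono pA order_refl)
  also have "\<dots> = (\<integral>\<^sup>+z. (\<integral>\<^sup>+w. ennreal (\<psi> z) * ennreal (\<psi> w) * lkern L z w + (?I z * lkern L z w + ?I w * lkern L w z) \<partial>\<nu>) \<partial>\<nu>)"
    unfolding J_def by (simp add: nn_integral_add)
  also have "\<dots> \<le> (\<integral>\<^sup>+z. (\<integral>\<^sup>+w. lkern L z w + ennreal (s\<^sup>2) * lkern L z w \<partial>\<nu>) \<partial>\<nu>)"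
    by (intro nn_integral_mono sum)
  also have "\<dots> = lenergy L \<nu> + ennreal (s\<^sup>2) * lenergy L \<nu>"
    unfolding lenergy_def lpot_def by (simp add: nn_integral_add nn_integral_cmult)
  also have "\<dots> \<le> ennreal (W + d) + ennreal (s\<^sup>2) * ennreal (W + d)"
    by (intro add_mono mult_left_mono e) auto
  also have "\<dots> = ennreal ((W + d) + s\<^sup>2 * (W + d))"
    using W d by (simp flip: ennreal_mult ennreal_plus)
  finally have le: "J + (ennreal s * (ennreal (W + 1) * ennreal m) + ennreal s * (ennreal (W + 1) * ennreal m)) \<le> ennreal ((W + d) + s\<^sup>2 * (W + d))" .
  have "J \<le> ennreal ((W + d) + s\<^sup>2 * (W + d))" using le by (rule order_trans[rotated]) simp
  then have "J < \<top>" by (rule le_less_trans) simp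
  then obtain j where j: "J = ennreal j" "j \<ge> 0" by (cases J) auto
  have 1: "j + 2 * (s * ((W + 1) * m)) \<le> (W + d) + s\<^sup>2 * (W + d)"
    using le j s W m d by (simp flip: ennreal_mult ennreal_plus) (simp add: mult_ac)
  \<comment> \<open>Renormalising the mass costs 2 s m W to first order, whereas scaling down
    \<open>A\<close> saves 2 s m (W + 1); the surplus 2 s m has to fit into the errors.\<close>
  have "W \<le> 1 / (1 - s * m)^2 * j"
    using WJ j sm W by (simp flip: ennreal_mult)
  then have "W * (1 - s * m)^2 \<le> j" using sm by (simp add: field_simps)
  moreover have "W * (1 - s * m)^2 = W - 2 * (W * s * m) + W * (s * m)\<^sup>2" by (simp add: power2_eq_square algebra_simps)
  moreover have "W * (s * m)\<^sup>2 \<ge> 0" using W by simp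
  ultimately have "2 * (s * m) \<le> d + s\<^sup>2 * (W + d)" using 1 by (simp add: algebra_simps)
  then show ?thesis by (simp add: m_def)
qed

text \<open>Existence of a minimiser is bypassed: a near-minimiser is restricted to the closed set
  \<open>B\<close> where its potential is at most W + 1 and renormalised. This raises the bound on
  \<open>B\<close> to W + 2, and projection onto \<open>B\<close> gives W + 3 everywhere. The last
  conclusion expresses W \<ge> 0.\<close>

lemma exists_bounded_potential_measure:
  assumes K: "compact K" "K \<subseteq> cball 0 R" and R: "R \<ge> 1" and L: "L \<ge> 2 * R" and cap: "log_capacity K > 0"
  shows "\<exists>\<tau>. sets \<tau> = sets borel \<and> prob_space \<tau> \<and> emeasure \<tau> K = 1 \<and>
    (\<forall>w. lpot L \<tau> w \<le> ennreal (ln (L / log_capacity K) + 3)) \<and> L / log_capacity K \<ge> 1"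
proof -
  let ?M = "{\<mu>. sets \<mu> = sets borel \<and> prob_space \<mu> \<and> emeasure \<mu> K = 1}"
  have Kb: "K \<in> sets borel" using K(1) by (simp add: borel_closed compact_imp_closed)
  have L1: "L \<ge> 1" using R L by simp
  have en: "log_energy \<mu> = enn2ereal (lenergy L \<mu>) - ereal (ln L)" if "\<mu> \<in> ?M" for \<mu>
    using that by (intro log_energy_conv_lenergy[OF _ _ _ K(2) Kb R L]) auto
  have "robin_constant K \<noteq> \<infinity>" using cap by (auto simp: log_capacity_def)
  moreover have "- ereal (ln L) \<le> robin_constant K"
    unfolding robin_constant_def
  proof (rule INF_greatest)
    fix \<mu> assume "\<mu> \<in> ?M"
    then show "- ereal (ln L) \<le> log_energy \<mu>" unfolding en[OF \<open>\<mu> \<in> ?M\<close>]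
      using enn2ereal_nonneg[of "lenergy L \<mu>"] by (cases "enn2ereal (lenergy L \<mu>)") auto
  qed
  ultimately obtain v where v: "robin_constant K = ereal v" "- ln L \<le> v"
    by (cases "robin_constant K") auto
  define W where "W = v + ln L"
  have W0: "W \<ge> 0" using v by (simp add: W_def)
  have capv: "log_capacity K = exp (- v)" by (simp add: log_capacity_def v)
  have WL: "ln (L / log_capacity K) = W" using L1 by (simp add: capv W_def ln_div)
  have min: "ennreal W \<le> lenergy L \<mu>" if "\<mu> \<in> ?M" for \<mu>
  proof -
    have "ereal v \<le> log_energy \<mu>" unfolding v(1)[symmetric] robin_constant_def using that by (rule INF_lower)
    then have "ereal W \<le> enn2ereal (lenergy L \<mu>)"
      unfolding en[OF that] W_def by (cases "enn2ereal (lenergy L \<mu>)") auto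
    then have "e2ennreal (ereal W) \<le> e2ennreal (enn2ereal (lenergy L \<mu>))" by (rule e2ennreal_mono)
    then show ?thesis by simp
  qed
  \<comment> \<open>Chosen so that the estimate for the exceptional mass gives m (W + 2) \<le> 1,
    which is what (W + 1) / (1 - m) \<le> W + 2 requires.\<close>
  define s where "s = 1 / (W + 2)\<^sup>2"
  define d where "d = s\<^sup>2"
  have "1 < (W + 2)\<^sup>2" using W0 power_mono[of 2 "W + 2" 2] by simp
  moreover have "0 < (W + 2)\<^sup>2" using W0 by simp
  ultimately have s: "0 < s" "s < 1" unfolding s_def by (simp_all only: divide_less_eq_1_pos zero_less_divide_1_iff)
  have d: "0 < d" "d < 1" using s by (auto simp: d_def power_less_one_iff)
  have "Inf (log_energy ` ?M) < ereal (v + d)" using v(1) d unfolding robin_constant_def by simp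
  then obtain \<nu> where \<nu>M: "\<nu> \<in> ?M" and \<nu>e: "log_energy \<nu> < ereal (v + d)" by (auto simp: INF_less_iff)
  have \<nu>s [measurable_cong]: "sets \<nu> = sets borel" and \<nu>p: "prob_space \<nu>" and \<nu>K: "emeasure \<nu> K = 1" using \<nu>M by auto
  interpret \<nu>: prob_space \<nu> by fact
  have sp: "space \<nu> = UNIV" using sets_eq_imp_space_eq[OF \<nu>s] by simp
  have e: "lenergy L \<nu> \<le> ennreal (W + d)"
  proof -
    have "enn2ereal (lenergy L \<nu>) \<le> ereal (W + d)"
      using \<nu>e unfolding en[OF \<nu>M] W_def by (cases "enn2ereal (lenergy L \<nu>)") auto
    then show ?thesis using W0 d by (cases "lenergy L \<nu>") (auto simp del: ennreal_plus intro!: ennreal_leI)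
  qed
  have [measurable]: "lpot L \<nu> \<in> borel_measurable borel" by (rule measurable_lpot[OF \<nu>.finite_measure_axioms \<nu>s])
  have AEK: "AE z in \<nu>. z \<in> K" using \<nu>K Kb \<nu>s by (subst \<nu>.AE_in_set_eq_1) (auto simp: \<nu>.emeasure_eq_measure)
  define A where "A = {z. lpot L \<nu> z > ennreal (W + 1)}"
  have A[measurable]: "A \<in> sets borel" unfolding A_def by measurable
  have "2 * s * measure \<nu> A \<le> d + s\<^sup>2 * (W + d)"
  proof (rule near_minimiser_exceptional_mass[OF \<nu>p \<nu>s W0 less_imp_le[OF d(1)] s A _ e])
    fix \<phi> :: "complex \<Rightarrow> ennreal" assume [measurable]: "\<phi> \<in> borel_measurable borel" and P: "prob_space (density \<nu> \<phi>)"
    interpret D: prob_space "density \<nu> \<phi>" by fact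
    have "AE z in density \<nu> \<phi>. z \<in> K" using AEK by (subst AE_density) auto
    then have "emeasure (density \<nu> \<phi>) K = 1" using Kb \<nu>s
      by (subst (asm) D.AE_in_set_eq_1) (auto simp: D.emeasure_eq_measure)
    then show "ennreal W \<le> lenergy L (density \<nu> \<phi>)" using P \<nu>s by (intro min) auto
  qed (auto simp: A_def)
  also have "\<dots> \<le> s\<^sup>2 * (W + 2)" using d mult_left_mono[of d 1 "s\<^sup>2"] by (simp add: d_def algebra_simps)
  finally have "s * (2 * measure \<nu> A) \<le> s * (s * (W + 2))" by (simp add: power2_eq_square mult_ac)
  then have "2 * measure \<nu> A \<le> s * (W + 2)" using s by simp
  also have "s * (W + 2) = 1 / (W + 2)" using W0 by (simp add: s_def power2_eq_square)
  finally have mA: "measure \<nu> A \<le> 1 / (W + 2)" using measure_nonneg[of \<nu> A] by linarith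
  define m where "m = measure \<nu> A"
  have m: "0 \<le> m" "m \<le> 1 / (W + 2)" "m < 1" using mA W0 by (auto simp: m_def intro: le_less_trans)
  define B where "B = {z \<in> K. lpot L \<nu> z \<le> ennreal (W + 1)}"
  have Bc: "closed B" unfolding B_def
    by (rule closed_lpot_sublevel) (use \<nu>.finite_measure_axioms \<nu>s L1 compact_imp_closed[OF K(1)] in auto)
  then have B[measurable]: "B \<in> sets borel" by (rule borel_closed)
  have mB: "measure \<nu> B = 1 - m"
  proof -
    have "measure \<nu> B = measure \<nu> (- A)"
    proof (rule \<nu>.finite_measure_eq_AE)
      show "AE x in \<nu>. x \<in> B \<longleftrightarrow> x \<in> - A" using AEK by eventually_elim (auto simp: A_def B_def not_less)
    qed (use \<nu>s in auto)
    also have "\<dots> = 1 - m" using \<nu>.prob_compl[of A] sp \<nu>s by (simp add: m_def Compl_eq_Diff_UNIV)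
    finally show ?thesis .
  qed
  have Bne: "B \<noteq> {}" using mB m by auto
  define \<tau> where "\<tau> = density \<nu> (\<lambda>z. ennreal (1 / (1 - m)) * indicator B z)"
  have \<tau>em: "emeasure \<tau> X = ennreal (1 / (1 - m)) * emeasure \<nu> (B \<inter> X)" if [measurable]: "X \<in> sets borel" for X
  proof -
    have "emeasure \<tau> X = (\<integral>\<^sup>+z. ennreal (1 / (1 - m)) * indicator (B \<inter> X) z \<partial>\<nu>)"
      unfolding \<tau>_def by (subst emeasure_density) (auto intro!: nn_integral_cong simp: indicator_def)
    then show ?thesis by (simp add: nn_integral_cmult)
  qed
  have one: "ennreal (1 / (1 - m)) * emeasure \<nu> B = 1"
    using m by (simp add: \<nu>.emeasure_eq_measure mB flip: ennreal_mult)
  have \<tau>s: "sets \<tau> = sets borel" by (simp add: \<tau>_def \<nu>s)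
  have \<tau>p: "prob_space \<tau>"
    by (rule prob_spaceI) (use \<tau>em[of UNIV] one in \<open>simp add: \<tau>_def sp\<close>)
  have BK: "B \<inter> K = B" by (auto simp: B_def)
  have \<tau>K: "emeasure \<tau> K = 1" using \<tau>em[OF Kb] one by (simp add: BK)
  have pot: "lpot L \<tau> w = (\<integral>\<^sup>+z. ennreal (1 / (1 - m)) * (indicator B z * lkern L w z) \<partial>\<nu>)" for w
    unfolding lpot_def \<tau>_def by (subst nn_integral_density) (auto simp: mult.assoc)
  have potB: "lpot L \<tau> w \<le> ennreal (W + 2)" if "w \<in> B" for w
  proof -
    have "lpot L \<tau> w \<le> (\<integral>\<^sup>+z. ennreal (1 / (1 - m)) * lkern L w z \<partial>\<nu>)"
      unfolding pot by (intro nn_integral_mono mult_left_mono) (auto simp: indicator_def)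
    also have "\<dots> = ennreal (1 / (1 - m)) * lpot L \<nu> w" by (simp add: nn_integral_cmult lpot_def)
    also have "\<dots> \<le> ennreal (1 / (1 - m)) * ennreal (W + 1)" using that by (intro mult_left_mono) (auto simp: B_def)
    also have "\<dots> = ennreal ((W + 1) / (1 - m))"
      using m W0 by (simp del: ennreal_plus flip: ennreal_mult)
    also have "\<dots> \<le> ennreal (W + 2)"
    proof (rule ennreal_leI)
      have "m * (W + 2) \<le> 1" using m W0 by (simp add: pos_le_divide_eq)
      then have "W + 1 \<le> (W + 2) * (1 - m)" by (simp add: algebra_simps)
      then show "(W + 1) / (1 - m) \<le> W + 2" using m by (simp add: pos_divide_le_eq)
    qed
    finally show ?thesis .
  qed
  have "lpot L \<tau> w \<le> ennreal (W + 3)" for w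
  proof -
    obtain w' where w': "w' \<in> B" "\<And>z. z \<in> B \<Longrightarrow> dist w w' \<le> dist w z"
      using distance_attains_inf[OF Bc Bne] by blast
    have "lpot L \<tau> w \<le> (\<integral>\<^sup>+z. ennreal (1 / (1 - m)) * (indicator B z * lkern L w' z) + ennreal (1 / (1 - m)) * (indicator B z * ennreal (ln 2)) \<partial>\<nu>)"
      unfolding pot
    proof (intro nn_integral_mono)
      fix z
      show "ennreal (1 / (1 - m)) * (indicator B z * lkern L w z) \<le> ennreal (1 / (1 - m)) * (indicator B z * lkern L w' z) + ennreal (1 / (1 - m)) * (indicator B z * ennreal (ln 2))"
        using lkern_le_lkern_nearest[OF w', of z L] L1
        by (cases "z \<in> B") (auto simp: distrib_left[symmetric] intro!: mult_left_mono)
    qed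
    also have "\<dots> = lpot L \<tau> w' + ennreal (1 / (1 - m)) * emeasure \<nu> B * ennreal (ln 2)"
      unfolding pot by (subst nn_integral_add) (auto simp: nn_integral_cmult nn_integral_multc mult.assoc)
    \<comment> \<open>\<open>\<tau>\<close> has mass 1, so passing to the nearest point adds ln 2
      \<le> 1 in total.\<close>
    also have "\<dots> \<le> ennreal (W + 2) + 1 * ennreal 1"
      unfolding one using ln_2_less_1 by (intro add_mono mult_left_mono potB w' ennreal_leI) auto
    also have "\<dots> = ennreal (W + 3)"
      using W0 ennreal_plus[of "W + 2" 1] by (simp add: add.commute del: ennreal_plus ennreal_1)
    finally show ?thesis .
  qed
  moreover have "L / log_capacity K \<ge> 1"
  proof -
    have "L / log_capacity K = exp W" using L1 by (simp add: capv W_def exp_add exp_minus divide_inverse mult.commute)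
    then show ?thesis using W0 by simp
  qed
  ultimately show ?thesis using \<tau>s \<tau>p \<tau>K WL by (intro exI[of _ \<tau>]) auto
qed

section \<open>Integrating the logarithm of an entire function\<close>

text \<open>The lower bound holds for infinitely many \<open>n\<close> only, so Fatou's lemma is
  applied to N - u along a subsequence; \<open>N\<close> is above both \<open>M\<close> and
  \<open>H\<close>, so that \<open>ennreal\<close> truncates nothing.\<close>

lemma reverse_fatou_frequently:
  fixes u :: "nat \<Rightarrow> 'a \<Rightarrow> real"
  assumes "finite_measure \<tau>" and p: "measure \<tau> (space \<tau>) = p"
    and int: "\<And>n. integrable \<tau> (u n)" and M: "\<And>n. AE z in \<tau>. u n z \<le> M"
    and H: "AE z in \<tau>. eventually (\<lambda>n. u n z \<le> H) sequentially"
    and c: "frequently (\<lambda>n. c \<le> integral\<^sup>L \<tau> (u n)) sequentially"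
  shows "c \<le> p * H"
proof -
  interpret finite_measure \<tau> by fact
  have "\<not> eventually (\<lambda>n. \<not> c \<le> integral\<^sup>L \<tau> (u n)) sequentially" using c by (simp add: frequently_def)
  from not_eventually_sequentiallyD[OF this]
  have "\<exists>r :: nat \<Rightarrow> nat. strict_mono r \<and> (\<forall>n. c \<le> integral\<^sup>L \<tau> (u (r n)))" by simp
  then obtain r :: "nat \<Rightarrow> nat" where "strict_mono r \<and> (\<forall>n. c \<le> integral\<^sup>L \<tau> (u (r n)))" ..
  then have r: "strict_mono r" "\<And>n. c \<le> integral\<^sup>L \<tau> (u (r n))" by simp_all
  define N where "N = max M H"
  have p0: "p \<ge> 0" using p by (metis measure_nonneg)
  have uN: "AE z in \<tau>. u n z \<le> N" for n using M[of n] by eventually_elim (simp add: N_def)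
  have I: "(\<integral>\<^sup>+z. ennreal (N - u (r n) z) \<partial>\<tau>) \<le> ennreal (p * N - c)" for n
  proof -
    have "(\<integral>\<^sup>+z. ennreal (N - u (r n) z) \<partial>\<tau>) = ennreal (integral\<^sup>L \<tau> (\<lambda>z. N - u (r n) z))"
      using uN[of "r n"] by (intro nn_integral_eq_integral Bochner_Integration.integrable_diff int) auto
    also have "integral\<^sup>L \<tau> (\<lambda>z. N - u (r n) z) = p * N - integral\<^sup>L \<tau> (u (r n))"
      by (subst Bochner_Integration.integral_diff) (auto simp: int p)
    finally show ?thesis using r(2)[of n] by (auto intro: ennreal_leI)
  qed
  have "ennreal (p * (N - H)) = (\<integral>\<^sup>+z. ennreal (N - H) \<partial>\<tau>)"
    using p p0 by (simp add: emeasure_eq_measure ennreal_mult' mult.commute N_def)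
  also have "\<dots> \<le> (\<integral>\<^sup>+z. liminf (\<lambda>n. ennreal (N - u (r n) z)) \<partial>\<tau>)"
  proof (rule nn_integral_mono_AE)
    show "AE z in \<tau>. ennreal (N - H) \<le> liminf (\<lambda>n. ennreal (N - u (r n) z))"
      using H
    proof eventually_elim
      case (elim z)
      then have "eventually (\<lambda>n. u (r n) z \<le> H) sequentially" by (rule eventually_subseq[OF r(1)])
      then show ?case by (intro Liminf_bounded) (auto elim!: eventually_mono intro: ennreal_leI)
    qed
  qed
  also have "\<dots> \<le> liminf (\<lambda>n. \<integral>\<^sup>+z. ennreal (N - u (r n) z) \<partial>\<tau>)"
    using int by (intro nn_integral_liminf) auto
  also have "\<dots> \<le> liminf (\<lambda>n. ennreal (p * N - c))" by (intro Liminf_mono always_eventually allI I)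
  also have "\<dots> = ennreal (p * N - c)" by (simp add: Liminf_const)
  finally have le: "ennreal (p * (N - H)) \<le> ennreal (p * N - c)" .
  have "c \<le> integral\<^sup>L \<tau> (u (r 0))" by (rule r)
  also have "\<dots> \<le> integral\<^sup>L \<tau> (\<lambda>_. N)" using uN by (intro integral_mono_AE int) auto
  finally have "c \<le> p * N" by (simp add: p)
  then have "p * (N - H) \<le> p * N - c" using le by (subst (asm) ennreal_le_iff) auto
  then show ?thesis by (simp add: algebra_simps)
qed

text \<open>The mass \<open>p\<close> may be below 1, to cover the restriction of a probability
  measure to the exterior of a disc. The scale 4 R makes the kernel nonnegative for |z| \<le> R and
  |w| \<le> 2 R.\<close>

locale bounded_potential =
  fixes \<tau> :: "complex measure" and R \<Lambda> p :: real
  assumes fin: "finite_measure \<tau>" and sets: "sets \<tau> = sets borel"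
    and p: "measure \<tau> UNIV = p" "p \<le> 1"
    and AE_R: "AE z in \<tau>. norm z \<le> R" and R1: "R \<ge> 1" and \<Lambda>1: "\<Lambda> \<ge> 1"
    and pot: "\<And>w. lpot (4 * R) \<tau> w \<le> ennreal \<Lambda>"
begin

sublocale finite_measure \<tau> by (rule fin)

lemmas [measurable_cong] = sets

lemma p_nonneg: "p \<ge> 0" using p(1) by (metis measure_nonneg)

lemma space: "space \<tau> = UNIV" using sets_eq_imp_space_eq[OF sets] by simp

text \<open>A point mass at \<open>w\<close> would make the potential there infinite. Zeros are
  therefore negligible, and the value of \<open>ln\<close> at 0 is immaterial.\<close>

lemma AE_neq: "AE z in \<tau>. z \<noteq> w"
proof -
  have "lpot (4 * R) \<tau> w < \<top>" using pot[of w] by (rule le_less_trans) simp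
  then have "AE z in \<tau>. lkern (4 * R) w z \<noteq> \<infinity>"
    by (intro nn_integral_PInf_AE) (auto simp: lpot_def)
  then show ?thesis by eventually_elim (auto simp: lkern_def)
qed

lemma ln_dist_near:
  assumes w: "norm w \<le> 2 * R"
  shows "integrable \<tau> (\<lambda>z. ln (norm (z - w) / max 1 (norm w)))"
    and "integral\<^sup>L \<tau> (\<lambda>z. ln (norm (z - w) / max 1 (norm w))) \<ge> p * ln (4 * R) - \<Lambda> - p * ln (max 1 (norm w))"
proof -
  define g where "g z = ln (4 * R / norm (z - w))" for z
  have [measurable]: "g \<in> borel_measurable borel" unfolding g_def by measurable
  have g0: "AE z in \<tau>. 0 \<le> g z"
    using AE_neq[of w] AE_R
  proof eventually_elim
    case (elim z)
    have "norm (z - w) \<le> 4 * R" using norm_triangle_ineq4[of z w] elim w R1 by linarith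
    then show ?case using elim by (auto simp: g_def intro!: ln_ge_zero)
  qed
  have "(\<integral>\<^sup>+z. ennreal (g z) \<partial>\<tau>) = lpot (4 * R) \<tau> w"
    unfolding lpot_def
  proof (rule nn_integral_cong_AE)
    show "AE z in \<tau>. ennreal (g z) = lkern (4 * R) w z"
      using AE_neq[of w] by eventually_elim (auto simp: g_def lkern_def dist_norm norm_minus_commute)
  qed
  then have gle: "(\<integral>\<^sup>+z. ennreal (g z) \<partial>\<tau>) \<le> ennreal \<Lambda>" using pot[of w] by simp
  have gi: "integrable \<tau> g"
  proof (rule integrableI_nonneg[OF _ g0])
    show "(\<integral>\<^sup>+z. ennreal (g z) \<partial>\<tau>) < \<infinity>" using gle by (rule le_less_trans) simp
  qed measurable
  have "ennreal (integral\<^sup>L \<tau> g) \<le> ennreal \<Lambda>" using nn_integral_eq_integral[OF gi g0] gle by simp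
  then have gI: "integral\<^sup>L \<tau> g \<le> \<Lambda>" using \<Lambda>1 by (subst (asm) ennreal_le_iff) auto
  have eq: "AE z in \<tau>. (ln (4 * R) - ln (max 1 (norm w))) - g z = ln (norm (z - w) / max 1 (norm w))"
    using AE_neq[of w] by eventually_elim (use R1 in \<open>auto simp: g_def ln_div ln_mult\<close>)
  have i: "integrable \<tau> (\<lambda>z. (ln (4 * R) - ln (max 1 (norm w))) - g z)"
    using gi by (intro Bochner_Integration.integrable_diff) auto
  show "integrable \<tau> (\<lambda>z. ln (norm (z - w) / max 1 (norm w)))"
    by (rule integrable_cong_AE_imp[OF i]) (measurable, use eq in \<open>auto elim: eventually_mono\<close>)
  have "integral\<^sup>L \<tau> (\<lambda>z. ln (norm (z - w) / max 1 (norm w))) = integral\<^sup>L \<tau> (\<lambda>z. (ln (4 * R) - ln (max 1 (norm w))) - g z)"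
    by (rule integral_cong_AE[symmetric]) (use eq in auto)
  also have "\<dots> = p * (ln (4 * R) - ln (max 1 (norm w))) - integral\<^sup>L \<tau> g"
    using gi by (subst Bochner_Integration.integral_diff) (auto simp: p space)
  finally show "integral\<^sup>L \<tau> (\<lambda>z. ln (norm (z - w) / max 1 (norm w))) \<ge> p * ln (4 * R) - \<Lambda> - p * ln (max 1 (norm w))"
    using gI by (simp add: algebra_simps)
qed

text \<open>Here |z - w| / |w| lies between 1/2 and 2, which bounds the integral without reference
  to the potential; - \<Lambda> is stated to match the bound for near zeros.\<close>

lemma ln_dist_far:
  assumes w: "norm w > 2 * R"
  shows "integrable \<tau> (\<lambda>z. ln (norm (z - w) / max 1 (norm w)))"
    and "integral\<^sup>L \<tau> (\<lambda>z. ln (norm (z - w) / max 1 (norm w))) \<ge> - \<Lambda>"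
proof -
  have wm: "max 1 (norm w) = norm w" using w R1 by simp
  have b: "AE z in \<tau>. - ln 2 \<le> ln (norm (z - w) / norm w) \<and> ln (norm (z - w) / norm w) \<le> ln 2"
    using AE_R
  proof eventually_elim
    case (elim z)
    have "norm w \<le> norm z + norm (z - w)" using norm_triangle_ineq4[of z "z - w"] by simp
    then have l: "1 / 2 \<le> norm (z - w) / norm w" 
    proof (subst pos_le_divide_eq)
      show "0 < norm w" using w R1 by linarith
      show "1 / 2 * norm w \<le> norm (z - w)" using elim w \<open>norm w \<le> norm z + norm (z - w)\<close> by linarith
    qed
    have "norm (z - w) \<le> 2 * norm w" using norm_triangle_ineq4[of z w] elim w R1 by linarith
    then have u: "norm (z - w) / norm w \<le> 2" using w R1 by (subst pos_divide_le_eq) auto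
    have "ln (1 / 2) \<le> ln (norm (z - w) / norm w)" "ln (norm (z - w) / norm w) \<le> ln 2"
      by (subst ln_le_cancel_iff; use l u in linarith)+
    then show ?case by (simp add: ln_div)
  qed
  have i: "integrable \<tau> (\<lambda>z. ln (norm (z - w) / norm w))"
  proof (rule integrable_const_bound[where B = "ln 2"])
    show "AE z in \<tau>. norm (ln (norm (z - w) / norm w)) \<le> ln 2" using b by eventually_elim auto
  qed measurable
  then show "integrable \<tau> (\<lambda>z. ln (norm (z - w) / max 1 (norm w)))" by (simp add: wm)
  have "- \<Lambda> \<le> - 1 * (1::real)" using \<Lambda>1 by simp
  also have "\<dots> \<le> - (p * ln 2)" using p p_nonneg ln_2_less_1 mult_mono[of p 1 "ln 2" 1] by simp
  also have "\<dots> = integral\<^sup>L \<tau> (\<lambda>z. - ln 2)" by (simp add: p space)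
  also have "\<dots> \<le> integral\<^sup>L \<tau> (\<lambda>z. ln (norm (z - w) / norm w))"
  proof (intro integral_mono_AE i)
    show "AE z in \<tau>. - ln 2 \<le> ln (norm (z - w) / norm w)" using b by eventually_elim auto
  qed auto
  finally show "integral\<^sup>L \<tau> (\<lambda>z. ln (norm (z - w) / max 1 (norm w))) \<ge> - \<Lambda>" by (simp add: wm)
qed

lemma integrable_ln_dist: "integrable \<tau> (\<lambda>z. ln (norm (z - w) / max 1 (norm w)))"
  using ln_dist_near(1)[of w] ln_dist_far(1)[of w] by linarith

lemma integral_ln_dist_small:
  assumes "norm w \<le> T" "1 \<le> T" "T \<le> 2 * R"
  shows "integral\<^sup>L \<tau> (\<lambda>z. ln (norm (z - w) / max 1 (norm w))) \<ge> p * ln (4 * R) - \<Lambda> - p * ln T"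
proof -
  have "ln (max 1 (norm w)) \<le> ln T" using assms by (subst ln_le_cancel_iff) auto
  then have "p * ln (max 1 (norm w)) \<le> p * ln T" using p_nonneg by (rule mult_left_mono)
  then show ?thesis using ln_dist_near(2)[of w] assms by linarith
qed

lemma integral_ln_dist_ge: "integral\<^sup>L \<tau> (\<lambda>z. ln (norm (z - w) / max 1 (norm w))) \<ge> - \<Lambda>"
proof (cases "norm w \<le> 2 * R")
  case True
  have "ln (max 1 (norm w)) \<le> ln (4 * R)" using True R1 by (subst ln_le_cancel_iff) auto
  then have "p * ln (max 1 (norm w)) \<le> p * ln (4 * R)" using p_nonneg by (rule mult_left_mono)
  then show ?thesis using ln_dist_near(2)[OF True] by linarith
qed (use ln_dist_far(2)[of w] in simp)

end

locale genus_zero_potential = genus_zero_function f + bounded_potential \<tau> R \<Lambda> p for f \<tau> R \<Lambda> p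
begin

lemma AE_nonzero: "AE z in \<tau>. f z \<noteq> 0"
proof -
  have "AE z in \<tau>. \<forall>w\<in>zeros_ball f (R + 1). z \<noteq> w" by (rule AE_finite_allI[OF finite_zeros_ball AE_neq])
  then show ?thesis using AE_R by eventually_elim (auto simp: zeros_ball_def)
qed

lemma integrable_zlog: "integrable \<tau> (zlog f (zeros_ball f S))"
  unfolding zlog_def by (intro Bochner_Integration.integrable_sum integrable_mult_right integrable_ln_dist)

lemma AE_estimate:
  assumes "S \<ge> 2 * R"
  shows "AE z in \<tau>. \<bar>ln (norm (f z)) - ln C1 - zlog f (zeros_ball f S) z\<bar> \<le> R * norm (tail_sum f S) + 2 * R\<^sup>2 * star_degree f / S"
  using AE_nonzero AE_R
proof eventually_elim
  case (elim z)
  have "\<bar>ln (norm (f z)) - ln C1 - zlog f (zeros_ball f S) z\<bar> \<le> norm z * norm (tail_sum f S) + 2 * (norm z)\<^sup>2 * star_degree f / S"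
    by (rule ln_norm_estimate) (use elim assms R1 in auto)
  also have "\<dots> \<le> R * norm (tail_sum f S) + 2 * R\<^sup>2 * star_degree f / S"
    using elim assms R1 star_degree_nonneg by (intro add_mono mult_right_mono divide_right_mono mult_left_mono power_mono) auto
  finally show ?case .
qed

lemma integrable_ln_norm: "integrable \<tau> (\<lambda>z. ln (norm (f z)))"
proof -
  define S where "S = 2 * R"
  then have S2: "2 * R \<le> S" by simp
  have [measurable]: "f \<in> borel_measurable borel"
    by (intro borel_measurable_continuous_onI holomorphic_on_imp_continuous_on hol)
  have "integrable \<tau> (\<lambda>z. \<bar>zlog f (zeros_ball f S) z\<bar> + (\<bar>ln C1\<bar> + (R * norm (tail_sum f S) + 2 * R\<^sup>2 * star_degree f / S)))"
    by (intro Bochner_Integration.integrable_add integrable_abs integrable_zlog) auto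
  then show ?thesis
  proof (rule Bochner_Integration.integrable_bound)
    show "AE z in \<tau>. norm (ln (norm (f z))) \<le> norm (\<bar>zlog f (zeros_ball f S) z\<bar> + (\<bar>ln C1\<bar> + (R * norm (tail_sum f S) + 2 * R\<^sup>2 * star_degree f / S)))"
      using AE_estimate[OF S2] by eventually_elim auto
  qed measurable
qed

text \<open>Zeros in the disc of radius \<open>T\<close> are credited with their gain p ln (4 R) -
  \<Lambda> - p ln T, the others up to \<open>S\<close> are only known to cost at most \<Lambda>
  each, and those beyond \<open>S\<close> enter through the pointwise error.\<close>

lemma integral_ln_norm_ge:
  assumes T: "1 \<le> T" "T \<le> 2 * R" and S: "S \<ge> 2 * R"
  shows "integral\<^sup>L \<tau> (\<lambda>z. ln (norm (f z))) \<ge> p * ln C1 + zcount f T * (p * ln (4 * R) - \<Lambda> - p * ln T)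
     - (zcount f S - zcount f T) * \<Lambda> - (R * norm (tail_sum f S) + 2 * R\<^sup>2 * star_degree f / S)"
proof -
  let ?D = "zeros_ball f S" and ?D' = "zeros_ball f T"
  let ?e = "R * norm (tail_sum f S) + 2 * R\<^sup>2 * star_degree f / S"
  let ?I = "\<lambda>w. integral\<^sup>L \<tau> (\<lambda>z. ln (norm (z - w) / max 1 (norm w)))"
  have sub: "?D' \<subseteq> ?D" using T S by (auto simp: zeros_ball_def)
  have e0: "?e \<ge> 0" using R1 S star_degree_nonneg by (intro add_nonneg_nonneg divide_nonneg_nonneg mult_nonneg_nonneg) auto
  have "integral\<^sup>L \<tau> (zlog f ?D) = (\<Sum>w\<in>?D. real (zmult f w) * ?I w)"
    unfolding zlog_def by (subst Bochner_Integration.integral_sum) (auto intro: integrable_ln_dist)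
  also have "\<dots> = (\<Sum>w\<in>?D - ?D'. real (zmult f w) * ?I w) + (\<Sum>w\<in>?D'. real (zmult f w) * ?I w)"
    by (rule sum.subset_diff[OF sub finite_zeros_ball])
  also have "\<dots> \<ge> (\<Sum>w\<in>?D - ?D'. real (zmult f w) * (- \<Lambda>)) + (\<Sum>w\<in>?D'. real (zmult f w) * (p * ln (4 * R) - \<Lambda> - p * ln T))"
    using T by (intro add_mono sum_mono mult_left_mono integral_ln_dist_ge integral_ln_dist_small) (auto simp: zeros_ball_def)
  also have "(\<Sum>w\<in>?D'. real (zmult f w) * (p * ln (4 * R) - \<Lambda> - p * ln T)) = zcount f T * (p * ln (4 * R) - \<Lambda> - p * ln T)"
    by (simp only: zcount_def sum_distrib_right)
  also have "(\<Sum>w\<in>?D - ?D'. real (zmult f w) * (- \<Lambda>)) = (zcount f S - zcount f T) * (- \<Lambda>)"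
    unfolding sum_distrib_right[symmetric] zcount_def sum.subset_diff[OF sub finite_zeros_ball, of "\<lambda>w. real (zmult f w)"] by simp
  finally have zl: "integral\<^sup>L \<tau> (zlog f ?D) \<ge> (zcount f S - zcount f T) * (- \<Lambda>) + zcount f T * (p * ln (4 * R) - \<Lambda> - p * ln T)" .
  have "p * (ln C1 - ?e) + integral\<^sup>L \<tau> (zlog f ?D) = integral\<^sup>L \<tau> (\<lambda>z. (ln C1 - ?e) + zlog f ?D z)"
    by (subst Bochner_Integration.integral_add) (auto simp: integrable_zlog p space)
  also have "\<dots> \<le> integral\<^sup>L \<tau> (\<lambda>z. ln (norm (f z)))"
  proof (rule integral_mono_AE)
    show "AE z in \<tau>. (ln C1 - ?e) + zlog f ?D z \<le> ln (norm (f z))"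
      using AE_estimate[OF S] by eventually_elim auto
    show "integrable \<tau> (\<lambda>z. (ln C1 - ?e) + zlog f ?D z)"
      by (intro Bochner_Integration.integrable_add integrable_zlog) auto
  qed (rule integrable_ln_norm)
  finally have "p * (ln C1 - ?e) + integral\<^sup>L \<tau> (zlog f ?D) \<le> integral\<^sup>L \<tau> (\<lambda>z. ln (norm (f z)))" .
  moreover have "p * ?e \<le> ?e" using p e0 mult_right_mono[of p 1 ?e] by simp
  ultimately show ?thesis using zl by (simp add: right_diff_distrib)
qed

end

section \<open>Counting zeros along the sequence\<close>

lemma frequently_conj_eventually:
  "frequently P F \<Longrightarrow> eventually Q F \<Longrightarrow> frequently (\<lambda>x. P x \<and> Q x) F"
  by (erule frequently_rev_mp) (auto elim: eventually_mono)

text \<open>To be applied to a subsequence: all conditions in \<open>n\<close> are universal or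
  eventual, hence inherited. The lower bound with \<open>B'\<close> will come from the large values
  of |P_n| that are to be refuted. The guard \<open>P n z \<noteq> 0\<close> in \<open>small\<close>
  is due to \<open>ln 0 = 0\<close>.\<close>

locale growth_sequence =
  fixes k :: "nat \<Rightarrow> real" and P :: "nat \<Rightarrow> complex \<Rightarrow> complex"
    and E :: "complex set" and h :: "real \<Rightarrow> real" and \<beta> B B' M :: real
  assumes k: "\<And>n. k n > 0" and genus: "\<And>n. genus_zero (P n)" and star: "\<And>n. star_degree (P n) \<le> k n"
    and E: "closed E" and \<beta>: "\<beta> > 0"
    and cap: "\<And>e. e > 0 \<Longrightarrow> frequently (\<lambda>R. R powr (\<beta> - e) \<le> log_capacity (E \<inter> cball 0 R)) at_top"
    and tail: "\<And>e. e > 0 \<Longrightarrow> eventually (\<lambda>S. eventually (\<lambda>n. norm (tail_sum (P n) S) \<le> e * k n) sequentially) at_top"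
    and count: "\<And>T. eventually (\<lambda>n. zcount (P n) T \<le> M * k n) sequentially"
    and small: "\<And>z. z \<in> E \<Longrightarrow> eventually (\<lambda>n. P n z \<noteq> 0 \<longrightarrow> ln (norm (P n z)) \<le> k n * (ln 2 + ln (h (norm z)))) sequentially"
    and upper: "\<And>n. ln (circle_geo_mean (P n) 1) \<le> B * k n"
    and lower: "\<And>n. B' * k n \<le> ln (circle_geo_mean (P n) 1)"
begin

lemma gz: "genus_zero_function (P n)"
  by unfold_locales (rule genus)

lemma ln_norm_le: 
  assumes "P n z \<noteq> 0"
  shows "ln (norm (P n z)) / k n \<le> B + norm z"
proof -
  interpret f: genus_zero_function "P n" by (rule gz)
  have "norm (P n z) \<le> circle_geo_mean (P n) 1 * exp (star_degree (P n) * norm z)"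
    by (rule f.norm_le_exp_star_degree)
  then have "ln (norm (P n z)) \<le> ln (circle_geo_mean (P n) 1 * exp (star_degree (P n) * norm z))"
    using assms f.C1_pos by (subst ln_le_cancel_iff) auto
  also have "\<dots> = ln (circle_geo_mean (P n) 1) + star_degree (P n) * norm z"
    using f.C1_pos by (simp add: ln_mult)
  also have "\<dots> \<le> B * k n + k n * norm z" using upper star by (intro add_mono mult_right_mono) auto
  also have "\<dots> = (B + norm z) * k n" by (simp add: algebra_simps)
  finally show ?thesis using k[of n] by (simp add: pos_divide_le_eq)
qed

text \<open>\<open>S\<close> depends on \<open>R\<close> but not on \<open>n\<close>: the tail sum
  controls the linear error, and 1 / S the quadratic one, because the star degree is at most
  \<open>k n\<close>.\<close>

lemma error_eventually:
  assumes R: "R \<ge> 0" and e: "e > 0"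
  shows "eventually (\<lambda>S. eventually (\<lambda>n. R * norm (tail_sum (P n) S) + 2 * R\<^sup>2 * star_degree (P n) / S \<le> e * k n) sequentially) at_top"
proof -
  define d where "d = e / (2 * (R + 1))"
  have d: "d > 0" using R e by (simp add: d_def)
  show ?thesis
    using tail[OF d] eventually_ge_at_top[of "4 * R\<^sup>2 / e + 1"]
  proof eventually_elim
    case (elim S)
    have S: "4 * R\<^sup>2 / e \<le> S" "S > 0" 
    proof -
      have "0 \<le> 4 * R\<^sup>2 / e" using e by (intro divide_nonneg_pos) auto
      then show "4 * R\<^sup>2 / e \<le> S" "S > 0" using elim(2) by linarith+
    qed
    from elim(1) show ?case
    proof eventually_elim
      case (elim n)
      have "R * norm (tail_sum (P n) S) \<le> R * (d * k n)" using elim R by (rule mult_left_mono)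
      also have "\<dots> \<le> (R + 1) * (d * k n)" using d k[of n] by (intro mult_right_mono) auto
      also have "\<dots> = e / 2 * k n" using R by (simp add: d_def field_simps)
      finally have 1: "R * norm (tail_sum (P n) S) \<le> e / 2 * k n" .
      have "2 * R\<^sup>2 * star_degree (P n) / S \<le> 2 * R\<^sup>2 * k n / S"
        using S star by (intro divide_right_mono mult_left_mono) auto
      also have "\<dots> = (2 * R\<^sup>2 / S) * k n" by simp
      also have "\<dots> \<le> e / 2 * k n"
      proof (rule mult_right_mono)
        show "2 * R\<^sup>2 / S \<le> e / 2" using S e by (simp add: field_simps)
      qed (use k[of n] in simp)
      finally show ?case using 1 by linarith
    qed
  qed
qed

text \<open>Fatou's lemma turns the pointwise hypothesis on \<open>E\<close> into an integrated one.\<close>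
lemma integrated_upper_bound:
  assumes "bounded_potential \<tau> R \<Lambda> p" and TE: "AE z in \<tau>. z \<in> E \<and> ln 2 + ln (h (norm z)) \<le> H \<or> z \<in> E \<and> B + norm z \<le> H"
    and c: "frequently (\<lambda>n. c * k n \<le> integral\<^sup>L \<tau> (\<lambda>z. ln (norm (P n z)))) sequentially"
  shows "c \<le> p * H"
proof -
  interpret bounded_potential \<tau> R \<Lambda> p by fact
  have gp: "genus_zero_potential (P n) \<tau> R \<Lambda> p" for n
    by (intro genus_zero_potential.intro gz bounded_potential_axioms)
  have nz: "AE z in \<tau>. P n z \<noteq> 0" for n by (rule genus_zero_potential.AE_nonzero[OF gp])
  show ?thesis
  proof (rule reverse_fatou_frequently[OF finite_measure_axioms])
    show "measure \<tau> (space \<tau>) = p" by (simp add: space p)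
    show "integrable \<tau> (\<lambda>z. ln (norm (P n z)) / k n)" for n
      using genus_zero_potential.integrable_ln_norm[OF gp] by simp
    show "AE z in \<tau>. ln (norm (P n z)) / k n \<le> B + R" for n
      using nz[of n] AE_R
    proof eventually_elim
      case (elim z)
      then show ?case using ln_norm_le[of n z] by simp
    qed
    have "AE z in \<tau>. \<forall>n. P n z \<noteq> 0" using nz by (simp add: AE_all_countable)
    then show "AE z in \<tau>. \<forall>\<^sub>F n in sequentially. ln (norm (P n z)) / k n \<le> H"
      using TE
    proof eventually_elim
      case (elim z)
      from elim(2) show ?case
      proof
        assume a: "z \<in> E \<and> ln 2 + ln (h (norm z)) \<le> H"
        then have "eventually (\<lambda>n. P n z \<noteq> 0 \<longrightarrow> ln (norm (P n z)) \<le> k n * (ln 2 + ln (h (norm z)))) sequentially"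
          by (intro small) auto
        then show ?thesis
        proof eventually_elim
          case (elim n)
          have "ln (norm (P n z)) / k n \<le> ln 2 + ln (h (norm z))"
            using elim \<open>\<forall>n. P n z \<noteq> 0\<close> k[of n] by (simp add: pos_divide_le_eq mult.commute)
          then show ?case using a by simp
        qed
      next
        assume "z \<in> E \<and> B + norm z \<le> H"
        then have "ln (norm (P n z)) / k n \<le> H" for n using ln_norm_le[of n z] elim(1) by force
        then show ?thesis by simp
      qed
    qed
    show "frequently (\<lambda>n. c \<le> integral\<^sup>L \<tau> (\<lambda>z. ln (norm (P n z)) / k n)) sequentially"
      using c by (rule frequently_elim1) (use k in \<open>simp add: pos_le_divide_eq\<close>)
  qed
qed

text \<open>The capacity bound holds for arbitrarily large radii, so for one beyond
  \<open>X\<close>. The 5 consists of the 3 from the potential bound and of 2 > ln 4 from the scale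
  4 R.\<close>

lemma exists_potential:
  assumes e: "0 < e" and X: "X \<ge> 1"
  obtains R \<tau> where "R \<ge> X" "sets \<tau> = sets borel" "prob_space \<tau>" "AE z in \<tau>. z \<in> E" "AE z in \<tau>. norm z \<le> R"
    "\<And>w. lpot (4 * R) \<tau> w \<le> ennreal (5 + (1 - \<beta> + e) * ln R)"
    "ln (4 * R) - (5 + (1 - \<beta> + e) * ln R) \<ge> (\<beta> - e) * ln R - 5" "5 + (1 - \<beta> + e) * ln R \<ge> 1"
proof -
  have "frequently (\<lambda>R. R powr (\<beta> - e) \<le> log_capacity (E \<inter> cball 0 R) \<and> R \<ge> X) at_top"
    using cap[OF e] eventually_ge_at_top[of X] by (rule frequently_conj_eventually)
  then obtain R where R: "R powr (\<beta> - e) \<le> log_capacity (E \<inter> cball 0 R)" "R \<ge> X"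
    by (auto dest: frequently_ex)
  have R1: "R \<ge> 1" using R X by simp
  let ?K = "E \<inter> cball 0 R" 
  let ?c = "log_capacity ?K"
  have Rp: "R powr (\<beta> - e) > 0" using R1 by simp
  then have cp: "?c > 0" using R(1) by linarith
  have Kc: "compact ?K" using E by (simp add: closed_Int_compact)
  obtain \<tau> where \<tau>: "sets \<tau> = sets borel" "prob_space \<tau>" "emeasure \<tau> ?K = 1"
    "\<And>w. lpot (4 * R) \<tau> w \<le> ennreal (ln (4 * R / ?c) + 3)" "4 * R / ?c \<ge> 1"
    using exists_bounded_potential_measure[OF Kc _ R1 _ cp, of "4 * R"] R1 by auto
  interpret prob_space \<tau> by fact
  have "AE z in \<tau>. z \<in> ?K" using \<tau>(1,3) Kc
    by (subst AE_in_set_eq_1) (auto simp: emeasure_eq_measure borel_closed compact_imp_closed)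
  then have AE: "AE z in \<tau>. z \<in> E" "AE z in \<tau>. norm z \<le> R" by (eventually_elim; simp)+
  have "(\<beta> - e) * ln R \<le> ln ?c"
  proof -
    have "ln (R powr (\<beta> - e)) \<le> ln ?c" using R(1) Rp cp by (subst ln_le_cancel_iff) auto
    then show ?thesis using R1 by (simp add: ln_powr)
  qed
  moreover have "ln (4 * R / ?c) = ln 4 + ln R - ln ?c" using R1 cp by (simp add: ln_div ln_mult)
  moreover have "ln (4 :: real) = ln 2 + ln 2" using ln_mult[of 2 2] by simp
  moreover have "0 \<le> ln (4 * R / ?c)" using \<tau>(5) by simp
  moreover have "ln (4 * R) = ln 4 + ln R" using R1 by (simp add: ln_mult)
  moreover have "0 < ln (2 :: real)" by simp
  ultimately have "ln (4 * R / ?c) + 3 \<le> 5 + (1 - \<beta> + e) * ln R"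
    "ln (4 * R) - (5 + (1 - \<beta> + e) * ln R) \<ge> (\<beta> - e) * ln R - 5" "5 + (1 - \<beta> + e) * ln R \<ge> 1"
    using ln_2_less_1 by (simp_all add: algebra_simps) (linarith+)?
  moreover from this(1) have "lpot (4 * R) \<tau> w \<le> ennreal (5 + (1 - \<beta> + e) * ln R)" for w
    by (rule order_trans[OF \<tau>(4) ennreal_leI])
  ultimately show thesis
    using \<tau>(1,2) R(2) AE by (intro that[of R \<tau>])
qed

text \<open>\<open>\<kappa>\<close> below is the limit for \<open>T \<rightarrow> \<infinity>\<close> of the upper density of zeros in the disc of radius \<open>T\<close>; the zeros
  between \<open>T\<close> and \<open>S\<close> are then at most \<open>2 e k\<^sub>n\<close>, which controls their negative contribution.\<close>
lemma zcount_upper: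
  assumes g: "g \<ge> 0" and hg: "\<And>e. e > 0 \<Longrightarrow> eventually (\<lambda>r. ln (h r) \<le> (g + e) * ln r) at_top"
    and x: "x > g / \<beta>"
  shows "eventually (\<lambda>n. zcount (P n) T \<le> x * k n) sequentially"
proof (rule ccontr)
  assume "\<not> ?thesis"
  then have fr0: "frequently (\<lambda>n. x * k n \<le> zcount (P n) T) sequentially"
    unfolding not_eventually by (rule frequently_elim1) simp
  define X where "X = {x. \<exists>T. frequently (\<lambda>n. x * k n \<le> zcount (P n) T) sequentially}"
  have xX: "x \<in> X" using fr0 by (auto simp: X_def)
  have "y \<le> M" if "y \<in> X" for y
  proof -
    from that obtain T where "frequently (\<lambda>n. y * k n \<le> zcount (P n) T) sequentially" by (auto simp: X_def)
    then have "frequently (\<lambda>n. y * k n \<le> zcount (P n) T \<and> zcount (P n) T \<le> M * k n) sequentially"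
      by (rule frequently_conj_eventually[OF _ count])
    from frequently_ex[OF this] obtain n where "y * k n \<le> M * k n" by (elim exE conjE) (rule that, rule order_trans)
    then show ?thesis using k[of n] by simp
  qed
  then have bdd: "bdd_above X" by (auto simp: bdd_above_def)
  define \<kappa> where "\<kappa> = Sup X"
  have \<kappa>x: "x \<le> \<kappa>" unfolding \<kappa>_def by (rule cSup_upper[OF xX bdd])
  have \<kappa>\<beta>: "\<kappa> * \<beta> > g" using x \<kappa>x \<beta> by (simp add: pos_divide_less_eq mult.commute less_le_trans[OF _ mult_left_mono])
  then have \<kappa>0: "\<kappa> > 0" using g \<beta> by (metis le_less_trans zero_less_mult_pos2)
  \<comment> \<open>The coefficient of ln R in the lower bound minus that in the upper bound:
    (\<kappa> - e) (\<beta> - e) from the zeros in the disc of radius \<open>T\<close>, - 2 e (1 -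
    \<beta> + e) from the zeros beyond it, and g + e from the growth of \<open>h\<close>. At e = 0
    it is \<kappa> \<beta> - g > 0.\<close>
  let ?F = "\<lambda>e. (\<kappa> - e) * (\<beta> - e) - 2 * e * (1 - \<beta> + e) - g - e"
  have "(?F \<longlongrightarrow> (\<kappa> - 0) * (\<beta> - 0) - 2 * 0 * (1 - \<beta> + 0) - g - 0) (at_right 0)"
    by (intro tendsto_intros)
  then have "eventually (\<lambda>e. ?F e > 0) (at_right 0)" using \<kappa>\<beta> by (intro order_tendstoD(1)) auto
  moreover have "eventually (\<lambda>e. e < min \<kappa> \<beta>) (at_right 0)"
    using \<kappa>0 \<beta> by (intro order_tendstoD(2)[OF tendsto_ident_at]) auto
  moreover have "eventually (\<lambda>e. 0 < e) (at_right (0::real))" by (simp add: eventually_at_right_less)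
  ultimately have "eventually (\<lambda>e. ?F e > 0 \<and> e < min \<kappa> \<beta> \<and> 0 < e) (at_right 0)" by eventually_elim auto
  then obtain e where e: "?F e > 0" "e < \<kappa>" "e < \<beta>" "0 < e"
    using eventually_happens'[OF trivial_limit_at_right_real] by force
  obtain y where y: "y \<in> X" "\<kappa> - e < y" using less_cSupD[of X "\<kappa> - e"] xX e by (auto simp: \<kappa>_def)
  obtain T1 where T1: "frequently (\<lambda>n. y * k n \<le> zcount (P n) T1) sequentially" using y by (auto simp: X_def)
  define T where "T = max T1 1"
  have frT: "frequently (\<lambda>n. (\<kappa> - e) * k n \<le> zcount (P n) T) sequentially"
    using T1
  proof (rule frequently_elim1)
    fix n assume a: "y * k n \<le> zcount (P n) T1"
    have "(\<kappa> - e) * k n \<le> y * k n" using y k[of n] by (intro mult_right_mono) auto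
    also note a
    also have "zcount (P n) T1 \<le> zcount (P n) T"
    proof -
      interpret f: genus_zero_function "P n" by (rule gz)
      show ?thesis by (rule f.zcount_mono) (simp add: T_def)
    qed
    finally show "(\<kappa> - e) * k n \<le> zcount (P n) T" .
  qed
  \<comment> \<open>\<open>\<kappa> + e\<close> bounds the density in every disc, so
    \<open>S\<close> may be chosen after \<open>R\<close> without losing control of the zeros
    between \<open>T\<close> and \<open>S\<close>.\<close>
  have evS: "eventually (\<lambda>n. zcount (P n) S \<le> (\<kappa> + e) * k n) sequentially" for S
  proof -
    have "\<kappa> + e \<notin> X" using cSup_upper[OF _ bdd, of "\<kappa> + e"] e by (auto simp: \<kappa>_def)
    then have "eventually (\<lambda>n. \<not> (\<kappa> + e) * k n \<le> zcount (P n) S) sequentially" by (auto simp: X_def frequently_def)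
    then show ?thesis by eventually_elim simp
  qed
  obtain R0 where R0: "\<And>r. r \<ge> R0 \<Longrightarrow> ln (h r) \<le> (g + e) * ln r" using hg[OF e(4)] by (auto simp: eventually_at_top_linorder)
  \<comment> \<open>Absorbs ln 2, and the a priori bound at points too close to the origin for the
    growth bound on \<open>h\<close>.\<close>
  define Q where "Q = \<bar>B\<bar> + \<bar>R0\<bar> + 1"
  define const where "const = Q - B' + 1 + (\<kappa> - e) * (5 + ln T) + 10 * e"
  \<comment> \<open>Three demands on \<open>R\<close>: it is at least \<open>T\<close>; the gain
    (\<beta> - e) ln R - 5 - ln T per zero is nonnegative; and ln R times \<open>?F e\<close>
    exceeds \<open>const\<close>, which collects the terms without ln R.\<close>
  define Y where "Y = max (max T (exp (5 + ln T) powr (1 / (\<beta> - e)))) (exp (\<bar>const\<bar> / ?F e + 1))"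
  have T1': "T \<ge> 1" by (simp add: T_def)
  then have Y1: "Y \<ge> 1" by (simp add: Y_def)
  obtain R \<tau> where R: "R \<ge> Y" "sets \<tau> = sets borel" "prob_space \<tau>" "AE z in \<tau>. z \<in> E" "AE z in \<tau>. norm z \<le> R"
    "\<And>w. lpot (4 * R) \<tau> w \<le> ennreal (5 + (1 - \<beta> + e) * ln R)"
    "ln (4 * R) - (5 + (1 - \<beta> + e) * ln R) \<ge> (\<beta> - e) * ln R - 5" "5 + (1 - \<beta> + e) * ln R \<ge> 1"
    using exists_potential[OF e(4) Y1] by metis
  define \<Lambda> where "\<Lambda> = 5 + (1 - \<beta> + e) * ln R"
  interpret prob_space \<tau> by fact
  have sp: "space \<tau> = UNIV" using sets_eq_imp_space_eq[OF R(2)] by simp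
  have R1: "R \<ge> 1" using R Y1 by simp
  have bp: "bounded_potential \<tau> R \<Lambda> 1"
    using R R1 finite_measure_axioms prob_space by (intro bounded_potential.intro) (auto simp: \<Lambda>_def sp)
  have lnR: "ln R \<ge> 0" using R1 by simp
  have lnRT: "(\<beta> - e) * ln R \<ge> 5 + ln T"
  proof -
    have "exp (5 + ln T) powr (1 / (\<beta> - e)) \<le> R" using R(1) by (simp add: Y_def)
    then have "ln (exp (5 + ln T) powr (1 / (\<beta> - e))) \<le> ln R" by (subst ln_le_cancel_iff) (use R1 in auto)
    then show ?thesis using e by (simp add: ln_powr field_simps)
  qed
  have lnRc: "ln R * ?F e > const"
  proof -
    have "exp (\<bar>const\<bar> / ?F e + 1) \<le> R" using R(1) by (simp add: Y_def)
    then have "\<bar>const\<bar> / ?F e + 1 \<le> ln R" using R1 by (subst ln_ge_iff) auto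
    then have "\<bar>const\<bar> / ?F e < ln R" by linarith
    then show ?thesis using e(1) by (simp add: pos_divide_less_eq)
  qed
  have "eventually (\<lambda>S. S \<ge> 2 * R \<and> eventually (\<lambda>n. R * norm (tail_sum (P n) S) + 2 * R\<^sup>2 * star_degree (P n) / S \<le> 1 * k n) sequentially) at_top"
    using error_eventually[of R 1] R1 by (intro eventually_conj eventually_ge_at_top) auto
  then obtain S where S: "S \<ge> 2 * R" "eventually (\<lambda>n. R * norm (tail_sum (P n) S) + 2 * R\<^sup>2 * star_degree (P n) / S \<le> 1 * k n) sequentially"
    using eventually_happens'[OF trivial_limit_at_top_linorder] by blast
  define c where "c = B' + (\<kappa> - e) * ((\<beta> - e) * ln R - 5 - ln T) - 2 * e * \<Lambda> - 1"
  have "frequently (\<lambda>n. c * k n \<le> integral\<^sup>L \<tau> (\<lambda>z. ln (norm (P n z)))) sequentially"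
  proof (rule frequently_elim1[OF frequently_conj_eventually[OF frT eventually_conj[OF evS[of S] S(2)]]], elim conjE)
    fix n
    assume a1: "(\<kappa> - e) * k n \<le> zcount (P n) T" and a2: "zcount (P n) S \<le> (\<kappa> + e) * k n"
      and a3: "R * norm (tail_sum (P n) S) + 2 * R\<^sup>2 * star_degree (P n) / S \<le> 1 * k n"
    interpret gp: genus_zero_potential "P n" \<tau> R \<Lambda> 1
      by (intro genus_zero_potential.intro gz bp)
    let ?D = "(\<beta> - e) * ln R - 5 - ln T"
    have "T \<le> R" using R(1) by (simp add: Y_def)
    then have "1 * ln gp.C1 + zcount (P n) T * (1 * ln (4 * R) - \<Lambda> - 1 * ln T)
     - (zcount (P n) S - zcount (P n) T) * \<Lambda> - (R * norm (tail_sum (P n) S) + 2 * R\<^sup>2 * star_degree (P n) / S)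
       \<le> integral\<^sup>L \<tau> (\<lambda>z. ln (norm (P n z)))"
      using T1' R1 S(1) by (intro gp.integral_ln_norm_ge) auto
    moreover have "zcount (P n) T * (1 * ln (4 * R) - \<Lambda> - 1 * ln T) \<ge> ((\<kappa> - e) * k n) * ?D"
    proof (rule mult_mono[OF a1])
      show "?D \<le> 1 * ln (4 * R) - \<Lambda> - 1 * ln T" using R(7) by (simp add: \<Lambda>_def)
      show "0 \<le> ?D" using lnRT by simp
    qed (rule gp.zcount_nonneg)
    moreover have "(zcount (P n) S - zcount (P n) T) * \<Lambda> \<le> (2 * e * k n) * \<Lambda>"
    proof (rule mult_right_mono)
      show "zcount (P n) S - zcount (P n) T \<le> 2 * e * k n" using a1 a2 by (simp add: algebra_simps)
      show "0 \<le> \<Lambda>" using R(8) by (simp add: \<Lambda>_def)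
    qed
    moreover have "c * k n = B' * k n + ((\<kappa> - e) * k n) * ?D - (2 * e * k n) * \<Lambda> - k n"
      unfolding c_def by (simp add: algebra_simps)
    ultimately show "c * k n \<le> integral\<^sup>L \<tau> (\<lambda>z. ln (norm (P n z)))"
      using lower[of n] a3 by linarith
  qed
  then have "c \<le> 1 * (Q + (g + e) * ln R)"
  proof (rule integrated_upper_bound[OF bp, rotated])
    show "AE z in \<tau>. z \<in> E \<and> ln 2 + ln (h (norm z)) \<le> Q + (g + e) * ln R \<or> z \<in> E \<and> B + norm z \<le> Q + (g + e) * ln R"
      using R(4,5)
    proof eventually_elim
      case (elim z)
      have nn: "0 \<le> (g + e) * ln R" using g e lnR by simp
      show ?case
      proof (cases "norm z \<ge> max R0 1")
        case True
        have "ln (norm z) \<le> ln R" using True elim by (subst ln_le_cancel_iff) auto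
        then have "(g + e) * ln (norm z) \<le> (g + e) * ln R" using g e by (intro mult_left_mono) auto
        then have "ln (h (norm z)) \<le> (g + e) * ln R" using R0[of "norm z"] True by simp
        moreover have "ln 2 \<le> Q" using ln_2_less_1 by (simp add: Q_def)
        ultimately show ?thesis using elim by simp
      next
        case False
        then have "B + norm z \<le> Q" by (auto simp: Q_def)
        then show ?thesis using elim nn by linarith
      qed
    qed
  qed
  then have "ln R * ?F e \<le> const" unfolding c_def \<Lambda>_def const_def by (simp add: algebra_simps)
  then show False using lnRc by linarith
qed

text \<open>With negligible zeros, the average of ln |P_n| / k_n over any part of the measure is
  almost at least \<open>B'\<close>, while far out in \<open>E\<close> the bound g ln |z| pushes it
  below B' - 1. The measure does charge the exterior of the disc of radius \<open>R0\<close>: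
  otherwise its potential at 0 would exceed \<Lambda>.\<close>

lemma zcount_negligible_contradiction:
  assumes zero: "\<And>e S. e > 0 \<Longrightarrow> eventually (\<lambda>n. zcount (P n) S \<le> e * k n) sequentially"
    and g: "g < 0" and hg: "eventually (\<lambda>r. ln (h r) \<le> g * ln r) at_top"
  shows False
proof -
  obtain R1 where R1: "\<And>r. r \<ge> R1 \<Longrightarrow> ln (h r) \<le> g * ln r" using hg by (auto simp: eventually_at_top_linorder)
  \<comment> \<open>Makes ln 2 + g ln R0 at most B' - 1; multiplying by the negative
    \<open>g\<close> reverses the inequality.\<close>
  define R0 where "R0 = max (max 1 R1) (exp ((B' - 1 - ln 2) / g))"
  have R0: "R0 \<ge> 1" "R0 \<ge> R1" "exp ((B' - 1 - ln 2) / g) \<le> R0" by (auto simp: R0_def)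
  have "(B' - 1 - ln 2) / g \<le> ln R0" using R0 by (subst ln_ge_iff) auto
  then have "g * ln R0 \<le> g * ((B' - 1 - ln 2) / g)" using g by (intro mult_left_mono_neg) auto
  then have H: "ln 2 + g * ln R0 \<le> B' - 1" using g by simp
  \<comment> \<open>Ensures \<beta> / 2 * ln R \<ge> 6 + ln R0, and thereby ln (4 R / R0) >
    \<Lambda>.\<close>
  define X where "X = max 1 (exp (2 / \<beta> * (6 + ln R0)))"
  have X1: "X \<ge> 1" by (simp add: X_def)
  have e: "0 < \<beta> / 2" using \<beta> by simp
  obtain R \<tau> where R: "R \<ge> X" "sets \<tau> = sets borel" "prob_space \<tau>" "AE z in \<tau>. z \<in> E" "AE z in \<tau>. norm z \<le> R"
    "\<And>w. lpot (4 * R) \<tau> w \<le> ennreal (5 + (1 - \<beta> + \<beta> / 2) * ln R)" "5 + (1 - \<beta> + \<beta> / 2) * ln R \<ge> 1"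
    using exists_potential[OF e X1] by metis
  define \<Lambda> where "\<Lambda> = 5 + (1 - \<beta> + \<beta> / 2) * ln R"
  note [measurable_cong] = R(2)
  interpret prob_space \<tau> by fact
  have sp: "space \<tau> = UNIV" using sets_eq_imp_space_eq[OF R(2)] by simp
  have R1': "R \<ge> 1" using R X1 by simp
  have lnR: "\<beta> / 2 * ln R \<ge> 6 + ln R0"
  proof -
    have "exp (2 / \<beta> * (6 + ln R0)) \<le> R" using R(1) by (simp add: X_def)
    then have "2 / \<beta> * (6 + ln R0) \<le> ln R" using R1' by (subst ln_ge_iff) auto
    then show ?thesis using \<beta> by (simp add: field_simps)
  qed
  let ?A = "{z. R0 < norm z} :: complex set"
  have [measurable]: "?A \<in> sets borel" by measurable
  define p where "p = measure \<tau> ?A"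
  have p0: "p > 0"
  proof (rule ccontr)
    assume "\<not> p > 0"
    then have "emeasure \<tau> ?A = 0" by (simp add: p_def emeasure_eq_measure not_less measure_le_0_iff)
    then have "AE z in \<tau>. z \<notin> ?A" by (intro AE_not_in) (auto simp: null_sets_def R(2))
    then have "ennreal (ln (4 * R / R0)) \<le> (\<integral>\<^sup>+z. lkern (4 * R) 0 z \<partial>\<tau>)"
    proof -
      have "ennreal (ln (4 * R / R0)) = (\<integral>\<^sup>+z. ennreal (ln (4 * R / R0)) \<partial>\<tau>)" by (simp add: emeasure_space_1)
      also have "\<dots> \<le> (\<integral>\<^sup>+z. lkern (4 * R) 0 z \<partial>\<tau>)"
      proof (rule nn_integral_mono_AE)
        show "AE z in \<tau>. ennreal (ln (4 * R / R0)) \<le> lkern (4 * R) 0 z"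
          using \<open>AE z in \<tau>. z \<notin> ?A\<close>
        proof eventually_elim
          case (elim z)
          show ?case
          proof (cases "z = 0")
            case False
            have "ln (4 * R / R0) \<le> ln (4 * R / norm z)"
            proof (subst ln_le_cancel_iff)
              show "4 * R / R0 \<le> 4 * R / norm z" using elim False R0 R1' by (intro divide_left_mono mult_pos_pos) auto
            qed (use False R1' R0 in auto)
            then show ?thesis using False by (auto simp: lkern_def intro: ennreal_leI)
          qed (simp add: lkern_def)
        qed
      qed
      finally show ?thesis .
    qed
    also have "\<dots> \<le> ennreal \<Lambda>" using R(6)[of 0] by (simp add: lpot_def \<Lambda>_def)
    finally have "ln (4 * R / R0) \<le> \<Lambda>" using R(7) by (subst (asm) ennreal_le_iff) (auto simp: \<Lambda>_def)
    moreover have "ln (4 * R / R0) = ln 4 + ln R - ln R0" using R1' R0 by (simp add: ln_div ln_mult)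
    moreover have "ln (4::real) \<ge> 0" by simp
    moreover have "\<Lambda> = 5 + ln R - \<beta> / 2 * ln R" by (simp add: \<Lambda>_def algebra_simps)
    ultimately show False using lnR by linarith
  qed
  define \<tau>1 where "\<tau>1 = density \<tau> (indicator ?A)"
  have \<tau>1s: "sets \<tau>1 = sets borel" by (simp add: \<tau>1_def R(2))
  have \<tau>1e: "emeasure \<tau>1 UNIV = ennreal p"
    unfolding \<tau>1_def by (subst emeasure_density) (auto simp: p_def emeasure_eq_measure R(2))
  have AE1: "AE z in \<tau>1. z \<in> ?A \<and> z \<in> E \<and> norm z \<le> R"
    unfolding \<tau>1_def
  proof (subst AE_density)
    show "AE z in \<tau>. 0 < (indicator ?A z :: ennreal) \<longrightarrow> z \<in> ?A \<and> z \<in> E \<and> norm z \<le> R"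
      using R(4,5) by eventually_elim (auto simp: indicator_def)
  qed measurable
  have bp: "bounded_potential \<tau>1 R \<Lambda> p"
  proof (rule bounded_potential.intro)
    show "finite_measure \<tau>1" by (rule finite_measureI) (use \<tau>1e in \<open>simp add: \<tau>1_def sp\<close>)
    show "measure \<tau>1 UNIV = p" using \<tau>1e by (simp add: measure_def p_def)
    show "p \<le> 1" by (simp add: p_def)
    show "AE z in \<tau>1. norm z \<le> R" using AE1 by eventually_elim auto
    show "lpot (4 * R) \<tau>1 w \<le> ennreal \<Lambda>" for w
    proof -
      have "lpot (4 * R) \<tau>1 w = (\<integral>\<^sup>+z. indicator ?A z * lkern (4 * R) w z \<partial>\<tau>)"
        unfolding lpot_def \<tau>1_def by (subst nn_integral_density) auto
      also have "\<dots> \<le> lpot (4 * R) \<tau> w"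
        unfolding lpot_def by (intro nn_integral_mono) (auto simp: indicator_def)
      also have "\<dots> \<le> ennreal \<Lambda>" using R(6) by (simp add: \<Lambda>_def)
      finally show ?thesis .
    qed
    show "1 \<le> \<Lambda>" using R(7) by (simp add: \<Lambda>_def)
  qed (use R1' \<tau>1s in auto)
  have \<Lambda>1: "\<Lambda> \<ge> 1" using R(7) by (simp add: \<Lambda>_def)
  have "eventually (\<lambda>S. S \<ge> 2 * R \<and> eventually (\<lambda>n. R * norm (tail_sum (P n) S) + 2 * R\<^sup>2 * star_degree (P n) / S \<le> p / 4 * k n) sequentially) at_top"
    using error_eventually[of R "p / 4"] R1' p0 by (intro eventually_conj eventually_ge_at_top) auto
  then obtain S where S: "S \<ge> 2 * R" "eventually (\<lambda>n. R * norm (tail_sum (P n) S) + 2 * R\<^sup>2 * star_degree (P n) / S \<le> p / 4 * k n) sequentially"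
    using eventually_happens'[OF trivial_limit_at_top_linorder] by blast
  \<comment> \<open>Per unit of \<open>k n\<close>, the zeros cost at most p / 4 and the tail error
    another p / 4: together half of the gap between p B' and p (B' - 1).\<close>
  have "eventually (\<lambda>n. zcount (P n) S \<le> p / (4 * \<Lambda>) * k n) sequentially"
    using p0 \<Lambda>1 by (intro zero) auto
  then have "eventually (\<lambda>n. (p * B' - p / 2) * k n \<le> integral\<^sup>L \<tau>1 (\<lambda>z. ln (norm (P n z)))) sequentially"
    using S(2)
  proof eventually_elim
    case (elim n)
    interpret gp: genus_zero_potential "P n" \<tau>1 R \<Lambda> p
      by (intro genus_zero_potential.intro gz bp)
    have "p * ln gp.C1 + zcount (P n) 1 * (p * ln (4 * R) - \<Lambda> - p * ln 1)
     - (zcount (P n) S - zcount (P n) 1) * \<Lambda> - (R * norm (tail_sum (P n) S) + 2 * R\<^sup>2 * star_degree (P n) / S)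
       \<le> integral\<^sup>L \<tau>1 (\<lambda>z. ln (norm (P n z)))"
      using R1' S(1) by (intro gp.integral_ln_norm_ge) auto
    moreover have "zcount (P n) 1 * (p * ln (4 * R) - \<Lambda> - p * ln 1) - (zcount (P n) S - zcount (P n) 1) * \<Lambda>
      = zcount (P n) 1 * (p * ln (4 * R)) - zcount (P n) S * \<Lambda>" by (simp add: algebra_simps)
    moreover have "zcount (P n) 1 * (p * ln (4 * R)) \<ge> 0" using gp.zcount_nonneg p0 R1' by (intro mult_nonneg_nonneg) auto
    moreover have "zcount (P n) S * \<Lambda> \<le> p / (4 * \<Lambda>) * k n * \<Lambda>" using elim(1) \<Lambda>1 by (intro mult_right_mono) auto
    moreover have "p / (4 * \<Lambda>) * k n * \<Lambda> = p / 4 * k n" using \<Lambda>1 by simp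
    moreover have "p * (B' * k n) \<le> p * ln gp.C1" using lower[of n] p0 by (intro mult_left_mono) auto
    moreover have "(p * B' - p / 2) * k n = p * (B' * k n) - p / 4 * k n - p / 4 * k n" by (simp add: algebra_simps)
    ultimately show ?case using elim(2) by linarith
  qed
  then have "frequently (\<lambda>n. (p * B' - p / 2) * k n \<le> integral\<^sup>L \<tau>1 (\<lambda>z. ln (norm (P n z)))) sequentially"
    by (rule eventually_frequently[OF trivial_limit_sequentially])
  then have "p * B' - p / 2 \<le> p * (B' - 1)"
  proof (rule integrated_upper_bound[OF bp, rotated])
    show "AE z in \<tau>1. z \<in> E \<and> ln 2 + ln (h (norm z)) \<le> B' - 1 \<or> z \<in> E \<and> B + norm z \<le> B' - 1"
      using AE1
    proof eventually_elim
      case (elim z)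
      have "ln (h (norm z)) \<le> g * ln (norm z)" using elim R0 by (intro R1) auto
      also have "ln R0 \<le> ln (norm z)" using elim R0 by (subst ln_le_cancel_iff) auto
      then have "g * ln (norm z) \<le> g * ln R0" using g by (intro mult_left_mono_neg) auto
      finally show ?case using H elim by auto
    qed
  qed
  then show False using p0 by (simp add: algebra_simps)
qed

text \<open>For \<gamma> < 0 the bound on \<open>h\<close> with exponent 0 already forces the zeros
  to have density 0, and the still negative exponent \<gamma> / 2 then contradicts the lower bound
  on the geometric means.\<close>

lemma zcount_growth_contradiction:
  assumes hg: "\<And>e. e > 0 \<Longrightarrow> eventually (\<lambda>r. ln (h r) \<le> (\<gamma> + e) * ln r) at_top"
    and x: "x > \<gamma> / \<beta>" and ev: "eventually (\<lambda>T. eventually (\<lambda>n. x * k n \<le> zcount (P n) T) sequentially) at_top"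
  shows False
proof (cases "\<gamma> \<ge> 0")
  case True
  obtain y where y: "\<gamma> / \<beta> < y" "y < x" using dense[OF x] by auto
  obtain T where "eventually (\<lambda>n. x * k n \<le> zcount (P n) T) sequentially"
    using eventually_happens'[OF trivial_limit_at_top_linorder ev] by blast
  moreover have "eventually (\<lambda>n. zcount (P n) T \<le> y * k n) sequentially" by (rule zcount_upper[OF True hg y(1)])
  ultimately have "eventually (\<lambda>n. x * k n \<le> y * k n) sequentially" by eventually_elim linarith
  then obtain n where "x * k n \<le> y * k n" using eventually_happens'[OF trivial_limit_sequentially] by blast
  then show False using y k[of n] by simp
next
  case False
  have h0: "eventually (\<lambda>r. ln (h r) \<le> (0 + e) * ln r) at_top" if "e > 0" for e
    using hg[OF that] eventually_ge_at_top[of 1]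
  proof eventually_elim
    case (elim r)
    have "(\<gamma> + e) * ln r \<le> (0 + e) * ln r" using False elim by (intro mult_right_mono) auto
    then show ?case using elim by linarith
  qed
  have "eventually (\<lambda>n. zcount (P n) S \<le> e * k n) sequentially" if "e > 0" for e S
    by (rule zcount_upper[OF order_refl h0]) (use that in auto)
  moreover have "eventually (\<lambda>r. ln (h r) \<le> \<gamma> / 2 * ln r) at_top"
    using hg[of "- \<gamma> / 2"] False by simp
  ultimately show False using zcount_negligible_contradiction[of "\<gamma> / 2"] False by simp
qed

end

section \<open>The growth bound\<close>

lemma less_powr_inverse_imp:
  fixes a x k :: real
  assumes "0 < a" "0 \<le> x" "0 < k" "a < x powr (1 / k)"
  shows "a powr k < x"
proof (rule ccontr)
  assume "\<not> a powr k < x"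
  then have "x powr (1 / k) \<le> (a powr k) powr (1 / k)" using assms by (intro powr_mono2) auto
  then show False using assms by (simp add: powr_powr)
qed

lemma powr_inverse_less_imp_ln_le:
  fixes a x k :: real
  assumes "0 < a" "0 < x" "0 < k" "x powr (1 / k) < a"
  shows "ln x \<le> ln a * k"
proof -
  have "ln (x powr (1 / k)) \<le> ln a" using assms by (subst ln_le_cancel_iff) auto
  then show ?thesis using assms by (simp add: ln_powr field_simps)
qed

lemma bdd_above_norm_cball:
  fixes f :: "complex \<Rightarrow> complex"
  assumes "f holomorphic_on UNIV"
  shows "bdd_above ((\<lambda>z. norm (f z)) ` cball 0 R)"
proof -
  have "compact ((\<lambda>z. norm (f z)) ` cball 0 R)"
    by (intro compact_continuous_image continuous_intros holomorphic_on_imp_continuous_on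
        holomorphic_on_subset[OF assms]) auto
  then show ?thesis by (intro bounded_imp_bdd_above compact_imp_bounded)
qed

lemma disc_norm_less_imp:
  assumes "f holomorphic_on UNIV" "R \<ge> 0" "a < disc_norm f R"
  shows "\<exists>z. norm z \<le> R \<and> a < norm (f z)"
proof -
  have "\<exists>z\<in>cball 0 R. a < norm (f z)"
    using assms(2,3) bdd_above_norm_cball[OF assms(1)] unfolding disc_norm_def
    by (subst (asm) less_cSUP_iff) auto
  then show ?thesis by auto
qed

lemma disc_norm_nonneg:
  assumes "f holomorphic_on UNIV" "R \<ge> 0"
  shows "disc_norm f R \<ge> 0"
proof (rule ccontr)
  assume neg: "\<not> disc_norm f R \<ge> 0"
  have "norm (f 0) \<le> disc_norm f R"
    unfolding disc_norm_def using assms(2) bdd_above_norm_cball[OF assms(1)] by (intro cSUP_upper) auto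
  then show False using neg norm_ge_zero[of "f 0"] by linarith
qed

lemma limsup_nonneg:
  assumes "\<And>n. 0 \<le> u n"
  shows "0 \<le> limsup (\<lambda>n. ereal (u n))"
proof -
  have "0 \<le> liminf (\<lambda>n. ereal (u n))" using assms by (intro Liminf_bounded) auto
  also have "\<dots> \<le> limsup (\<lambda>n. ereal (u n))" by (rule Liminf_le_Limsup) simp
  finally show ?thesis .
qed

theorem theorem3:
  fixes k :: "nat \<Rightarrow> real" and P :: "nat \<Rightarrow> complex \<Rightarrow> complex"
    and E :: "complex set" and \<beta> \<gamma> :: real and h :: "real \<Rightarrow> real"
  assumes "\<And>n. k n > 0"
    and "\<And>n. genus_zero (P n)"
    and "\<And>n. k n \<ge> star_degree (P n)"
    and "closed E"
    and "Limsup at_top (\<lambda>R::real. ereal_ln (log_capacity (E \<inter> cball 0 R)) / ereal (ln R)) = ereal \<beta>"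
    and "\<beta> > 0"
    and "((\<lambda>R::real. limsup (\<lambda>n. ereal (norm (tail_sum (P n) R) / k n))) \<longlongrightarrow> 0) at_top"
    and "\<exists>r :: nat \<Rightarrow> real. (\<forall>n. r n > 0) \<and> filterlim r at_top sequentially
           \<and> limsup (\<lambda>n. ereal (zero_count (P n) (r n) / k n)) < \<infinity>"
    and "\<And>R. R \<ge> 0 \<Longrightarrow> h R > 0"
    and "Limsup at_top (\<lambda>R::real. ereal (ln (h R) / ln R)) \<le> ereal \<gamma>"
    and "\<And>z. z \<in> E \<Longrightarrow> limsup (\<lambda>n. ereal (norm (P n z) powr (1 / k n))) \<le> ereal (h (norm z))"
  shows "\<forall>R>0. limsup (\<lambda>n. ereal (disc_norm (P n) R powr (1 / k n)))
           \<le> limsup (\<lambda>n. ereal (circle_geo_mean (P n) 1 powr (1 / k n)))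
             * ereal ((1 + R) powr (\<gamma> / \<beta>))"
proof (intro allI impI, rule ccontr)
  fix R :: real assume R: "R > 0"
  note k = assms(1) and gz = assms(2) and star = assms(3) and \<beta> = assms(6)
  let ?f = "(1 + R) powr (\<gamma> / \<beta>)"
  let ?C = "\<lambda>n. circle_geo_mean (P n) 1"
  let ?lim = "limsup (\<lambda>n. ereal (?C n powr (1 / k n)))"
  let ?L = "limsup (\<lambda>n. ereal (disc_norm (P n) R powr (1 / k n)))"
  have f: "?f > 0" using R by simp
  have gf: "genus_zero_function (P n)" for n by unfold_locales (rule gz)
  have Cp: "?C n > 0" for n by (simp add: circle_geo_mean_def)
  assume "\<not> ?L \<le> ?lim * ereal ?f"
  then have lt: "?lim * ereal ?f < ?L" by simp
  have "?lim \<noteq> \<infinity>" using lt f by auto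
  moreover have "0 \<le> ?lim" by (rule limsup_nonneg) simp
  ultimately obtain c where c: "?lim = ereal c" "c \<ge> 0" by (cases ?lim) auto
  \<comment> \<open>The strict inequality is split into gaps: \<open>a\<close> below the norms,
    \<open>c0\<close> above the geometric means and positive even if \<open>c\<close> is 0, and
    later \<open>x\<close> strictly between \<gamma> / \<beta> and (A - B) / ln (1 + R).\<close>
  obtain a where a: "ereal (c * ?f) < ereal a" "ereal a < ?L"
    using ereal_dense2[of "ereal (c * ?f)" ?L] lt c by auto
  have "0 \<le> c * ?f" using c(2) by simp
  then have a0: "a > 0" using a(1) by (simp del: zero_le_mult_iff)
  have "c < a / ?f" using a(1) f by (simp add: pos_less_divide_eq)
  then obtain c0 where c0: "c < c0" "c0 < a / ?f" using dense by blast
  have c0p: "c0 > 0" using c c0 by simp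
  define A B where "A = ln a" and "B = ln c0"
  have l1R: "ln (1 + R) > 0" using R by simp
  have "ln (c0 * ?f) < ln a" using c0 f c0p a0 by (subst ln_less_cancel_iff) (auto simp: pos_less_divide_eq)
  then have "\<gamma> / \<beta> * ln (1 + R) < A - B" using f c0p R by (simp add: A_def B_def ln_mult ln_powr)
  then have "\<gamma> / \<beta> < (A - B) / ln (1 + R)" using l1R by (simp add: pos_less_divide_eq)
  then obtain x where x: "\<gamma> / \<beta> < x" "x < (A - B) / ln (1 + R)" using dense by blast
  have xAB: "x * ln (1 + R) < A - B" using x(2) l1R by (simp add: pos_less_divide_eq)

  have evC: "eventually (\<lambda>n. ?C n powr (1 / k n) < c0) sequentially"
    using Limsup_lessD[of sequentially "\<lambda>n. ereal (?C n powr (1 / k n))" "ereal c0"] c c0 by simp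
  have frL: "frequently (\<lambda>n. a < disc_norm (P n) R powr (1 / k n)) sequentially"
  proof (rule ccontr)
    assume "\<not> ?thesis"
    then have "eventually (\<lambda>n. ereal (disc_norm (P n) R powr (1 / k n)) \<le> ereal a) sequentially"
      by (simp add: frequently_def not_less)
    then have "?L \<le> ereal a" by (rule Limsup_bounded)
    then show False using a(2) by simp
  qed
  have "frequently (\<lambda>n. a < disc_norm (P n) R powr (1 / k n) \<and> ?C n powr (1 / k n) < c0) sequentially"
    by (rule frequently_conj_eventually[OF frL evC])
  then have "\<not> eventually (\<lambda>n. \<not> (a < disc_norm (P n) R powr (1 / k n) \<and> ?C n powr (1 / k n) < c0)) sequentially"
    by (simp add: frequently_def)
  from not_eventually_sequentiallyD[OF this] obtain r :: "nat \<Rightarrow> nat" where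
    r: "strict_mono r" "\<forall>n. a < disc_norm (P (r n)) R powr (1 / k (r n)) \<and> ?C (r n) powr (1 / k (r n)) < c0"
    by auto
  have upper: "ln (?C (r n)) \<le> B * k (r n)" for n
    unfolding B_def using r(2) c0p Cp k by (intro powr_inverse_less_imp_ln_le) auto
  have "\<exists>z. norm z \<le> R \<and> P (r n) z \<noteq> 0 \<and> A * k (r n) \<le> ln (norm (P (r n) z))" for n
  proof -
    have hol: "P (r n) holomorphic_on UNIV" using gz by (simp add: genus_zero_def)
    have "a powr k (r n) < disc_norm (P (r n)) R"
      using r(2) a0 k disc_norm_nonneg[OF hol, of R] R by (intro less_powr_inverse_imp) auto
    then obtain z where z: "norm z \<le> R" "a powr k (r n) < norm (P (r n) z)"
      using disc_norm_less_imp[OF hol less_imp_le[OF R]] by blast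
    have pz: "P (r n) z \<noteq> 0" using z(2) a0 by auto
    have "ln (a powr k (r n)) \<le> ln (norm (P (r n) z))" using z(2) a0 pz by (subst ln_le_cancel_iff) auto
    then show ?thesis using z pz a0 by (auto simp: A_def ln_powr mult.commute)
  qed
  then obtain \<zeta> where \<zeta>: "\<And>n. norm (\<zeta> n) \<le> R" "\<And>n. P (r n) (\<zeta> n) \<noteq> 0" "\<And>n. A * k (r n) \<le> ln (norm (P (r n) (\<zeta> n)))"
    by metis
  \<comment> \<open>A large value on the disc of radius \<open>R\<close> forces a large geometric
    mean, because |P_n(z)| is at most the geometric mean times exp (k_n |z|).\<close>
  have lower: "(A - R) * k (r n) \<le> ln (?C (r n))" for n
  proof -
    interpret f: genus_zero_function "P (r n)" by (rule gf)
    have "ln (norm (P (r n) (\<zeta> n))) \<le> ln (f.C1 * exp (star_degree (P (r n)) * norm (\<zeta> n)))"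
      using f.norm_le_exp_star_degree[of "\<zeta> n"] \<zeta>(2)[of n] f.C1_pos by (subst ln_le_cancel_iff) auto
    also have "\<dots> = ln f.C1 + star_degree (P (r n)) * norm (\<zeta> n)" using f.C1_pos by (simp add: ln_mult)
    also have "star_degree (P (r n)) * norm (\<zeta> n) \<le> k (r n) * R"
      using star \<zeta>(1) k[of "r n"] by (intro mult_mono) auto
    finally show ?thesis using \<zeta>(3)[of n] by (simp add: algebra_simps)
  qed

  have cap: "frequently (\<lambda>R. R powr (\<beta> - e) \<le> log_capacity (E \<inter> cball 0 R)) at_top" if e: "e > 0" for e
  proof (rule ccontr)
    assume "\<not> ?thesis"
    then have "eventually (\<lambda>R. log_capacity (E \<inter> cball 0 R) < R powr (\<beta> - e)) at_top"
      by (simp add: frequently_def not_le)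
    then have "eventually (\<lambda>R::real. ereal_ln (log_capacity (E \<inter> cball 0 R)) / ereal (ln R) \<le> ereal (\<beta> - e)) at_top"
      using eventually_gt_at_top[of 1]
    proof eventually_elim
      case (elim S)
      let ?c = "log_capacity (E \<inter> cball 0 S)"
      have lS: "ln S > 0" using elim by simp
      show ?case
      proof (cases "?c \<le> 0")
        case True
        then show ?thesis using lS by (simp add: ereal_ln_def)
      next
        case False
        have "ln ?c \<le> ln (S powr (\<beta> - e))" using False elim by (subst ln_le_cancel_iff) auto
        then have "ln ?c / ln S \<le> \<beta> - e" using lS elim by (simp add: ln_powr pos_divide_le_eq)
        then show ?thesis using False lS by (simp add: ereal_ln_def)
      qed
    qed
    then have "ereal \<beta> \<le> ereal (\<beta> - e)" unfolding assms(5)[symmetric] by (rule Limsup_bounded)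
    then show False using e by simp
  qed
  have tail: "eventually (\<lambda>S. eventually (\<lambda>n. norm (tail_sum (P n) S) \<le> e * k n) sequentially) at_top" if e: "e > 0" for e
  proof -
    have "eventually (\<lambda>S. limsup (\<lambda>n. ereal (norm (tail_sum (P n) S) / k n)) < ereal e) at_top"
      using order_tendstoD(2)[OF assms(7), of "ereal e"] e by simp
    then show ?thesis
    proof eventually_elim
      case (elim S)
      from Limsup_lessD[OF elim] show ?case
        by eventually_elim (use k in \<open>simp add: pos_divide_less_eq less_imp_le\<close>)
    qed
  qed
  obtain rr where rr: "filterlim rr at_top sequentially" "limsup (\<lambda>n. ereal (zero_count (P n) (rr n) / k n)) < \<infinity>"
    using assms(8) by blast
  obtain M0 where M0: "limsup (\<lambda>n. ereal (zero_count (P n) (rr n) / k n)) < ereal M0"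
    using rr(2) less_PInf_Ex_of_nat by (metis ereal_dense2)
  \<comment> \<open>The 1 pays for the multiplicity of the origin, through the star degree.\<close>
  have count: "eventually (\<lambda>n. zcount (P n) T \<le> (1 + M0) * k n) sequentially" for T
  proof -
    have "eventually (\<lambda>n. T \<le> rr n) sequentially" using rr(1) by (simp add: filterlim_at_top)
    then show ?thesis using Limsup_lessD[OF M0]
    proof eventually_elim
      case (elim n)
      interpret f: genus_zero_function "P n" by (rule gf)
      have "zcount (P n) T \<le> star_degree (P n) + zero_count (P n) (rr n)" by (rule f.zcount_le_zero_count) fact
      moreover have "zero_count (P n) (rr n) \<le> M0 * k n" using elim(2) k[of n] by (simp add: pos_divide_less_eq)
      ultimately show ?case using star[of n] by (simp add: algebra_simps)
    qed
  qed
  have small: "eventually (\<lambda>n. P n z \<noteq> 0 \<longrightarrow> ln (norm (P n z)) \<le> k n * (ln 2 + ln (h (norm z)))) sequentially" if z: "z \<in> E" for z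
  proof -
    have hp: "h (norm z) > 0" by (rule assms(9)) simp
    \<comment> \<open>The factor 2 turns the non-strict bound on the limsup into one that holds
      eventually; it is the origin of the ln 2.\<close>
    have "limsup (\<lambda>n. ereal (norm (P n z) powr (1 / k n))) < ereal (2 * h (norm z))"
      using hp by (intro le_less_trans[OF assms(11)[OF z]]) simp
    from Limsup_lessD[OF this] show ?thesis
    proof eventually_elim
      case (elim n)
      show ?case
      proof
        assume "P n z \<noteq> 0"
        then have "ln (norm (P n z)) \<le> ln (2 * h (norm z)) * k n"
          using elim hp k by (intro powr_inverse_less_imp_ln_le) auto
        then show "ln (norm (P n z)) \<le> k n * (ln 2 + ln (h (norm z)))" using hp by (simp add: ln_mult mult.commute)
      qed
    qed
  qed
  have hg: "eventually (\<lambda>r. ln (h r) \<le> (\<gamma> + e) * ln r) at_top" if e: "e > 0" for e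
  proof -
    have "Limsup at_top (\<lambda>R::real. ereal (ln (h R) / ln R)) < ereal (\<gamma> + e)"
      using e by (intro le_less_trans[OF assms(10)]) simp
    from Limsup_lessD[OF this] eventually_gt_at_top[of 1] show ?thesis
      by eventually_elim (simp add: pos_divide_less_eq less_imp_le)
  qed

  interpret growth_sequence "\<lambda>n. k (r n)" "\<lambda>n. P (r n)" E h \<beta> B "A - R" "1 + M0"
  proof
    show "eventually (\<lambda>S. eventually (\<lambda>n. norm (tail_sum (P (r n)) S) \<le> e * k (r n)) sequentially) at_top" if "e > 0" for e
      using tail[OF that] by eventually_elim (rule eventually_subseq[OF r(1)])
    show "eventually (\<lambda>n. zcount (P (r n)) T \<le> (1 + M0) * k (r n)) sequentially" for T
      by (rule eventually_subseq[OF r(1) count])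
    show "eventually (\<lambda>n. P (r n) z \<noteq> 0 \<longrightarrow> ln (norm (P (r n) z)) \<le> k (r n) * (ln 2 + ln (h (norm z)))) sequentially" if "z \<in> E" for z
      by (rule eventually_subseq[OF r(1) small[OF that]])
  qed (use k gz star \<beta> assms(4) cap upper lower in auto)
  \<comment> \<open>The slack in the choice of \<open>x\<close> pays for the tail error.\<close>
  have d0: "A - B - x * ln (1 + R) > 0" using xAB by simp
  \<comment> \<open>The pointwise upper bound at \<open>\<zeta> n\<close> is read backwards: to get
    from B k_n to A k_n at a gain of at most ln (1 + R) per zero, at least x k_n zeros are
    required.\<close>
  have "eventually (\<lambda>T. eventually (\<lambda>n. x * k (r n) \<le> zcount (P (r n)) T) sequentially) at_top"
    using error_eventually[OF less_imp_le[OF R] d0] eventually_ge_at_top[of "max 2 (2 * R)"]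
  proof eventually_elim
    case (elim T)
    from elim(1) show ?case
    proof eventually_elim
      case (elim n)
      interpret f: genus_zero_function "P (r n)" by (rule gf)
      let ?z = "\<zeta> n"
      have T: "T \<ge> 2" "T \<ge> 2 * R" using \<open>max 2 (2 * R) \<le> T\<close> by auto
      have "ln (norm (P (r n) ?z)) \<le> ln f.C1 + zcount (P (r n)) T * ln (1 + norm ?z) + norm ?z * norm (tail_sum (P (r n)) T) + 2 * (norm ?z)\<^sup>2 * star_degree (P (r n)) / T"
        using T \<zeta>(1)[of n] by (intro f.ln_norm_upper \<zeta>) auto
      moreover have "zcount (P (r n)) T * ln (1 + norm ?z) \<le> zcount (P (r n)) T * ln (1 + R)"
        using \<zeta>(1)[of n] R by (intro mult_left_mono f.zcount_nonneg) (auto simp: add_pos_nonneg)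
      moreover have "norm ?z * norm (tail_sum (P (r n)) T) \<le> R * norm (tail_sum (P (r n)) T)"
        using \<zeta>(1)[of n] by (intro mult_right_mono) auto
      moreover have "2 * (norm ?z)\<^sup>2 * star_degree (P (r n)) / T \<le> 2 * R\<^sup>2 * star_degree (P (r n)) / T"
        using \<zeta>(1)[of n] T f.star_degree_nonneg by (intro divide_right_mono mult_right_mono mult_left_mono power_mono) auto
      ultimately have "A * k (r n) \<le> B * k (r n) + zcount (P (r n)) T * ln (1 + R) + (A - B - x * ln (1 + R)) * k (r n)"
        using elim \<zeta>(3)[of n] upper[of n] by linarith
      then have "x * k (r n) * ln (1 + R) \<le> zcount (P (r n)) T * ln (1 + R)" by (simp add: algebra_simps)
      then show ?case using l1R by simp
    qed
  qed
  then show False using zcount_growth_contradiction[OF hg x(1)] by blast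
qed

end
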